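(* Let $X$ be a normed vector space. Let $\Gamma:\mathcal P(\Sigma_G^{\mathbb N})\to X$ be continuous and affine and let $\Delta:\mathcal P(\Sigma_G^{\mathbb N})\to\mathbb R$ be continuous and affine with $\Delta(\mu)\ne0$ for all $\mu\in\mathcal P(\Sigma_G^{\mathbb N})$. Define $U:\mathcal P(\Sigma_G^{\mathbb N})\to X$ by $U=\frac{\Gamma}{\Delta}$. Let $C$ be a closed and convex subset of $X$ and assume that $$\overset{\circ}{C}\cap U\big(\mathcal P_S(\Sigma_G^{\mathbb N})\big)\ne\varnothing.$$ Let $\varphi:\Sigma_G^{\mathbb N}\to\mathbb R$ be continuous. (1) The lower and upper multifractal pressures $\underline P_C^U(\varphi)$ and $\overline P_C^U(\varphi)$ coincide and their common value $P_C^U(\varphi)$ satisfies $$P_C^U(\varphi)=\sup_{\mu\in\mathcal P_S(\Sigma_G^{\mathbb N}),\ U\mu\in C}\Big(h(\mu)+\int\varphi\,d\mu\Big)=\sup_{\mu\in\mathcal P_S(\Sigma_G^{\mathbb N}),\ U\mu\in\overset{\circ}{C}}\Big(h(\mu)+\int\varphi\,d\mu\Big).$$ (2) We have $$-\log\sigma_{\mathrm{rad}}\big(\zeta_C^{\mathrm{dyn},U}(\varphi;\cdot)\big)=\sup_{\mu\in\mathcal P_S(\Sigma_G^{\mathbb N}),\ U\mu\in C}\Big(h(\mu)+\int\varphi\,d\mu\Big)=\sup_{\mu\in\mathcal P_S(\Sigma_G^{\mathbb N}),\ U\mu\in\overset{\circ}{C}}\Big(h(\mu)+\int\varphi\,d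\mu\Big).$$
   Context: $G=(V,E)$ is a fixed finite directed multigraph (vertex set $V$, edge set $E$), assumed strongly connected. For $e\in E$, $\mathrm i(e)$ and $\mathrm t(e)$ are its initial and terminal vertices. $\Sigma_G^n$ is the set of strings $e_1\ldots e_n$ of edges with $\mathrm t(e_k)=\mathrm i(e_{k+1})$ for $1\le k<n$, and $\Sigma_G^{\mathbb N}$ is the set of infinite strings $e_1e_2\ldots$ with $\mathrm t(e_k)=\mathrm i(e_{k+1})$ for all $k\ge1$, with the product topology (discrete factors). For $\mathbf u=e_1e_2\ldots\in\Sigma_G^{\mathbb N}$, $\mathbf u|n=e_1\ldots e_n$; for $\mathbf i\in\Sigma_G^n$, the cylinder is $[\mathbf i]=\{\mathbf u\in\Sigma_G^{\mathbb N}:\mathbf u|n=\mathbf i\}$. $S(e_1e_2\ldots)=e_2e_3\ldots$ is the shift. $\mathcal P(\Sigma_G^{\mathbb N})$ (resp. $\mathcal P_S(\Sigma_G^{\mathbb N})$) is the set of Borel (resp. shift-invariant Borel) probability measures on $\Sigma_G^{\mathbb N}$, with the weak topology; $h(\mu)$ is the (Kolmogorov–Sinai) entropy of $\mu\in\mathcal P_S(\Sigma_G^{\mathbb N})$ with respect to $S$. $L_n:\Sigma_G^{\mathbb N}\to\mathcal P(\Sigma_G^{\mathbb N})$ is $L_n\mathbf u=\frac1n\sum_{k=0}^{n-1}\delta_{S^k\mathbf u}$, and $UL_n[\mathbf i]=\{U(L_n\mathbf u):\mathbf u\in[\mathbf i]\}$. For $D\subseteq X$ put $$Z_n(D)=\sum_{\mathbf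 i\in\Sigma_G^n,\ UL_n[\mathbf i]\subseteq D}\ \sup_{\mathbf u\in[\mathbf i]}\exp\sum_{k=0}^{n-1}\varphi(S^k\mathbf u).$$ The lower and upper multifractal pressures are $\underline P^U_D(\varphi)=\liminf_n\frac1n\log Z_n(D)$ and $\overline P^U_D(\varphi)=\limsup_n\frac1n\log Z_n(D)$; the dynamical multifractal zeta-function is the power series $\zeta^{\mathrm{dyn},U}_D(\varphi;z)=\sum_n\frac{z^n}{n}Z_n(D)$. $\sigma_{\mathrm{rad}}(f)\in[0,\infty]$ is the radius of convergence of a power series $f$. $\overset{\circ}{C}$ is the interior of $C$. "Affine" means preserving convex combinations. *)

theory Defs
  imports
    "HOL-Probability.Probability"
    "Graph_Theory.Digraph_Component"
begin

text \<open>\<^term>\<open>tail G e\<close> is the initial vertex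
  and \<^term>\<open>head G e\<close> the terminal vertex of the edge \<^term>\<open>e\<close>. Infinite strings are indexed
  from 0.\<close>

definition words :: "('v, 'e) pre_digraph \<Rightarrow> nat \<Rightarrow> 'e list set" where
  "words G n = {es. length es = n \<and> set es \<subseteq> arcs G \<and>
     (\<forall>k. Suc k < n \<longrightarrow> head G (es ! k) = tail G (es ! Suc k))}"

definition strings :: "('v, 'e) pre_digraph \<Rightarrow> (nat \<Rightarrow> 'e) set" where
  "strings G = {u. (\<forall>k. u k \<in> arcs G) \<and> (\<forall>k. head G (u k) = tail G (u (Suc k)))}"

definition string_topology :: "('v, 'e) pre_digraph \<Rightarrow> (nat \<Rightarrow> 'e) topology" where
  "string_topology G =
     subtopology (product_topology (\<lambda>_. discrete_topology (arcs G)) UNIV) (strings G)"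

definition cylinder :: "('v, 'e) pre_digraph \<Rightarrow> 'e list \<Rightarrow> (nat \<Rightarrow> 'e) set" where
  "cylinder G es = {u \<in> strings G. map u [0..<length es] = es}"

definition shift_map :: "(nat \<Rightarrow> 'e) \<Rightarrow> nat \<Rightarrow> 'e" where
  "shift_map u = (\<lambda>k. u (Suc k))"


definition borel_algebra :: "'a topology \<Rightarrow> 'a measure" where
  "borel_algebra X = sigma (topspace X) {W. openin X W}"

definition prob_measures :: "'a topology \<Rightarrow> 'a measure set" where
  "prob_measures X = {\<mu>. sets \<mu> = sets (borel_algebra X) \<and> prob_space \<mu>}"

text \<open>The weak topology on Borel probability measures: the coarsest topology making
  integration against every bounded continuous function continuous.\<close>

definition weak_topology :: "'a topology \<Rightarrow> 'a measure topology" where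
  "weak_topology X = topology_generated_by
     {{\<mu> \<in> prob_measures X. integral\<^sup>L \<mu> f \<in> V} | f V.
        continuous_map X euclideanreal f \<and> bounded (f ` topspace X) \<and> open V}"

definition invariant_measures :: "'a topology \<Rightarrow> ('a \<Rightarrow> 'a) \<Rightarrow> 'a measure set" where
  "invariant_measures X T =
     {\<mu> \<in> prob_measures X. T \<in> measurable \<mu> \<mu> \<and> distr \<mu> \<mu> T = \<mu>}"

definition measure_mix :: "real \<Rightarrow> 'a measure \<Rightarrow> 'a measure \<Rightarrow> 'a measure" where
  "measure_mix p \<mu> \<nu> = measure_of (space \<mu>) (sets \<mu>)
     (\<lambda>A. ennreal p * emeasure \<mu> A + ennreal (1 - p) * emeasure \<nu> A)"

definition affine_on_measures :: "'a topology \<Rightarrow> ('a measure \<Rightarrow> 'x::real_vector) \<Rightarrow> bool" where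
  "affine_on_measures X F \<longleftrightarrow>
     (\<forall>\<mu> \<in> prob_measures X. \<forall>\<nu> \<in> prob_measures X. \<forall>p \<in> {0..1}.
        F (measure_mix p \<mu> \<nu>) = p *\<^sub>R F \<mu> + (1 - p) *\<^sub>R F \<nu>)"

text \<open>The terms for \<open>n = 0\<close> of the sequence below are
  irrelevant for the limit, which exists by subadditivity when \<open>T\<close> preserves \<open>M\<close>.
  Empty preimages are discarded by \<^const>\<open>common_refinement\<close>.\<close>

definition partition_entropy :: "'a measure \<Rightarrow> 'a set set \<Rightarrow> real" where
  "partition_entropy M \<xi> = - (\<Sum>A\<in>\<xi>. measure M A * ln (measure M A))"

definition dynamical_refinement :: "'a measure \<Rightarrow> ('a \<Rightarrow> 'a) \<Rightarrow> 'a set set \<Rightarrow> nat \<Rightarrow> 'a set set" where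
  "dynamical_refinement M T \<xi> n =
     common_refinement ((\<lambda>k. (\<lambda>A. (T ^^ k) -` A \<inter> space M) ` \<xi>) ` {..<n})"

definition entropy_wrt_partition :: "'a measure \<Rightarrow> ('a \<Rightarrow> 'a) \<Rightarrow> 'a set set \<Rightarrow> real" where
  "entropy_wrt_partition M T \<xi> =
     lim (\<lambda>n. partition_entropy M (dynamical_refinement M T \<xi> n) / real n)"

definition KS_entropy :: "'a measure \<Rightarrow> ('a \<Rightarrow> 'a) \<Rightarrow> ereal" where
  "KS_entropy M T =
     (SUP \<xi> \<in> {\<xi>. finite \<xi> \<and> \<xi> \<subseteq> sets M \<and> partition_on (space M) \<xi>}.
        ereal (entropy_wrt_partition M T \<xi>))"


definition empirical_measure :: "('v, 'e) pre_digraph \<Rightarrow> nat \<Rightarrow> (nat \<Rightarrow> 'e) \<Rightarrow> (nat \<Rightarrow> 'e) measure"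
  where
  "empirical_measure G n u =
     (let B = borel_algebra (string_topology G) in
      measure_of (space B) (sets B)
        (\<lambda>A. ennreal (1 / real n) * (\<Sum>k<n. emeasure (return B ((shift_map ^^ k) u)) A)))"

text \<open>The supremum over a cylinder is a real one: over a strongly connected finite graph with
  at least one edge all cylinders of words are nonempty, and a continuous \<open>\<phi>\<close> is bounded.\<close>

definition multifractal_sum ::
  "('v, 'e) pre_digraph \<Rightarrow> ((nat \<Rightarrow> 'e) measure \<Rightarrow> 'x) \<Rightarrow> 'x set \<Rightarrow> ((nat \<Rightarrow> 'e) \<Rightarrow> real)
     \<Rightarrow> nat \<Rightarrow> real" where
  "multifractal_sum G U D \<phi> n =
     (\<Sum>es \<in> {es \<in> words G n. (\<lambda>u. U (empirical_measure G n u)) ` cylinder G es \<subseteq> D}.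
        (SUP u \<in> cylinder G es. exp (\<Sum>k<n. \<phi> ((shift_map ^^ k) u))))"

text \<open>The logarithm on \<open>[0,\<infinity>]\<close>, with \<open>log 0 = -\<infinity>\<close> (whereas \<^term>\<open>ln (0::real) = 0\<close>).\<close>

definition elog :: "ereal \<Rightarrow> ereal" where
  "elog x = (if x \<le> 0 then -\<infinity> else if x = \<infinity> then \<infinity> else ereal (ln (real_of_ereal x)))"

definition lower_pressure ::
  "('v, 'e) pre_digraph \<Rightarrow> ((nat \<Rightarrow> 'e) measure \<Rightarrow> 'x) \<Rightarrow> 'x set \<Rightarrow> ((nat \<Rightarrow> 'e) \<Rightarrow> real)
     \<Rightarrow> ereal" where
  "lower_pressure G U D \<phi> =
     liminf (\<lambda>n. ereal (1 / real n) * elog (ereal (multifractal_sum G U D \<phi> n)))"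

definition upper_pressure ::
  "('v, 'e) pre_digraph \<Rightarrow> ((nat \<Rightarrow> 'e) measure \<Rightarrow> 'x) \<Rightarrow> 'x set \<Rightarrow> ((nat \<Rightarrow> 'e) \<Rightarrow> real)
     \<Rightarrow> ereal" where
  "upper_pressure G U D \<phi> =
     limsup (\<lambda>n. ereal (1 / real n) * elog (ereal (multifractal_sum G U D \<phi> n)))"

text \<open>The power series starts at \<open>n = 1\<close>; its constant coefficient is \<open>0\<close>, by \<open>x / 0 = 0\<close>.\<close>

definition dyn_zeta ::
  "('v, 'e) pre_digraph \<Rightarrow> ((nat \<Rightarrow> 'e) measure \<Rightarrow> 'x) \<Rightarrow> 'x set \<Rightarrow> ((nat \<Rightarrow> 'e) \<Rightarrow> real)
     \<Rightarrow> complex fps" where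
  "dyn_zeta G U D \<phi> = Abs_fps (\<lambda>n. complex_of_real (multifractal_sum G U D \<phi> n / real n))"

end

theory Submission
  imports Defs "HOL-Complex_Analysis.Great_Picard"
begin

text \<open>Let \<open>F(\<mu>) = h(\<mu>) + \<integral>\<phi> d\<mu>\<close>. Both inequalities rest on the block entropies \<open>H\<^sub>n(\<mu>)\<close>,
  with \<open>H\<^sub>n(\<mu>) / n \<rightarrow> h(\<mu>)\<close> by the generator theorem.

  Lower bound: if \<open>U \<mu>\<close> is interior to \<open>C\<close>, every word whose empirical cylinder frequencies are close to
  those of \<open>\<mu>\<close> is admissible. Concatenating independent \<open>\<mu>\<close>-random words of a large fixed length through
  connecting paths yields about \<open>exp (n h(\<mu>))\<close> of them, so \<open>F(\<mu>)\<close> is at most the lower pressure.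

  Upper bound (Misiurewicz): the admissible words of length \<open>n\<close>, weighted by \<open>exp (\<Sum>k<n. \<phi> (S^k u))\<close>, define
  a mixture of empirical measures. It stays in the closed set \<open>{U \<in> C}\<close>, which is closed under mixtures
  because \<open>\<Delta>\<close> has constant sign. A limit point is an invariant \<open>\<mu>\<close> with \<open>F(\<mu>)\<close> at least the upper pressure.

  Finally, mixing \<open>\<mu>\<close> with a little of a measure whose \<open>U\<close>-value is interior to \<open>C\<close> moves \<open>U \<mu>\<close> to the
  interior and changes \<open>F\<close> little, since entropy is concave; this identifies the two suprema.\<close>

section \<open>Entropy of finite-valued functions\<close>

text \<open>The weak topology enters only through the frequencies of finitely many cylinders:
  integrals of continuous functions are approximated, uniformly over all probability measures, by
  sums over words. Both bounds thereby become statements about finite words, and compactness of the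
  space of measures reduces to a diagonal sequence over words and Caratheodory's extension theorem.
  Entropy is computed for finite-valued labels instead of partitions, so that joins become pairs and
  coarsenings become functions. The obstacle to the lower bound is that an invariant measure may
  fail to be ergodic: a single orbit need not show its frequencies or its entropy. Independent draws
  of \<open>m\<close>-words repair this. Chebyshev's inequality controls all averages at once with
  an error of 1 per draw, and every loss (deviation, connecting path, boundary effect, decoding) is
  bounded per draw, hence small per letter for large \<open>m\<close>. In the upper bound the
  weighted measures are moved by the shift, so windows are counted for arbitrary measures. The word
  length tends to infinity first, the window length afterwards.\<close>

definition fibres :: "'a measure \<Rightarrow> ('a \<Rightarrow> 'b) \<Rightarrow> 'a set set" where
  "fibres M X = (\<lambda>x. X -` {X x} \<inter> space M) ` space M"

text \<open>Shannon entropy, in nats, of the law of the label \<open>X\<close>. Since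
  \<open>ln 0 = 0\<close>, values of probability zero contribute nothing, and the image of
  \<open>X\<close> may be replaced by any finite superset.\<close>

definition ent :: "'a measure \<Rightarrow> ('a \<Rightarrow> 'b) \<Rightarrow> real" where
  "ent M X = - (\<Sum>y\<in>X ` space M. measure M (X -` {y} \<inter> space M) * ln (measure M (X -` {y} \<inter> space M)))"

text \<open>The \<open>l\<close>-name of \<open>x\<close> over the times \<open>j\<close> to
  \<open>j + q - 1\<close>. The starting time is a parameter because, for a measure that
  \<open>T\<close> moves, the entropy of a window depends on its position.\<close>

definition block :: "('a \<Rightarrow> 'a) \<Rightarrow> ('a \<Rightarrow> 'b) \<Rightarrow> nat \<Rightarrow> nat \<Rightarrow> 'a \<Rightarrow> 'b list" where
  "block T l j q x = map (\<lambda>i. l ((T ^^ i) x)) [j..<j + q]"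

lemma simple_function_iff_finite_measurable:
  "simple_function M X \<longleftrightarrow> finite (X ` space M) \<and> X \<in> measurable M (count_space UNIV)"
proof
  assume "simple_function M X"
  then show "finite (X ` space M) \<and> X \<in> measurable M (count_space UNIV)"
    by (auto simp: simple_functionD measurable_simple_function)
next
  assume *: "finite (X ` space M) \<and> X \<in> measurable M (count_space UNIV)"
  show "simple_function M X"
    unfolding simple_function_def
    using * by (auto intro: measurable_sets[of X M "count_space UNIV"])
qed

lemma simple_function_comp_measurable:
  assumes "simple_function N X" "T \<in> measurable M N"
  shows "simple_function M (\<lambda>x. X (T x))"
proof -
  have "(\<lambda>x. X (T x)) ` space M \<subseteq> X ` space N"
    using measurable_space[OF assms(2)] by auto
  then show ?thesis
    using assms measurable_compose[OF assms(2), of X "count_space UNIV"]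
    by (auto simp: simple_function_iff_finite_measurable intro: finite_subset)
qed

lemma ent_superset:
  assumes "finite S" "X ` space M \<subseteq> S"
  shows "ent M X = - (\<Sum>y\<in>S. measure M (X -` {y} \<inter> space M) * ln (measure M (X -` {y} \<inter> space M)))"
proof -
  have "(\<Sum>y\<in>S. measure M (X -` {y} \<inter> space M) * ln (measure M (X -` {y} \<inter> space M)))
      = (\<Sum>y\<in>X ` space M. measure M (X -` {y} \<inter> space M) * ln (measure M (X -` {y} \<inter> space M)))"
  proof (rule sum.mono_neutral_right[OF assms])
    have "X -` {y} \<inter> space M = {}" if "y \<in> S - X ` space M" for y
      using that by auto
    then show "\<forall>i\<in>S - X ` space M. measure M (X -` {i} \<inter> space M) * ln (measure M (X -` {i} \<inter> space M)) = 0"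
      by simp
  qed
  then show ?thesis by (simp add: ent_def)
qed

lemma ent_cong:
  assumes "\<And>x. x \<in> space M \<Longrightarrow> X x = Y x"
  shows "ent M X = ent M Y"
proof -
  have "X ` space M = Y ` space M" "\<And>y. X -` {y} \<inter> space M = Y -` {y} \<inter> space M"
    using assms by auto
  then show ?thesis by (simp add: ent_def)
qed

lemma ent_distr:
  assumes T: "T \<in> measurable M N" and X: "simple_function N X"
  shows "ent (distr M N T) X = ent M (\<lambda>x. X (T x))"
proof -
  have fin: "finite (X ` space N)" using X by (rule simple_functionD)
  have sub: "(\<lambda>x. X (T x)) ` space M \<subseteq> X ` space N"
    using measurable_space[OF T] by auto
  have "measure (distr M N T) (X -` {y} \<inter> space N) = measure M ((\<lambda>x. X (T x)) -` {y} \<inter> space M)" for y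
  proof -
    have "X -` {y} \<inter> space N \<in> sets N" using X by (rule simple_functionD)
    moreover have "T -` (X -` {y} \<inter> space N) \<inter> space M = (\<lambda>x. X (T x)) -` {y} \<inter> space M"
      using measurable_space[OF T] by auto
    ultimately show ?thesis using measure_distr[OF T] by metis
  qed
  then show ?thesis
    using ent_superset[OF fin sub] by (simp add: ent_def)
qed

lemma partition_entropy_fibres: "partition_entropy M (fibres M X) = ent M X"
proof -
  have "fibres M X = (\<lambda>y. X -` {y} \<inter> space M) ` (X ` space M)"
    by (auto simp: fibres_def)
  moreover have "inj_on (\<lambda>y. X -` {y} \<inter> space M) (X ` space M)"
    by (auto simp: inj_on_def)
  ultimately show ?thesis
    by (simp add: partition_entropy_def ent_def sum.reindex del: image_image)
qed

context prob_space begin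

text \<open>Base \<open>exp 1\<close> turns the \<open>log\<close> of the information theory library
  into \<open>ln\<close>, so that its inequalities transfer to \<open>ent\<close>.\<close>

lemma information_space_exp: "information_space M (exp 1)"
  by unfold_locales simp

lemma ent_eq_entropy:
  assumes "simple_function M X"
  shows "ent M X = entropy (exp 1) (count_space (X ` space M)) X"
proof -
  interpret information_space M "exp 1" by (rule information_space_exp)
  show ?thesis
    by (subst entropy_simple_distributed[OF simple_distributedI[OF assms measure_nonneg refl]])
      (simp add: ent_def log_def)
qed

lemma ent_pair_le:
  assumes "simple_function M X" "simple_function M Y"
  shows "ent M (\<lambda>x. (X x, Y x)) \<le> ent M X + ent M Y"
proof -
  interpret information_space M "exp 1" by (rule information_space_exp)
  show ?thesis
    using entropy_chain_rule[OF assms] conditional_entropy_less_eq_entropy[OF assms(2,1)]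
    by (simp add: ent_eq_entropy assms simple_function_Pair)
qed

text \<open>\<open>Y\<close> factors through \<open>X\<close> on \<open>space M\<close>, so this is
  data processing. The factor map evaluates \<open>Y\<close> at a chosen point of each level set of
  \<open>X\<close>.\<close>

lemma ent_mono:
  assumes X: "simple_function M X"
    and XY: "\<And>x y. x \<in> space M \<Longrightarrow> y \<in> space M \<Longrightarrow> X x = X y \<Longrightarrow> Y x = Y y"
  shows "ent M Y \<le> ent M X"
proof -
  interpret information_space M "exp 1" by (rule information_space_exp)
  define f where "f = (\<lambda>z. Y (SOME x. x \<in> space M \<and> X x = z))"
  have "(f \<circ> X) x = Y x" if x: "x \<in> space M" for x
  proof -
    have "\<exists>y. y \<in> space M \<and> X y = X x" using x by blast
    then have "(SOME y. y \<in> space M \<and> X y = X x) \<in> space M \<and> X (SOME y. y \<in> space M \<and> X y = X x) = X x"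
      by (rule someI_ex)
    then show ?thesis unfolding f_def comp_apply by (metis XY x)
  qed
  then have "ent M Y = ent M (f \<circ> X)" by (intro ent_cong) auto
  also have "\<dots> \<le> ent M X"
    using entropy_data_processing[OF X, of f]
    by (simp add: ent_eq_entropy X simple_function_compose)
  finally show ?thesis .
qed

lemma ent_le_card:
  assumes X: "simple_function M X" and S: "finite S" "X ` space M \<subseteq> S"
  shows "ent M X \<le> ln (card S)"
proof -
  interpret information_space M "exp 1" by (rule information_space_exp)
  have ne: "X ` space M \<noteq> {}" using not_empty by auto
  have "ent M X \<le> ln (card (X ` space M))"
    using entropy_le_card[OF simple_distributedI[OF X measure_nonneg refl]]
    by (simp add: ent_eq_entropy X log_def)
  also have "\<dots> \<le> ln (card S)"
  proof -
    have "0 < card (X ` space M)" using ne finite_subset[OF S(2,1)] by (metis card_gt_0_iff)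
    moreover have "card (X ` space M) \<le> card S" by (rule card_mono[OF S])
    ultimately show ?thesis by simp
  qed
  finally show ?thesis .
qed

lemma ent_nonneg: "0 \<le> ent M X"
proof -
  have "measure M A * ln (measure M A) \<le> 0" for A
    by (cases "measure M A = 0") (auto simp: mult_le_0_iff less_le)
  then show ?thesis unfolding ent_def by (simp add: sum_nonpos)
qed

lemma simple_function_block:
  assumes T: "T \<in> measurable M M" and l: "simple_function M l"
  shows "simple_function M (block T l j q)"
proof (induction q)
  case 0
  then show ?case by (simp add: block_def)
next
  case (Suc q)
  have "simple_function M (\<lambda>x. l ((T ^^ (j + q)) x))"
    by (rule simple_function_comp_measurable[OF l measurable_compose_n[OF T]])
  from simple_function_compose2[OF Suc this, of "\<lambda>a b. a @ [b]"]
  show ?case by (simp add: block_def)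
qed

end

text \<open>The counting step of Misiurewicz's argument. Instead of cutting an interval into
  consecutive windows for each residue modulo \<open>q\<close>, all overlapping windows are summed
  and the increments \<open>b (j + q) - b j\<close> telescope. With \<open>b\<close> the block
  entropy and \<open>x j\<close> the entropy of the window at \<open>j\<close>, the inequality
  compares a long block with its windows.\<close>

lemma window_sum_le:
  fixes b x :: "nat \<Rightarrow> real"
  assumes "mono b" and "\<And>j. b (j + q) \<le> b j + x j"
  shows "real q * b n \<le> (\<Sum>j<n. x j) + real q * b q"
proof -
  \<comment> \<open>Summing over all starts \<open>j < n\<close> cancels everything except the
    \<open>q\<close> values from index \<open>n\<close> on and the first \<open>q\<close>
    values.\<close>
  have tele: "(\<Sum>j<n. b (j + q) - b j) = (\<Sum>i<q. b (n + i) - b i)"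
  proof (induction n)
    case (Suc n)
    have "(\<Sum>i<q. b (Suc n + i) - b i) = (\<Sum>i<q. b (n + i) - b i) + (\<Sum>i<q. b (n + Suc i) - b (n + i))"
      by (simp flip: sum.distrib)
    also have "(\<Sum>i<q. b (n + Suc i) - b (n + i)) = b (n + q) - b n"
      using sum_lessThan_telescope[of "\<lambda>i. b (n + i)" q] by simp
    finally show ?case using Suc by simp
  qed simp
  have "real q * b n - real q * b q = (\<Sum>i<q. b n - b q)" by (simp add: algebra_simps)
  also have "\<dots> \<le> (\<Sum>i<q. b (n + i) - b i)"
    by (intro sum_mono diff_mono) (auto intro: monoD[OF assms(1)])
  also have "\<dots> = (\<Sum>j<n. b (j + q) - b j)" by (simp add: tele)
  also have "\<dots> \<le> (\<Sum>j<n. x j)"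
    by (intro sum_mono) (use assms(2) in \<open>simp add: algebra_simps\<close>)
  finally show ?thesis by simp
qed

text \<open>The window at \<open>j\<close> keeps its own entropy here. In this form the estimates
  apply to the weighted measures of the upper bound, which the shift moves.\<close>

lemma (in prob_space)
  assumes T: "T \<in> measurable M M" and l: "simple_function M l"
  shows ent_block_add: "ent M (block T l 0 (j + q)) \<le> ent M (block T l 0 j) + ent M (block T l j q)"
    and ent_block_mono: "mono (\<lambda>n. ent M (block T l 0 n))"
    and ent_block_window: "real q * ent M (block T l 0 n) \<le>
      (\<Sum>j<n. ent M (block T l j q)) + real q * ent M (block T l 0 q)"
proof -
  note sb = simple_function_block[OF T l]
  show add: "ent M (block T l 0 (j + q)) \<le> ent M (block T l 0 j) + ent M (block T l j q)" for j q
  proof -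
    have eq: "block T l 0 (j + q) x = block T l 0 j x @ block T l j q x" for x
      unfolding block_def add_0 upt_add_eq_append[OF le0] map_append ..
    have "ent M (block T l 0 (j + q)) \<le> ent M (\<lambda>x. (block T l 0 j x, block T l j q x))"
      by (rule ent_mono) (auto simp: eq intro: simple_function_Pair sb)
    also have "\<dots> \<le> ent M (block T l 0 j) + ent M (block T l j q)"
      by (intro ent_pair_le sb)
    finally show ?thesis .
  qed
  show mono: "mono (\<lambda>n. ent M (block T l 0 n))"
  proof (rule monoI, rule ent_mono[OF sb])
    fix m n :: nat and x y assume "m \<le> n" and eq: "block T l 0 n x = block T l 0 n y"
    have "take m (block T l 0 n z) = block T l 0 m z" for z
      using \<open>m \<le> n\<close> by (simp add: block_def take_map)
    then show "block T l 0 m x = block T l 0 m y" using eq by metis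
  qed
  show "real q * ent M (block T l 0 n) \<le>
      (\<Sum>j<n. ent M (block T l j q)) + real q * ent M (block T l 0 q)"
    by (rule window_sum_le[OF mono add])
qed

text \<open>A Fekete argument: division by \<open>q * n\<close> gives
  \<open>b n / n \<le> b q / q + b q / n\<close>, so the quotients converge to their infimum
  \<open>L\<close>.\<close>

lemma converges_of_window:
  fixes b :: "nat \<Rightarrow> real"
  assumes nn: "\<And>n. 0 \<le> b n" and win: "\<And>n q. real q * b n \<le> real n * b q + real q * b q"
  obtains L where "(\<lambda>n. b n / real n) \<longlonglongrightarrow> L" "\<And>q. 0 < q \<Longrightarrow> L \<le> b q / real q"
proof -
  define L where "L = (INF q\<in>{0<..}. b q / real q)"
  have bdd: "bdd_below ((\<lambda>q. b q / real q) ` {0<..})"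
    by (rule bdd_belowI[of _ 0]) (auto simp: nn)
  have lower: "L \<le> b q / real q" if "0 < q" for q
    unfolding L_def using that bdd by (auto intro: cINF_lower)
  have "(\<lambda>n. b n / real n) \<longlonglongrightarrow> L"
  proof (rule LIMSEQ_I)
    fix r :: real assume r: "0 < r"
    have "\<exists>q\<in>{0<..}. b q / real q < L + r / 2"
      using cINF_less_iff[OF _ bdd, of "L + r/2"] r unfolding L_def by auto
    then obtain q where q: "0 < q" "b q / real q < L + r / 2" by auto
    obtain N where N: "2 * b q / r < real N" using reals_Archimedean2 by blast
    have "norm (b n / real n - L) < r" if n: "n \<ge> Suc N" for n
    proof -
      have n0: "0 < n" using n by simp
      have "real q * b n \<le> real n * b q + real q * b q" by (rule win)
      then have "b n / real n \<le> b q / real q + b q / real n"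
        using q(1) n0 by (simp add: field_simps)
      moreover have "b q / real n < r / 2"
      proof -
        have "2 * b q / r < real n" using N n by (simp add: less_le_trans)
        then show ?thesis using n0 r by (simp add: field_simps)
      qed
      ultimately show ?thesis unfolding real_norm_def using q(2) lower[OF n0] by linarith
    qed
    then show "\<exists>no. \<forall>n\<ge>no. norm (b n / real n - L) < r" by blast
  qed
  with lower show ?thesis by (rule that[rotated])
qed

text \<open>Jensen's inequality for \<open>- (y * ln y)\<close> through its tangent at the mean
  \<open>a\<close>: the bound \<open>- (y * ln y) \<le> - y * ln a + a - y\<close> follows from
  \<open>ln (a / y) \<le> a / y - 1\<close>, also holds at \<open>y = 0\<close>, and averages to the
  claim. If \<open>a = 0\<close>, all terms vanish.\<close>

lemma xlnx_concave:
  fixes x :: "'i \<Rightarrow> real"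
  assumes "finite I" "\<And>i. i \<in> I \<Longrightarrow> 0 \<le> p i" "\<And>i. i \<in> I \<Longrightarrow> 0 \<le> x i"
    and sum: "(\<Sum>i\<in>I. p i) = 1"
  shows "(\<Sum>i\<in>I. p i * - (x i * ln (x i))) \<le> - ((\<Sum>i\<in>I. p i * x i) * ln (\<Sum>i\<in>I. p i * x i))"
proof -
  define a where "a = (\<Sum>i\<in>I. p i * x i)"
  have a0: "0 \<le> a" unfolding a_def using assms by (intro sum_nonneg) auto
  show ?thesis
  proof (cases "a = 0")
    case True
    then have "\<forall>i\<in>I. p i * x i = 0"
      unfolding a_def using assms by (subst (asm) sum_nonneg_eq_0_iff) auto
    then have "(\<Sum>i\<in>I. p i * - (x i * ln (x i))) = 0" by (intro sum.neutral) auto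
    then show ?thesis using True by (simp add: a_def)
  next
    case False
    then have a: "0 < a" using a0 by simp
    have "- (y * ln y) \<le> - y * ln a + a - y" if "0 \<le> y" for y
    proof (cases "y = 0")
      case False
      then have y: "0 < y" using that by simp
      have "ln (a / y) \<le> a / y - 1" using a y by (intro ln_le_minus_one) simp
      then have "y * (ln a - ln y) \<le> y * (a / y - 1)"
        using a y by (intro mult_left_mono) (auto simp: ln_div)
      then show ?thesis using y by (simp add: algebra_simps)
    qed (use a in simp)
    then have "(\<Sum>i\<in>I. p i * - (x i * ln (x i))) \<le> (\<Sum>i\<in>I. p i * (- x i * ln a + a - x i))"
      using assms by (intro sum_mono mult_left_mono) auto
    also have "\<dots> = (\<Sum>i\<in>I. - ln a * (p i * x i) + a * p i - p i * x i)"
      by (intro sum.cong) (auto simp: algebra_simps)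
    also have "\<dots> = - ln a * a + a * (\<Sum>i\<in>I. p i) - a"
      unfolding a_def sum.distrib sum_subtractf sum_distrib_left[symmetric] ..
    finally show ?thesis by (simp add: a_def[symmetric] sum mult.commute)
  qed
qed

text \<open>A cell of the refinement consists of the points that share the labels at all times
  \<open>k < n\<close>, that is, the whole block. For \<open>n = 0\<close> the empty intersection in
  \<open>common_refinement\<close> would be \<open>UNIV\<close>.\<close>

lemma dynamical_refinement_fibres:
  assumes T: "T \<in> space M \<rightarrow> space M" and n: "0 < n"
  shows "dynamical_refinement M T (fibres M l) n = fibres M (block T l 0 n)"
proof -
  define P where "P = (\<lambda>k. (\<lambda>A. (T ^^ k) -` A \<inter> space M) ` fibres M l)"
  have Tk: "(T ^^ k) x \<in> space M" if "x \<in> space M" for k x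
    using that T by (induction k) auto
  define F where "F = (\<lambda>k x. {z \<in> space M. l ((T ^^ k) z) = l ((T ^^ k) x)})"
  have blk: "block T l 0 n z = block T l 0 n x \<longleftrightarrow> (\<forall>k<n. l ((T ^^ k) z) = l ((T ^^ k) x))" for x z
    by (auto simp: block_def)
  have inF: "B = F k x" if "B \<in> P k" "x \<in> B" for B k x
    using that by (auto simp: P_def fibres_def F_def Tk)
  have FP: "F k x \<in> P k" if "x \<in> space M" for k x
  proof -
    have "l -` {l ((T ^^ k) x)} \<inter> space M \<in> fibres M l"
      using Tk[OF that] by (auto simp: fibres_def)
    moreover have "F k x = (T ^^ k) -` (l -` {l ((T ^^ k) x)} \<inter> space M) \<inter> space M"
      using Tk by (auto simp: F_def)
    ultimately show ?thesis unfolding P_def by blast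
  qed
  have fib: "block T l 0 n -` {block T l 0 n x} \<inter> space M = (\<Inter>k<n. F k x)" for x
    using n by (auto simp: blk F_def)
  have "common_refinement (P ` {..<n}) = fibres M (block T l 0 n)"
  proof (intro set_eqI iffI)
    fix B assume "B \<in> common_refinement (P ` {..<n})"
    then obtain f where f: "\<And>k. k < n \<Longrightarrow> f (P k) \<in> P k" "B = (\<Inter>k<n. f (P k))" "B \<noteq> {}"
      by (auto simp: common_refinement)
    then obtain x where x: "x \<in> B" by auto
    have eq: "f (P k) = F k x" if "k < n" for k
      by (rule inF) (use f x that in auto)
    have xs: "x \<in> space M" using x n f(1,2) by (auto simp: P_def)
    have "B = (\<Inter>k<n. F k x)" using eq f(2) by auto
    then show "B \<in> fibres M (block T l 0 n)"
      using xs fib by (auto simp: fibres_def)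
  next
    fix B assume "B \<in> fibres M (block T l 0 n)"
    then obtain x where x: "x \<in> space M" "B = (\<Inter>k<n. F k x)"
      using fib by (auto simp: fibres_def)
    \<comment> \<open>Choice functions are indexed by the partitions \<open>P k\<close>, and these
      may coincide for different \<open>k\<close>. Selecting the member that contains the fixed
      point \<open>x\<close> is consistent nevertheless.\<close>
    define f where "f = (\<lambda>Q. THE A. A \<in> Q \<and> x \<in> A)"
    have eq: "f (P k) = F k x" for k
    proof -
      have "x \<in> F k x" using x(1) by (simp add: F_def)
      then show ?thesis unfolding f_def using FP[OF x(1), of k] inF[of _ k x]
        by (intro the_equality) blast+
    qed
    have "f \<in> (\<Pi> Q\<in>P ` {..<n}. Q)"
    proof
      fix Q assume "Q \<in> P ` {..<n}"
      then obtain k where "Q = P k" by blast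
      then show "f Q \<in> Q" using eq[of k] FP[OF x(1), of k] by metis
    qed
    moreover have "\<Inter> (f ` P ` {..<n}) = B" unfolding x(2) image_image eq ..
    moreover have "x \<in> B" unfolding x(2) F_def using x(1) by blast
    ultimately show "B \<in> common_refinement (P ` {..<n})"
      unfolding common_refinement by blast
  qed
  then show ?thesis by (simp add: dynamical_refinement_def P_def)
qed

text \<open>Each point is labelled by its own cell, so every partition comes from a label.\<close>

lemma partition_on_eq_fibres:
  assumes "partition_on (space M) \<xi>"
  shows "\<xi> = fibres M (\<lambda>x. THE A. A \<in> \<xi> \<and> x \<in> A)"
proof -
  let ?l = "\<lambda>x. THE A. A \<in> \<xi> \<and> x \<in> A"
  have l: "?l x = A" if "A \<in> \<xi>" "x \<in> A" for x A
    using that assms by (intro the_equality) (auto simp: partition_on_def disjoint_def)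
  have U: "\<Union>\<xi> = space M" and ne: "{} \<notin> \<xi>" using assms by (auto simp: partition_on_def)
  have fib: "?l -` {?l x} \<inter> space M = A" if "A \<in> \<xi>" "x \<in> A" for x A
  proof (intro set_eqI iffI)
    fix z assume z: "z \<in> ?l -` {?l x} \<inter> space M"
    then obtain B where "B \<in> \<xi>" "z \<in> B" using U by blast
    with z l[OF this] l[OF that] show "z \<in> A" by simp
  next
    fix z assume "z \<in> A"
    then show "z \<in> ?l -` {?l x} \<inter> space M"
      using l[OF that] l[OF that(1) \<open>z \<in> A\<close>] U that(1) by auto
  qed
  show ?thesis
  proof (intro set_eqI iffI)
    fix A assume A: "A \<in> \<xi>"
    then obtain x where "x \<in> A" using ne by (metis all_not_in_conv)
    with fib[OF A this] A U show "A \<in> fibres M ?l" unfolding fibres_def by blast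
  next
    fix B assume "B \<in> fibres M ?l"
    then obtain x where x: "x \<in> space M" "B = ?l -` {?l x} \<inter> space M" by (auto simp: fibres_def)
    then obtain A where "A \<in> \<xi>" "x \<in> A" using U by blast
    with fib[of A x] x(2) show "B \<in> \<xi>" by simp
  qed
qed

section \<open>The space of infinite strings\<close>

lemma shift_map_funpow: "(shift_map ^^ k) u = (\<lambda>i. u (i + k))"
  by (induction k) (auto simp: shift_map_def)

text \<open>The algebra of sets decided by finitely many letters; these are clopen and generate the
  Borel sets. One implication suffices because \<open>u\<close> and \<open>v\<close> can be
  exchanged, and leaving \<open>k\<close> existential lets sets of different depths be
  combined.\<close>

definition cylinder_sets :: "('v, 'e) pre_digraph \<Rightarrow> (nat \<Rightarrow> 'e) set set" where
  "cylinder_sets G = {D. D \<subseteq> strings G \<and>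
     (\<exists>k. \<forall>u\<in>strings G. \<forall>v\<in>strings G. (\<forall>i<k. u i = v i) \<longrightarrow> u \<in> D \<longrightarrow> v \<in> D)}"

lemma cylinder_setsE:
  assumes "D \<in> cylinder_sets G"
  obtains k where "\<And>k' u v. k \<le> k' \<Longrightarrow> u \<in> strings G \<Longrightarrow> v \<in> strings G \<Longrightarrow>
    (\<And>i. i < k' \<Longrightarrow> u i = v i) \<Longrightarrow> u \<in> D \<longleftrightarrow> v \<in> D" "D \<subseteq> strings G"
proof -
  obtain k where k: "D \<subseteq> strings G"
    "\<And>u v. u \<in> strings G \<Longrightarrow> v \<in> strings G \<Longrightarrow> (\<forall>i<k. u i = v i) \<Longrightarrow> u \<in> D \<Longrightarrow> v \<in> D"
    using assms unfolding cylinder_sets_def by blast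
  show ?thesis
  proof (rule that[of k])
    fix k' u v assume "k \<le> k'" "u \<in> strings G" "v \<in> strings G" "\<And>i. i < k' \<Longrightarrow> u i = v i"
    then have "\<forall>i<k. u i = v i" "\<forall>i<k. v i = u i" by auto
    then show "u \<in> D \<longleftrightarrow> v \<in> D" using k(2) \<open>u \<in> strings G\<close> \<open>v \<in> strings G\<close> by blast
  qed (rule k(1))
qed

lemma mem_cylinder_map: "u \<in> cylinder G (map v [0..<n]) \<longleftrightarrow> u \<in> strings G \<and> (\<forall>i<n. u i = v i)"
  by (auto simp: cylinder_def)

lemma cylinder_in_cylinder_sets: "cylinder G es \<in> cylinder_sets G"
proof -
  have "v \<in> cylinder G es" if "v \<in> strings G" "\<forall>i<length es. u i = v i" "u \<in> cylinder G es" for u v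
  proof -
    have "map v [0..<length es] = map u [0..<length es]" using that(2) by auto
    moreover have "map u [0..<length es] = es" using that(3) by (simp add: cylinder_def)
    ultimately show ?thesis using that(1) by (simp add: cylinder_def)
  qed
  then show ?thesis unfolding cylinder_sets_def cylinder_def by blast
qed

lemma topspace_string_topology [simp]: "topspace (string_topology G) = strings G"
  by (auto simp: string_topology_def strings_def PiE_def)

text \<open>A basic open set of the product restricts only finitely many coordinates, so a prefix
  reaching past all of them already forces membership.\<close>

lemma openin_contains_cylinder:
  assumes W: "openin (string_topology G) W" and u: "u \<in> W"
  obtains n where "cylinder G (map u [0..<n]) \<subseteq> W"
proof -
  obtain V where V: "openin (product_topology (\<lambda>_. discrete_topology (arcs G)) UNIV) V"
    "W = V \<inter> strings G"
    using W unfolding string_topology_def openin_subtopology by auto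
  have "u \<in> V" using u V(2) by simp
  from product_topology_open_contains_basis[OF V(1) this]
  obtain X where X: "u \<in> Pi\<^sub>E UNIV X" "finite {i. X i \<noteq> arcs G}" "Pi\<^sub>E UNIV X \<subseteq> V"
    unfolding topspace_discrete_topology by blast
  obtain n where n: "\<And>i. X i \<noteq> arcs G \<Longrightarrow> i < n"
    using finite_nat_bounded[OF X(2)] by auto
  have "cylinder G (map u [0..<n]) \<subseteq> W"
  proof
    fix v assume v: "v \<in> cylinder G (map u [0..<n])"
    have "v i \<in> X i" for i
    proof (cases "i < n")
      case True
      then show ?thesis using X(1) v by (auto simp: mem_cylinder_map PiE_def)
    next
      case False
      then have "X i = arcs G" using n by blast
      then show ?thesis using v by (auto simp: mem_cylinder_map strings_def)
    qed
    then have "v \<in> V" using X(3) by (auto simp: PiE_def)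
    then show "v \<in> W" using v V(2) by (auto simp: mem_cylinder_map)
  qed
  then show ?thesis by (rule that)
qed

lemma openin_cylinder: "openin (string_topology G) (cylinder G es)"
proof -
  define X where "X = (\<lambda>i. if i < length es then {es ! i} \<inter> arcs G else arcs G)"
  have "{i. X i \<noteq> topspace (discrete_topology (arcs G))} \<subseteq> {..<length es}"
    by (auto simp: X_def)
  then have "openin (product_topology (\<lambda>_. discrete_topology (arcs G)) UNIV) (Pi\<^sub>E UNIV X)"
    unfolding openin_PiE_gen by (auto simp: X_def intro: finite_subset)
  moreover have "cylinder G es = Pi\<^sub>E UNIV X \<inter> strings G"
  proof (intro set_eqI iffI)
    fix u assume u: "u \<in> cylinder G es"
    then have m: "map u [0..<length es] = es" by (simp add: cylinder_def)
    have "u i = es ! i" if "i < length es" for i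
      using that arg_cong[OF m, of "\<lambda>xs. xs ! i"] by simp
    moreover have "u \<in> strings G" "\<And>i. u i \<in> arcs G" using u by (auto simp: cylinder_def strings_def)
    ultimately have "u i \<in> X i" for i unfolding X_def by (metis Int_iff insertI1)
    with \<open>u \<in> strings G\<close> show "u \<in> Pi\<^sub>E UNIV X \<inter> strings G" by auto
  next
    fix u assume u: "u \<in> Pi\<^sub>E UNIV X \<inter> strings G"
    then have "u i = es ! i" if "i < length es" for i
    proof -
      have "u i \<in> X i" using u by auto
      then show ?thesis using that by (simp add: X_def)
    qed
    with u show "u \<in> cylinder G es"
      by (auto simp: cylinder_def intro: nth_equalityI)
  qed
  ultimately show ?thesis
    unfolding string_topology_def openin_subtopology by blast
qed

lemma openin_cylinder_sets:
  assumes "D \<in> cylinder_sets G"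
  shows "openin (string_topology G) D"
proof -
  obtain k where k: "\<And>k' u v. k \<le> k' \<Longrightarrow> u \<in> strings G \<Longrightarrow> v \<in> strings G \<Longrightarrow>
    (\<And>i. i < k' \<Longrightarrow> u i = v i) \<Longrightarrow> u \<in> D \<longleftrightarrow> v \<in> D" "D \<subseteq> strings G"
    using assms by (rule cylinder_setsE) blast
  have "\<exists>T. openin (string_topology G) T \<and> u \<in> T \<and> T \<subseteq> D" if "u \<in> D" for u
  proof (intro exI conjI)
    show "u \<in> cylinder G (map u [0..<k])" using that k(2) by (auto simp: mem_cylinder_map)
    show "cylinder G (map u [0..<k]) \<subseteq> D"
    proof
      fix v assume v: "v \<in> cylinder G (map u [0..<k])"
      then show "v \<in> D" using k(1)[of k v u] k(2) that by (auto simp: mem_cylinder_map)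
    qed
  qed (rule openin_cylinder)
  then show ?thesis by (subst openin_subopen) blast
qed

lemma cylinder_sets_Diff: "D \<in> cylinder_sets G \<Longrightarrow> strings G - D \<in> cylinder_sets G"
proof (erule cylinder_setsE)
  fix k assume "\<And>k' u v. k \<le> k' \<Longrightarrow> u \<in> strings G \<Longrightarrow> v \<in> strings G \<Longrightarrow>
    (\<And>i. i < k' \<Longrightarrow> u i = v i) \<Longrightarrow> u \<in> D \<longleftrightarrow> v \<in> D"
  from this[OF order_refl] show ?thesis
    unfolding cylinder_sets_def by blast
qed

lemma cylinder_sets_Un:
  assumes "D \<in> cylinder_sets G" "E \<in> cylinder_sets G"
  shows "D \<union> E \<in> cylinder_sets G"
proof -
  obtain k where k: "\<And>k' u v. k \<le> k' \<Longrightarrow> u \<in> strings G \<Longrightarrow> v \<in> strings G \<Longrightarrow>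
    (\<And>i. i < k' \<Longrightarrow> u i = v i) \<Longrightarrow> u \<in> D \<longleftrightarrow> v \<in> D" "D \<subseteq> strings G"
    using assms(1) by (rule cylinder_setsE) blast
  obtain l where l: "\<And>k' u v. l \<le> k' \<Longrightarrow> u \<in> strings G \<Longrightarrow> v \<in> strings G \<Longrightarrow>
    (\<And>i. i < k' \<Longrightarrow> u i = v i) \<Longrightarrow> u \<in> E \<longleftrightarrow> v \<in> E" "E \<subseteq> strings G"
    using assms(2) by (rule cylinder_setsE) blast
  have "v \<in> D \<union> E" if "u \<in> strings G" "v \<in> strings G" "\<forall>i<max k l. u i = v i" "u \<in> D \<union> E" for u v
    using k(1)[of "max k l" u v] l(1)[of "max k l" u v] that by auto
  with k(2) l(2) show ?thesis unfolding cylinder_sets_def by blast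
qed

lemma cylinder_sets_empty: "{} \<in> cylinder_sets G"
  by (simp add: cylinder_sets_def)

lemma cylinder_sets_UN:
  assumes "finite I" "\<And>i. i \<in> I \<Longrightarrow> D i \<in> cylinder_sets G"
  shows "(\<Union>i\<in>I. D i) \<in> cylinder_sets G"
  using assms by (induction I) (auto simp: cylinder_sets_empty intro: cylinder_sets_Un)

lemma algebra_cylinder_sets: "algebra (strings G) (cylinder_sets G)"
  unfolding algebra_iff_Un
proof (intro conjI ballI)
  show "cylinder_sets G \<subseteq> Pow (strings G)" by (auto simp: cylinder_sets_def)
qed (simp_all add: cylinder_sets_Diff cylinder_sets_Un cylinder_sets_empty)

lemma shift_map_strings: "u \<in> strings G \<Longrightarrow> shift_map u \<in> strings G"
  by (auto simp: strings_def shift_map_def)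

lemma shift_map_funpow_strings: "u \<in> strings G \<Longrightarrow> (shift_map ^^ k) u \<in> strings G"
  by (induction k) (auto simp: shift_map_strings)

lemma cylinder_sets_vimage_shift:
  assumes "D \<in> cylinder_sets G"
  shows "shift_map -` D \<inter> strings G \<in> cylinder_sets G"
proof -
  obtain k where k: "\<And>k' u v. k \<le> k' \<Longrightarrow> u \<in> strings G \<Longrightarrow> v \<in> strings G \<Longrightarrow>
    (\<And>i. i < k' \<Longrightarrow> u i = v i) \<Longrightarrow> u \<in> D \<longleftrightarrow> v \<in> D" "D \<subseteq> strings G"
    using assms by (rule cylinder_setsE) blast
  have "v \<in> shift_map -` D \<inter> strings G"
    if "u \<in> strings G" "v \<in> strings G" "\<forall>i<Suc k. u i = v i" "u \<in> shift_map -` D \<inter> strings G" for u v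
    using k(1)[of k "shift_map u" "shift_map v"] that shift_map_strings[of _ G]
    by (auto simp: shift_map_def)
  then show ?thesis unfolding cylinder_sets_def by blast
qed

text \<open>Tychonoff for the full product. The strings form a closed subset, since a violated
  adjacency is visible in two coordinates and persists in a neighbourhood.\<close>

lemma compact_space_string_topology:
  fixes G :: "('v, 'e) pre_digraph"
  assumes "finite (arcs G)"
  shows "compact_space (string_topology G)"
proof -
  let ?P = "product_topology (\<lambda>_::nat. discrete_topology (arcs G)) UNIV"
  have comp: "compact_space ?P"
    using assms by (simp add: compact_space_product_topology compact_space_discrete_topology)
  have tp: "topspace ?P = {u. \<forall>k. u k \<in> arcs G}" by (auto simp: PiE_def)
  have "openin ?P (topspace ?P - strings G)"
  proof (subst openin_subopen, intro ballI)
    fix u assume u: "u \<in> topspace ?P - strings G"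
    then obtain k where k: "head G (u k) \<noteq> tail G (u (Suc k))" by (auto simp: strings_def tp)
    define X where "X = (\<lambda>i. if i = k \<or> i = Suc k then {u i} else arcs G)"
    have "{i. X i \<noteq> topspace (discrete_topology (arcs G))} \<subseteq> {k, Suc k}"
      by (auto simp: X_def)
    then have "openin ?P (Pi\<^sub>E UNIV X)"
      unfolding openin_PiE_gen using u by (auto simp: X_def tp intro: finite_subset)
    moreover have "u \<in> Pi\<^sub>E UNIV X" using u by (auto simp: X_def tp)
    moreover have "v \<in> topspace ?P - strings G" if v: "v \<in> Pi\<^sub>E UNIV X" for v
    proof -
      have vX: "v i \<in> X i" for i using v by auto
      have "v k = u k" "v (Suc k) = u (Suc k)" using vX[of k] vX[of "Suc k"] by (auto simp: X_def)
      moreover have "v i \<in> arcs G" for i using vX[of i] u by (auto simp: X_def tp split: if_splits)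
      ultimately have "v \<in> topspace ?P" "head G (v k) \<noteq> tail G (v (Suc k))" using k by (auto simp: tp)
      then show ?thesis by (auto simp: strings_def)
    qed
    ultimately show "\<exists>T. openin ?P T \<and> u \<in> T \<and> T \<subseteq> topspace ?P - strings G" by blast
  qed
  then have "closedin ?P (strings G)" by (auto simp: closedin_def tp strings_def)
  then have "compactin ?P (strings G)" using comp closedin_compact_space by blast
  then show ?thesis unfolding string_topology_def by (rule compact_space_subtopology)
qed

lemma finite_cylinder_cover:
  assumes "finite (arcs G)" and "\<And>u. u \<in> strings G \<Longrightarrow> u \<in> cylinder G (map u [0..<n u])"
  obtains F where "finite F" "F \<subseteq> strings G" "strings G = (\<Union>u\<in>F. cylinder G (map u [0..<n u]))"
proof -
  let ?C = "\<lambda>u. cylinder G (map u [0..<n u])"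
  have "compactin (string_topology G) (strings G)"
    using compact_space_string_topology[OF assms(1)] by (simp add: compact_space_def)
  moreover have "strings G \<subseteq> \<Union> (?C ` strings G)" using assms(2) by auto
  ultimately obtain \<F> where \<F>: "finite \<F>" "\<F> \<subseteq> ?C ` strings G" "strings G \<subseteq> \<Union>\<F>"
    using openin_cylinder unfolding compactin_def by (metis (no_types, lifting) imageE)
  then obtain F where F: "finite F" "F \<subseteq> strings G" "\<F> = ?C ` F"
    by (meson finite_subset_image)
  have "strings G = (\<Union>u\<in>F. ?C u)"
    using \<F>(3) F(3) by (auto simp: cylinder_def)
  with F show ?thesis using that by blast
qed

text \<open>Uniform continuity: finitely many cylinders on which \<open>f\<close> stays within
  \<open>e / 2\<close> of its value at the centre cover the space, and \<open>k\<close> bounds their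
  lengths.\<close>

lemma continuous_map_uniformly_cylindrical:
  fixes f :: "(nat \<Rightarrow> 'e) \<Rightarrow> real"
  assumes fin: "finite (arcs G)" and f: "continuous_map (string_topology G) euclideanreal f" and e: "0 < e"
  obtains k where "\<And>u v. u \<in> strings G \<Longrightarrow> v \<in> strings G \<Longrightarrow> (\<And>i. i < k \<Longrightarrow> u i = v i) \<Longrightarrow> \<bar>f u - f v\<bar> < e"
proof -
  have "\<exists>n. \<forall>v \<in> cylinder G (map u [0..<n]). \<bar>f v - f u\<bar> < e / 2" if u: "u \<in> strings G" for u
  proof -
    have "openin (string_topology G) {x \<in> topspace (string_topology G). f x \<in> ball (f u) (e/2)}"
      using f by (rule openin_continuous_map_preimage) simp
    then obtain n where "cylinder G (map u [0..<n]) \<subseteq> {x \<in> topspace (string_topology G). f x \<in> ball (f u) (e/2)}"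
      by (rule openin_contains_cylinder) (use u e in auto)
    then show ?thesis by (intro exI[of _ n]) (auto simp: dist_real_def abs_minus_commute)
  qed
  then obtain n where n: "\<And>u v. u \<in> strings G \<Longrightarrow> v \<in> cylinder G (map u [0..<n u]) \<Longrightarrow> \<bar>f v - f u\<bar> < e / 2"
    by metis
  obtain F where F: "finite F" "F \<subseteq> strings G" "strings G = (\<Union>u\<in>F. cylinder G (map u [0..<n u]))"
    by (rule finite_cylinder_cover[OF fin, of n]) (auto simp: mem_cylinder_map)
  obtain k where k: "\<And>u. u \<in> F \<Longrightarrow> n u \<le> k"
    using F(1) by (meson finite_imageI finite_nat_set_iff_bounded_le image_eqI)
  show ?thesis
  proof (rule that[of k])
    fix u v assume uv: "u \<in> strings G" "v \<in> strings G" "\<And>i. i < k \<Longrightarrow> u i = v i"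
    obtain x where x: "x \<in> F" "u \<in> cylinder G (map x [0..<n x])" using F(3) uv(1) by auto
    have "v i = x i" if "i < n x" for i
      using that uv(3)[of i] k[OF x(1)] x(2) by (auto simp: mem_cylinder_map)
    then have "v \<in> cylinder G (map x [0..<n x])" using uv(2) by (simp add: mem_cylinder_map)
    then have "\<bar>f v - f x\<bar> < e / 2" "\<bar>f u - f x\<bar> < e / 2" using n F(2) x by auto
    then show "\<bar>f u - f v\<bar> < e" by linarith
  qed
qed

lemma continuous_map_bounded:
  fixes f :: "(nat \<Rightarrow> 'e) \<Rightarrow> real"
  assumes fin: "finite (arcs G)" and f: "continuous_map (string_topology G) euclideanreal f"
  obtains M where "0 \<le> M" "\<And>u. u \<in> strings G \<Longrightarrow> \<bar>f u\<bar> \<le> M"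
proof -
  have "compactin euclideanreal (f ` strings G)"
    using image_compactin[OF _ f, of "strings G"] compact_space_string_topology[OF fin]
    by (simp add: compact_space_def)
  then have "bounded (f ` strings G)" by (simp add: compact_imp_bounded)
  then obtain M where "\<And>u. u \<in> strings G \<Longrightarrow> \<bar>f u\<bar> \<le> M" unfolding bounded_iff by auto
  then show ?thesis using that[of "max 0 M"] by (meson max.cobounded1 max.coboundedI2)
qed

text \<open>Cylinder sets are closed, so a decreasing sequence of nonempty ones would meet by
  compactness. Hence finite additivity on this algebra yields continuity at the empty set, as
  Caratheodory's theorem requires.\<close>

lemma cylinder_sets_decseq_empty:
  assumes fin: "finite (arcs G)" and A: "range A \<subseteq> cylinder_sets G" "decseq A" "(\<Inter>i. A i) = {}"
  obtains n where "\<And>m. n \<le> m \<Longrightarrow> A m = {}"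
proof -
  have "closedin (string_topology G) (A n)" for n
  proof -
    have "A n \<in> cylinder_sets G" using A(1) by auto
    then show ?thesis
      using openin_cylinder_sets[OF cylinder_sets_Diff] by (auto simp: closedin_def cylinder_sets_def)
  qed
  then have "\<exists>n. A n = {}"
    using compact_space_imp_nest[OF compact_space_string_topology[OF fin], of A] A(2,3) by blast
  then obtain n where "A n = {}" by blast
  then have "A m = {}" if "n \<le> m" for m using decseqD[OF A(2) that] by simp
  then show ?thesis by (rule that)
qed

section \<open>Words, walks and nonempty cylinders\<close>

lemma finite_words: "finite (arcs G) \<Longrightarrow> finite (words G n)"
  by (rule finite_subset[OF _ finite_lists_length_eq[of "arcs G" n]]) (auto simp: words_def)

lemma card_words_le: "finite (arcs G) \<Longrightarrow> card (words G n) \<le> card (arcs G) ^ n"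
  using card_mono[OF finite_lists_length_eq[of "arcs G" n], of "words G n"]
  by (auto simp: words_def card_lists_length_eq)

lemma segment_in_words: "u \<in> strings G \<Longrightarrow> map u [j..<j + n] \<in> words G n"
  by (auto simp: words_def strings_def)

lemma prefix_in_words: "u \<in> strings G \<Longrightarrow> map u [0..<n] \<in> words G n"
  using segment_in_words[of u G 0 n] by simp

lemma mem_cylinder_words: "es \<in> words G n \<Longrightarrow> u \<in> cylinder G es \<longleftrightarrow> u \<in> strings G \<and> map u [0..<n] = es"
  by (auto simp: cylinder_def words_def)

text \<open>\<open>strongly_connected\<close> admits a single vertex without edges, whose string
  space is empty; \<open>arcs_ne\<close> rules this out.\<close>

locale string_graph = fin_digraph G for G :: "('v, 'e) pre_digraph" +
  assumes sc: "strongly_connected G" and arcs_ne: "arcs G \<noteq> {}"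
begin

lemma verts_ne: "verts G \<noteq> {}"
  using sc by (auto simp: strongly_connected_def)

lemma ex_awalk: "u \<in> verts G \<Longrightarrow> v \<in> verts G \<Longrightarrow> \<exists>p. awalk u p v"
  using sc reachable_awalk by (auto simp: strongly_connected_def)

text \<open>A walk from \<open>v\<close> to the tail of some arc \<open>a\<close> either begins with
  an arc leaving \<open>v\<close> or is empty, and then \<open>a\<close> itself leaves
  \<open>v\<close>.\<close>

lemma ex_out_arc:
  assumes "v \<in> verts G"
  shows "\<exists>e\<in>arcs G. tail G e = v"
proof -
  obtain a where a: "a \<in> arcs G" using arcs_ne by auto
  obtain p where p: "awalk v p (tail G a)" using ex_awalk[OF assms tail_in_verts[OF a]] by auto
  show ?thesis
  proof (cases p)
    case Nil
    with p a show ?thesis by (auto simp: awalk_Nil_iff)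
  next
    case (Cons e p')
    with p show ?thesis by (auto simp: awalk_Cons_iff)
  qed
qed

lemma awalk_in_words: "awalk u p v \<Longrightarrow> p \<in> words G (length p)"
proof (induction p arbitrary: u)
  case Nil
  then show ?case by (simp add: words_def)
next
  case (Cons e p)
  then have e: "e \<in> arcs G" "awalk (head G e) p v" by (auto simp: awalk_Cons_iff)
  with Cons.IH have p: "p \<in> words G (length p)" by blast
  have "head G ((e # p) ! k) = tail G ((e # p) ! Suc k)" if "Suc k < Suc (length p)" for k
  proof (cases k)
    case 0
    with that obtain a p' where "p = a # p'" by (cases p) auto
    with e(2) 0 show ?thesis by (auto simp: awalk_Cons_iff)
  next
    case (Suc l)
    with that p show ?thesis by (auto simp: words_def)
  qed
  with e(1) p show ?case by (auto simp: words_def)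
qed

lemma words_ConsD:
  assumes "e # es \<in> words G (Suc n)"
  shows "e \<in> arcs G" "es \<in> words G n" "es \<noteq> [] \<Longrightarrow> head G e = tail G (hd es)"
proof -
  have *: "length es = n" "e \<in> arcs G" "set es \<subseteq> arcs G"
    "\<And>k. Suc k < Suc n \<Longrightarrow> head G ((e # es) ! k) = tail G ((e # es) ! Suc k)"
    using assms by (auto simp: words_def)
  show "e \<in> arcs G" by fact
  show "es \<in> words G n"
    using * *(4)[of "Suc _"] by (auto simp: words_def)
  show "head G e = tail G (hd es)" if "es \<noteq> []"
    using that *(4)[of 0] *(1) by (cases es) auto
qed

lemma words_awalk:
  assumes "es \<in> words G n" "0 < n"
  shows "awalk (tail G (hd es)) es (head G (last es))"
  using assms
proof (induction es arbitrary: n)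
  case (Cons e es)
  then obtain n' where n: "n = Suc n'" by (auto simp: words_def)
  note e = words_ConsD[OF Cons.prems(1)[unfolded n]]
  show ?case
  proof (cases "es = []")
    case False
    then have "0 < n'" using e(2) by (auto simp: words_def)
    from Cons.IH[OF e(2) this] show ?thesis using e False by (simp add: awalk_Cons_iff)
  qed (use e(1) in \<open>simp add: awalk_Cons_iff awalk_Nil_iff\<close>)
qed (auto simp: words_def)

text \<open>The clause on \<open>tail G (x 0)\<close> allows the induction to prepend an edge; it
  also gives the empty walk a definite starting vertex.\<close>

lemma awalk_extend:
  assumes "awalk u es v"
  shows "\<exists>x\<in>cylinder G es. tail G (x 0) = u"
  using assms
proof (induction es arbitrary: u)
  case Nil
  define out where "out = (\<lambda>v. SOME e. e \<in> arcs G \<and> tail G e = v)"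
  have out: "out v \<in> arcs G" "tail G (out v) = v" if "v \<in> verts G" for v
    using someI_ex[of "\<lambda>e. e \<in> arcs G \<and> tail G e = v"] ex_out_arc[OF that] by (auto simp: out_def)
  \<comment> \<open>From \<open>u\<close> on, a fixed choice of outgoing arc is followed at every
    vertex.\<close>
  define x where "x = (\<lambda>j. ((\<lambda>e. out (head G e)) ^^ j) (out u))"
  have u: "u \<in> verts G" using Nil by (auto simp: awalk_Nil_iff)
  have arc: "x j \<in> arcs G" for j
    by (induction j) (auto simp: x_def out u)
  then have "x \<in> strings G" by (auto simp: strings_def x_def out)
  then have "x \<in> cylinder G []" "tail G (x 0) = u" using out(2)[OF u] by (auto simp: cylinder_def x_def)
  then show ?case by blast
next
  case (Cons e es)
  then have e: "e \<in> arcs G" "u = tail G e" "awalk (head G e) es v" by (auto simp: awalk_Cons_iff)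
  obtain x where x: "x \<in> cylinder G es" "tail G (x 0) = head G e" using Cons.IH[OF e(3)] by auto
  define y where "y = (\<lambda>j. case j of 0 \<Rightarrow> e | Suc i \<Rightarrow> x i)"
  have "y \<in> strings G" using x e(1) by (auto simp: strings_def y_def cylinder_def split: nat.split)
  moreover have "map y [0..<length (e # es)] = e # map x [0..<length es]"
    unfolding y_def list.size(4) add_Suc_right add_0_right map_upt_Suc by simp
  ultimately have "y \<in> cylinder G (e # es)" using x(1) by (simp add: cylinder_def)
  moreover have "tail G (y 0) = u" by (simp add: y_def e)
  ultimately show ?case by blast
qed

lemma cylinder_ne:
  assumes "es \<in> words G n"
  shows "cylinder G es \<noteq> {}"
proof (cases n)
  case 0
  then have "es = []" using assms by (simp add: words_def)
  moreover obtain v where "v \<in> verts G" using verts_ne by auto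
  ultimately show ?thesis using awalk_extend[of v "[]" v] by (auto simp: awalk_Nil_iff)
next
  case (Suc n')
  then show ?thesis using awalk_extend[OF words_awalk[OF assms]] by auto
qed

text \<open>A representative of the cylinder, which turns a function on strings into a function on
  words.\<close>

definition ext :: "'e list \<Rightarrow> nat \<Rightarrow> 'e" where
  "ext es = (SOME u. u \<in> cylinder G es)"

lemma ext_in: "es \<in> words G n \<Longrightarrow> ext es \<in> cylinder G es"
  using cylinder_ne[of es n] unfolding ext_def by (simp add: some_in_eq)

lemma ext_strings: "es \<in> words G n \<Longrightarrow> ext es \<in> strings G"
  using ext_in[of es n] by (simp add: cylinder_def)

lemma strings_ne: "strings G \<noteq> {}"
  using ext_strings[of "[]" 0] by (auto simp: words_def)

end

section \<open>Measures on the string space\<close>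

text \<open>The common form of \<open>measure_mix\<close> and \<open>empirical_measure\<close>, and
  also of the weighted averages in the upper bound, so that countable additivity is checked once.
  \<open>N\<close> only supplies the sigma-algebra.\<close>

definition mixture :: "'a measure \<Rightarrow> 'i set \<Rightarrow> ('i \<Rightarrow> real) \<Rightarrow> ('i \<Rightarrow> 'a measure) \<Rightarrow> 'a measure" where
  "mixture N I p \<nu> = measure_of (space N) (sets N) (\<lambda>A. \<Sum>i\<in>I. ennreal (p i) * emeasure (\<nu> i) A)"

lemma sets_mixture [simp]: "sets (mixture N I p \<nu>) = sets N"
  and space_mixture [simp]: "space (mixture N I p \<nu>) = space N"
  by (simp_all add: mixture_def)

lemma emeasure_mixture:
  assumes "\<And>i. i \<in> I \<Longrightarrow> sets (\<nu> i) = sets N" and A: "A \<in> sets N"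
  shows "emeasure (mixture N I p \<nu>) A = (\<Sum>i\<in>I. ennreal (p i) * emeasure (\<nu> i) A)"
  unfolding mixture_def
proof (rule emeasure_measure_of_sigma[OF sets.sigma_algebra_axioms _ _ A])
  show "countably_additive (sets N) (\<lambda>A. \<Sum>i\<in>I. ennreal (p i) * emeasure (\<nu> i) A)"
  proof (rule countably_additiveI)
    fix A :: "nat \<Rightarrow> _" assume A: "range A \<subseteq> sets N" "disjoint_family A"
    have "(\<Sum>n. \<Sum>i\<in>I. ennreal (p i) * emeasure (\<nu> i) (A n)) = (\<Sum>i\<in>I. \<Sum>n. ennreal (p i) * emeasure (\<nu> i) (A n))"
      by (rule suminf_sum) simp
    also have "\<dots> = (\<Sum>i\<in>I. ennreal (p i) * emeasure (\<nu> i) (\<Union>n. A n))"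
      using A assms(1) by (intro sum.cong refl) (simp add: suminf_emeasure)
    finally show "(\<Sum>n. \<Sum>i\<in>I. ennreal (p i) * emeasure (\<nu> i) (A n)) =
      (\<Sum>i\<in>I. ennreal (p i) * emeasure (\<nu> i) (\<Union>n. A n))" .
  qed
qed (simp add: positive_def)

lemma measure_mixture:
  assumes "\<And>i. i \<in> I \<Longrightarrow> sets (\<nu> i) = sets N" "\<And>i. i \<in> I \<Longrightarrow> prob_space (\<nu> i)"
    and "\<And>i. i \<in> I \<Longrightarrow> 0 \<le> p i" and A: "A \<in> sets N"
  shows "measure (mixture N I p \<nu>) A = (\<Sum>i\<in>I. p i * measure (\<nu> i) A)"
proof -
  have "emeasure (mixture N I p \<nu>) A = (\<Sum>i\<in>I. ennreal (p i) * emeasure (\<nu> i) A)"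
    by (rule emeasure_mixture[OF assms(1) A])
  also have "\<dots> = (\<Sum>i\<in>I. ennreal (p i * measure (\<nu> i) A))"
  proof (rule sum.cong[OF refl])
    fix i assume i: "i \<in> I"
    interpret prob_space "\<nu> i" by (rule assms(2)[OF i])
    show "ennreal (p i) * emeasure (\<nu> i) A = ennreal (p i * measure (\<nu> i) A)"
      using assms(3)[OF i] by (simp add: emeasure_eq_measure ennreal_mult)
  qed
  also have "\<dots> = ennreal (\<Sum>i\<in>I. p i * measure (\<nu> i) A)"
    using assms(3) by (intro sum_ennreal) simp
  finally show ?thesis
    using assms(3) by (simp add: measure_def sum_nonneg)
qed

lemma prob_space_mixture:
  assumes "\<And>i. i \<in> I \<Longrightarrow> sets (\<nu> i) = sets N" "\<And>i. i \<in> I \<Longrightarrow> prob_space (\<nu> i)"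
    and "\<And>i. i \<in> I \<Longrightarrow> 0 \<le> p i" and sum: "(\<Sum>i\<in>I. p i) = 1"
  shows "prob_space (mixture N I p \<nu>)"
proof
  have "emeasure (mixture N I p \<nu>) (space N) = (\<Sum>i\<in>I. ennreal (p i) * emeasure (\<nu> i) (space N))"
    by (rule emeasure_mixture[OF assms(1)]) auto
  also have "\<dots> = (\<Sum>i\<in>I. ennreal (p i))"
  proof (rule sum.cong[OF refl])
    fix i assume i: "i \<in> I"
    have "space (\<nu> i) = space N" using assms(1)[OF i] by (rule sets_eq_imp_space_eq)
    then show "ennreal (p i) * emeasure (\<nu> i) (space N) = ennreal (p i)"
      using prob_space.emeasure_space_1[OF assms(2)[OF i]] by simp
  qed
  also have "\<dots> = 1" using assms(3) sum by (simp add: sum_ennreal)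
  finally show "emeasure (mixture N I p \<nu>) (space (mixture N I p \<nu>)) = 1" by simp
qed

text \<open>Concavity of entropy, applied to each value of \<open>X\<close> separately.\<close>

lemma ent_mixture:
  assumes "\<And>i. i \<in> I \<Longrightarrow> sets (\<nu> i) = sets N" "\<And>i. i \<in> I \<Longrightarrow> prob_space (\<nu> i)"
    and "\<And>i. i \<in> I \<Longrightarrow> 0 \<le> p i" and sum: "(\<Sum>i\<in>I. p i) = 1"
    and X: "simple_function N X"
  shows "(\<Sum>i\<in>I. p i * ent (\<nu> i) X) \<le> ent (mixture N I p \<nu>) X"
proof -
  have I: "finite I" using sum by (metis sum.infinite zero_neq_one)
  have sp: "space (\<nu> i) = space N" if "i \<in> I" for i
    using assms(1)[OF that] by (rule sets_eq_imp_space_eq)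
  define m where "m = (\<lambda>i y. measure (\<nu> i) (X -` {y} \<inter> space N))"
  have "(\<Sum>i\<in>I. p i * ent (\<nu> i) X) = (\<Sum>i\<in>I. \<Sum>y\<in>X ` space N. p i * - (m i y * ln (m i y)))"
    by (intro sum.cong refl) (simp add: ent_def sp m_def sum_distrib_left sum_negf)
  also have "\<dots> = (\<Sum>y\<in>X ` space N. \<Sum>i\<in>I. p i * - (m i y * ln (m i y)))"
    by (rule sum.swap)
  also have "\<dots> \<le> (\<Sum>y\<in>X ` space N. - ((\<Sum>i\<in>I. p i * m i y) * ln (\<Sum>i\<in>I. p i * m i y)))"
    using assms(3) by (intro sum_mono xlnx_concave I sum) (auto simp: m_def)
  also have "\<dots> = ent (mixture N I p \<nu>) X"
  proof -
    have "measure (mixture N I p \<nu>) (X -` {y} \<inter> space N) = (\<Sum>i\<in>I. p i * m i y)" for y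
      unfolding m_def using X by (intro measure_mixture assms) (auto dest: simple_functionD)
    then show ?thesis by (simp add: ent_def sum_negf)
  qed
  finally show ?thesis .
qed

section \<open>Borel probability measures determined by cylinders\<close>

lemma prob_measures_iff: "\<nu> \<in> prob_measures X \<longleftrightarrow> sets \<nu> = sets (borel_algebra X) \<and> prob_space \<nu>"
  by (simp add: prob_measures_def)

lemma mixture_in_prob_measures:
  assumes "\<And>i. i \<in> I \<Longrightarrow> \<nu> i \<in> prob_measures X" "\<And>i. i \<in> I \<Longrightarrow> 0 \<le> p i" "(\<Sum>i\<in>I. p i) = 1"
  shows "mixture (borel_algebra X) I p \<nu> \<in> prob_measures X"
  using assms by (auto simp: prob_measures_iff intro: prob_space_mixture)

lemma measure_mixture_prob_measures:
  assumes "\<And>i. i \<in> I \<Longrightarrow> \<nu> i \<in> prob_measures X" "\<And>i. i \<in> I \<Longrightarrow> 0 \<le> p i" "A \<in> sets (borel_algebra X)"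
  shows "measure (mixture (borel_algebra X) I p \<nu>) A = (\<Sum>i\<in>I. p i * measure (\<nu> i) A)"
  using assms by (intro measure_mixture) (auto simp: prob_measures_iff)

lemma measure_mix_eq_mixture:
  assumes "\<mu> \<in> prob_measures X"
  shows "measure_mix p \<mu> \<nu> = mixture (borel_algebra X) UNIV (\<lambda>b. if b then p else 1 - p) (\<lambda>b. if b then \<mu> else \<nu>)"
proof -
  have "sets \<mu> = sets (borel_algebra X)" "space \<mu> = space (borel_algebra X)"
    using assms sets_eq_imp_space_eq[of \<mu> "borel_algebra X"] by (auto simp: prob_measures_iff)
  then show ?thesis by (simp add: measure_mix_def mixture_def UNIV_bool add.commute)
qed

lemma space_borel_algebra [simp]: "space (borel_algebra X) = topspace X"
  and sets_borel_algebra: "sets (borel_algebra X) = sigma_sets (topspace X) {W. openin X W}"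
proof -
  have "{W. openin X W} \<subseteq> Pow (topspace X)" by (auto dest: openin_subset)
  then show "space (borel_algebra X) = topspace X"
    "sets (borel_algebra X) = sigma_sets (topspace X) {W. openin X W}"
    by (auto simp: borel_algebra_def)
qed

lemma prob_measures_prob_space: "\<nu> \<in> prob_measures X \<Longrightarrow> prob_space \<nu>"
  and prob_measures_sets: "\<nu> \<in> prob_measures X \<Longrightarrow> sets \<nu> = sets (borel_algebra X)"
  and prob_measures_space: "\<nu> \<in> prob_measures X \<Longrightarrow> space \<nu> = topspace X"
  using sets_eq_imp_space_eq[of \<nu> "borel_algebra X"] by (auto simp: prob_measures_iff)

lemma openin_in_sets_borel_algebra: "openin X W \<Longrightarrow> W \<in> sets (borel_algebra X)"
  by (simp add: sets_borel_algebra)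

lemma continuous_map_borel_measurable:
  assumes "\<nu> \<in> prob_measures X" "continuous_map X euclideanreal f"
  shows "f \<in> borel_measurable \<nu>"
proof (rule borel_measurableI)
  fix S :: "real set" assume "open S"
  then have "openin X {x \<in> topspace X. f x \<in> S}"
    using assms(2) by (intro openin_continuous_map_preimage) auto
  moreover have "{x \<in> topspace X. f x \<in> S} = f -` S \<inter> space \<nu>"
    by (auto simp: prob_measures_space[OF assms(1)])
  ultimately show "f -` S \<inter> space \<nu> \<in> sets \<nu>"
    by (simp add: prob_measures_sets[OF assms(1)] openin_in_sets_borel_algebra)
qed

text \<open>There are only countably many words over the finite set of arcs, so every open set is a
  countable union of cylinders.\<close>

lemma sets_borel_string_topology:
  assumes "finite (arcs G)"
  shows "sets (borel_algebra (string_topology G)) = sigma_sets (strings G) (cylinder_sets G)"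
proof -
  have "W \<in> sigma_sets (strings G) (cylinder_sets G)" if W: "openin (string_topology G) W" for W
  proof -
    define Q where "Q = {es. set es \<subseteq> arcs G \<and> cylinder G es \<subseteq> W}"
    have "countable (lists (arcs G))"
      using assms by (intro countable_lists countable_finite)
    then have "countable Q" by (rule countable_subset[rotated]) (auto simp: Q_def)
    have "(\<Union>es\<in>Q. cylinder G es) \<in> sigma_sets (strings G) (cylinder_sets G)"
    proof -
      interpret sigma_algebra "strings G" "sigma_sets (strings G) (cylinder_sets G)"
        by (rule sigma_algebra_sigma_sets) (auto simp: cylinder_sets_def)
      show ?thesis
        using \<open>countable Q\<close> by (intro countable_UN'') (auto intro: cylinder_in_cylinder_sets)
    qed
    moreover have "W = (\<Union>es\<in>Q. cylinder G es)"
    proof (intro set_eqI iffI)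
      fix u assume u: "u \<in> W"
      then have us: "u \<in> strings G" using openin_subset[OF W] by auto
      obtain n where n: "cylinder G (map u [0..<n]) \<subseteq> W"
        using openin_contains_cylinder[OF W u] .
      have "map u [0..<n] \<in> Q" using n us by (auto simp: Q_def strings_def)
      moreover have "u \<in> cylinder G (map u [0..<n])" using us by (simp add: mem_cylinder_map)
      ultimately show "u \<in> (\<Union>es\<in>Q. cylinder G es)" by blast
    qed (auto simp: Q_def)
    ultimately show ?thesis by simp
  qed
  then have "sigma_sets (strings G) {W. openin (string_topology G) W} \<subseteq> sigma_sets (strings G) (cylinder_sets G)"
    by (intro sigma_sets_mono) auto
  moreover have "sigma_sets (strings G) (cylinder_sets G) \<subseteq> sigma_sets (strings G) {W. openin (string_topology G) W}"
    by (intro sigma_sets_mono) (auto intro: openin_cylinder_sets)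
  ultimately show ?thesis by (simp add: sets_borel_algebra)
qed

lemma cylinder_sets_in_borel: "D \<in> cylinder_sets G \<Longrightarrow> D \<in> sets (borel_algebra (string_topology G))"
  by (intro openin_in_sets_borel_algebra openin_cylinder_sets)

lemma cylinder_in_borel: "cylinder G es \<in> sets (borel_algebra (string_topology G))"
  by (intro openin_in_sets_borel_algebra openin_cylinder)

lemma empirical_measure_eq_mixture:
  "empirical_measure G n u = mixture (borel_algebra (string_topology G)) {..<n} (\<lambda>_. 1 / real n)
     (\<lambda>k. return (borel_algebra (string_topology G)) ((shift_map ^^ k) u))"
  by (simp add: empirical_measure_def mixture_def Let_def sum_distrib_left)

lemma return_in_prob_measures:
  "u \<in> topspace X \<Longrightarrow> return (borel_algebra X) u \<in> prob_measures X"
  by (auto simp: prob_measures_iff intro: prob_space_return)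

lemma empirical_measure_in_prob_measures:
  assumes "u \<in> strings G" "0 < n"
  shows "empirical_measure G n u \<in> prob_measures (string_topology G)"
  unfolding empirical_measure_eq_mixture
  using assms by (intro mixture_in_prob_measures return_in_prob_measures)
    (auto simp: shift_map_funpow_strings)

lemma measure_empirical_measure:
  assumes "u \<in> strings G" "A \<in> sets (borel_algebra (string_topology G))"
  shows "measure (empirical_measure G n u) A = (\<Sum>k<n. indicator A ((shift_map ^^ k) u)) / real n"
proof -
  have "measure (empirical_measure G n u) A = (\<Sum>k<n. 1 / real n *
      measure (return (borel_algebra (string_topology G)) ((shift_map ^^ k) u)) A)"
    unfolding empirical_measure_eq_mixture
    using assms by (intro measure_mixture_prob_measures return_in_prob_measures)
      (auto simp: shift_map_funpow_strings)
  then show ?thesis using assms(2) by (simp add: measure_return sum_divide_distrib)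
qed

context string_graph begin

abbreviation "pmeas \<equiv> prob_measures (string_topology G)"
abbreviation "cyl \<equiv> cylinder G"

lemma prob_measure_eqI:
  assumes \<mu>: "\<mu> \<in> pmeas" and \<nu>: "\<nu> \<in> pmeas"
    and eq: "\<And>D. D \<in> cylinder_sets G \<Longrightarrow> measure \<mu> D = measure \<nu> D"
  shows "\<mu> = \<nu>"
proof (rule measure_eqI_generator_eq[where \<Omega>="strings G" and E="cylinder_sets G" and A="\<lambda>_. strings G"])
  interpret algebra "strings G" "cylinder_sets G" by (rule algebra_cylinder_sets)
  interpret m: prob_space \<mu> using \<mu> by (rule prob_measures_prob_space)
  interpret n: prob_space \<nu> using \<nu> by (rule prob_measures_prob_space)
  show "Int_stable (cylinder_sets G)" by (auto simp: Int_stable_def)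
  show "cylinder_sets G \<subseteq> Pow (strings G)" by (rule space_closed)
  show "range (\<lambda>_::nat. strings G) \<subseteq> cylinder_sets G" by auto
  show "sets \<mu> = sigma_sets (strings G) (cylinder_sets G)" "sets \<nu> = sigma_sets (strings G) (cylinder_sets G)"
    using \<mu> \<nu> by (simp_all add: prob_measures_sets sets_borel_string_topology)
  show "emeasure \<mu> D = emeasure \<nu> D" if "D \<in> cylinder_sets G" for D
    using eq[OF that] by (simp add: m.emeasure_eq_measure n.emeasure_eq_measure)
  show "emeasure \<mu> (strings G) \<noteq> \<infinity>" by simp
qed auto

lemma finite_words' [simp]: "finite (words G n)"
  by (rule finite_words) simp

lemma disjoint_cylinders: "disjoint_family_on cyl (words G n)"
  unfolding disjoint_family_on_def by (auto simp: mem_cylinder_words)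

text \<open>\<open>Q\<close> is chosen before \<open>\<nu>\<close>: one finite sum of cylinder
  frequencies serves all measures, so convergence on cylinders carries over to all cylinder
  sets.\<close>

lemma measure_cylinder_set:
  assumes D: "D \<in> cylinder_sets G"
  shows "\<exists>k Q. Q \<subseteq> words G k \<and> (\<forall>\<nu>\<in>pmeas. measure \<nu> D = (\<Sum>w\<in>Q. measure \<nu> (cyl w)))"
proof -
  obtain k where k: "\<And>k' u v. k \<le> k' \<Longrightarrow> u \<in> strings G \<Longrightarrow> v \<in> strings G \<Longrightarrow>
    (\<And>i. i < k' \<Longrightarrow> u i = v i) \<Longrightarrow> u \<in> D \<longleftrightarrow> v \<in> D" "D \<subseteq> strings G"
    using D by (rule cylinder_setsE) blast
  define Q where "Q = {w \<in> words G k. cyl w \<subseteq> D}"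
  have D_eq: "D = (\<Union>w\<in>Q. cyl w)"
  proof (intro set_eqI iffI)
    fix u assume u: "u \<in> D"
    then have us: "u \<in> strings G" using k(2) by auto
    have "cyl (map u [0..<k]) \<subseteq> D"
    proof
      fix v assume "v \<in> cyl (map u [0..<k])"
      then show "v \<in> D" using k(1)[of k v u] u us by (auto simp: mem_cylinder_map)
    qed
    then have "map u [0..<k] \<in> Q" using us by (simp add: Q_def prefix_in_words)
    moreover have "u \<in> cyl (map u [0..<k])" using us by (simp add: mem_cylinder_map)
    ultimately show "u \<in> (\<Union>w\<in>Q. cyl w)" by blast
  qed (auto simp: Q_def)
  have Q: "Q \<subseteq> words G k" by (auto simp: Q_def)
  show ?thesis
  proof (intro exI conjI ballI, rule Q)
    fix \<nu> assume \<nu>: "\<nu> \<in> pmeas"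
    interpret prob_space \<nu> using \<nu> by (rule prob_measures_prob_space)
    show "measure \<nu> D = (\<Sum>w\<in>Q. measure \<nu> (cyl w))"
      unfolding D_eq
      using Q disjoint_cylinders[of k] finite_subset[OF Q]
      by (intro finite_measure_finite_Union)
        (auto simp: prob_measures_sets[OF \<nu>] cylinder_in_borel disjoint_family_on_def)
  qed
qed

lemma sum_measure_cyl:
  assumes \<nu>: "\<nu> \<in> pmeas"
  shows "(\<Sum>w\<in>words G n. measure \<nu> (cyl w)) = 1"
proof -
  interpret prob_space \<nu> using \<nu> by (rule prob_measures_prob_space)
  have "(\<Sum>w\<in>words G n. measure \<nu> (cyl w)) = measure \<nu> (\<Union>w\<in>words G n. cyl w)"
    using disjoint_cylinders[of n]
    by (intro finite_measure_finite_Union[symmetric])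
      (auto simp: prob_measures_sets[OF \<nu>] cylinder_in_borel)
  also have "(\<Union>w\<in>words G n. cyl w) = space \<nu>"
    using prefix_in_words[of _ G n] by (auto simp: prob_measures_space[OF \<nu>] mem_cylinder_words)
  finally show ?thesis by (simp add: prob_space)
qed

section \<open>Integrals and the weak topology through cylinder frequencies\<close>

lemma integral_prefix:
  fixes h :: "'e list \<Rightarrow> real"
  assumes \<nu>: "\<nu> \<in> pmeas"
  shows "integrable \<nu> (\<lambda>u. h (map u [0..<k]))"
    and "(\<integral>u. h (map u [0..<k]) \<partial>\<nu>) = (\<Sum>w\<in>words G k. h w * measure \<nu> (cyl w))"
proof -
  interpret prob_space \<nu> using \<nu> by (rule prob_measures_prob_space)
  have cyl_sets [measurable]: "cyl w \<in> sets \<nu>" for w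
    by (simp add: prob_measures_sets[OF \<nu>] cylinder_in_borel)
  have eq: "h (map u [0..<k]) = (\<Sum>w\<in>words G k. h w * indicator (cyl w) u)" if "u \<in> space \<nu>" for u
  proof -
    have u: "u \<in> strings G" using that by (simp add: prob_measures_space[OF \<nu>])
    have "(\<Sum>w\<in>words G k. h w * indicator (cyl w) u) = (\<Sum>w\<in>words G k. if w = map u [0..<k] then h w else 0)"
      using u by (intro sum.cong) (auto simp: mem_cylinder_words indicator_def)
    then show ?thesis using prefix_in_words[OF u] by simp
  qed
  have int_w: "integrable \<nu> (\<lambda>u. h w * indicator (cyl w) u)" for w
    by (intro integrable_mult_right integrable_real_indicator) (auto simp: emeasure_eq_measure)
  show "integrable \<nu> (\<lambda>u. h (map u [0..<k]))"
    by (rule iffD2[OF Bochner_Integration.integrable_cong[OF refl eq] Bochner_Integration.integrable_sum[OF int_w]])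
  have "(\<integral>u. h (map u [0..<k]) \<partial>\<nu>) = (\<integral>u. (\<Sum>w\<in>words G k. h w * indicator (cyl w) u) \<partial>\<nu>)"
    by (rule Bochner_Integration.integral_cong[OF refl eq])
  also have "\<dots> = (\<Sum>w\<in>words G k. h w * measure \<nu> (cyl w))"
    using int_w by (subst Bochner_Integration.integral_sum) (auto simp: emeasure_eq_measure)
  finally show "(\<integral>u. h (map u [0..<k]) \<partial>\<nu>) = (\<Sum>w\<in>words G k. h w * measure \<nu> (cyl w))" .
qed

text \<open>The bridge from weak convergence to words: \<open>f\<close> is replaced by a function of
  the first \<open>k\<close> letters, and \<open>k\<close> depends on \<open>f\<close> and
  \<open>e\<close> but not on \<open>\<nu>\<close>.\<close>

lemma integral_step:
  assumes f: "continuous_map (string_topology G) euclideanreal f" and e: "0 < e"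
  obtains k where "\<And>\<nu>. \<nu> \<in> pmeas \<Longrightarrow> \<bar>integral\<^sup>L \<nu> f - (\<Sum>w\<in>words G k. f (ext w) * measure \<nu> (cyl w))\<bar> \<le> e"
proof -
  obtain k where k: "\<And>u v. u \<in> strings G \<Longrightarrow> v \<in> strings G \<Longrightarrow> (\<And>i. i < k \<Longrightarrow> u i = v i) \<Longrightarrow> \<bar>f u - f v\<bar> < e"
    using continuous_map_uniformly_cylindrical[OF finite_arcs f e] by blast
  obtain M where M: "\<And>u. u \<in> strings G \<Longrightarrow> \<bar>f u\<bar> \<le> M"
    using continuous_map_bounded[OF finite_arcs f] by blast
  show ?thesis
  proof (rule that[of k])
    fix \<nu> assume \<nu>: "\<nu> \<in> pmeas"
    interpret prob_space \<nu> using \<nu> by (rule prob_measures_prob_space)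
    have meas [measurable]: "f \<in> borel_measurable \<nu>"
      by (rule continuous_map_borel_measurable[OF \<nu> f])
    have sp: "space \<nu> = strings G" by (simp add: prob_measures_space[OF \<nu>])
    have int_f: "integrable \<nu> f"
      by (rule integrable_const_bound[of _ M]) (auto simp: sp M)
    note g = integral_prefix[OF \<nu>, of "\<lambda>w. f (ext w)" k]
    have "integral\<^sup>L \<nu> f - (\<Sum>w\<in>words G k. f (ext w) * measure \<nu> (cyl w)) = (\<integral>u. f u - f (ext (map u [0..<k])) \<partial>\<nu>)"
      using int_f g by simp
    also have "\<bar>\<dots>\<bar> \<le> (\<integral>u. e \<partial>\<nu>)"
    proof (rule order_trans[OF integral_abs_bound integral_mono])
      fix u assume "u \<in> space \<nu>"
      then have u: "u \<in> strings G" by (simp add: sp)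
      then have "ext (map u [0..<k]) \<in> cyl (map u [0..<k])" using ext_in prefix_in_words by blast
      then show "\<bar>f u - f (ext (map u [0..<k]))\<bar> \<le> e"
        using k[of u "ext (map u [0..<k])"] u by (simp add: mem_cylinder_map less_imp_le)
    qed (use int_f g in auto)
    finally show "\<bar>integral\<^sup>L \<nu> f - (\<Sum>w\<in>words G k. f (ext w) * measure \<nu> (cyl w))\<bar> \<le> e"
      by (simp add: prob_space)
  qed
qed

text \<open>The approximating word sums are linear in the measure, and the error of
  \<open>integral_step\<close> is uniform, so it survives the average with weights \<open>p\<close>.
  Letting the error tend to zero gives equality.\<close>

lemma integral_mixture:
  assumes \<nu>: "\<And>i. i \<in> I \<Longrightarrow> \<nu> i \<in> pmeas" and p: "\<And>i. i \<in> I \<Longrightarrow> 0 \<le> p i" "(\<Sum>i\<in>I. p i) = 1"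
    and f: "continuous_map (string_topology G) euclideanreal f"
  shows "integral\<^sup>L (mixture (borel_algebra (string_topology G)) I p \<nu>) f = (\<Sum>i\<in>I. p i * integral\<^sup>L (\<nu> i) f)"
proof -
  let ?\<mu> = "mixture (borel_algebra (string_topology G)) I p \<nu>"
  have \<mu>: "?\<mu> \<in> pmeas" using assms by (intro mixture_in_prob_measures)
  have "\<bar>integral\<^sup>L ?\<mu> f - (\<Sum>i\<in>I. p i * integral\<^sup>L (\<nu> i) f)\<bar> \<le> 0 + e" if e: "0 < e" for e
  proof -
    obtain k where k: "\<And>\<nu>. \<nu> \<in> pmeas \<Longrightarrow> \<bar>integral\<^sup>L \<nu> f - (\<Sum>w\<in>words G k. f (ext w) * measure \<nu> (cyl w))\<bar> \<le> e / 2"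
      using integral_step[OF f, of "e / 2"] e by auto
    let ?s = "\<lambda>\<nu>. \<Sum>w\<in>words G k. f (ext w) * measure \<nu> (cyl w)"
    have "?s ?\<mu> = (\<Sum>w\<in>words G k. \<Sum>i\<in>I. p i * (f (ext w) * measure (\<nu> i) (cyl w)))"
      using \<nu> p by (intro sum.cong refl)
        (simp add: measure_mixture_prob_measures cylinder_in_borel sum_distrib_left mult.left_commute)
    also have "\<dots> = (\<Sum>i\<in>I. p i * ?s (\<nu> i))"
      by (subst sum.swap) (simp add: sum_distrib_left)
    finally have s: "?s ?\<mu> = (\<Sum>i\<in>I. p i * ?s (\<nu> i))" .
    have "\<bar>(\<Sum>i\<in>I. p i * integral\<^sup>L (\<nu> i) f) - (\<Sum>i\<in>I. p i * ?s (\<nu> i))\<bar>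
        = \<bar>\<Sum>i\<in>I. p i * (integral\<^sup>L (\<nu> i) f - ?s (\<nu> i))\<bar>"
      by (simp add: sum_subtractf right_diff_distrib)
    also have "\<dots> \<le> (\<Sum>i\<in>I. p i * (e / 2))"
      using p k[OF \<nu>] by (intro order_trans[OF sum_abs] sum_mono) (simp add: abs_mult mult_left_mono del: times_divide_eq_right)
    also have "\<dots> = e / 2" using p(2) by (simp flip: sum_divide_distrib sum_distrib_right)
    finally show ?thesis using k[OF \<mu>] s by linarith
  qed
  then have "\<bar>integral\<^sup>L ?\<mu> f - (\<Sum>i\<in>I. p i * integral\<^sup>L (\<nu> i) f)\<bar> \<le> 0"
    by (rule field_le_epsilon)
  then show ?thesis by simp
qed

lemma integral_empirical_measure:
  assumes u: "u \<in> strings G" and n: "0 < n" and f: "continuous_map (string_topology G) euclideanreal f"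
  shows "integral\<^sup>L (empirical_measure G n u) f = (\<Sum>k<n. f ((shift_map ^^ k) u)) / real n"
proof -
  have ret: "return (borel_algebra (string_topology G)) ((shift_map ^^ k) u) \<in> pmeas" for k
    using u by (intro return_in_prob_measures) (simp add: shift_map_funpow_strings)
  have "integral\<^sup>L (empirical_measure G n u) f =
    (\<Sum>k<n. 1 / real n * integral\<^sup>L (return (borel_algebra (string_topology G)) ((shift_map ^^ k) u)) f)"
    unfolding empirical_measure_eq_mixture using n by (intro integral_mixture ret f) auto
  also have "\<dots> = (\<Sum>k<n. 1 / real n * f ((shift_map ^^ k) u))"
  proof (intro sum.cong refl)
    fix k
    have "f \<in> borel_measurable (borel_algebra (string_topology G))"
      using continuous_map_borel_measurable[OF ret f] by simp
    then show "1 / real n * integral\<^sup>L (return (borel_algebra (string_topology G)) ((shift_map ^^ k) u)) f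
      = 1 / real n * f ((shift_map ^^ k) u)"
      using u by (subst integral_return) (auto simp: shift_map_funpow_strings)
  qed
  finally show ?thesis by (simp add: sum_divide_distrib)
qed

text \<open>Induction over the generation of the topology. Only the subbasic sets need an argument:
  there \<open>integral_step\<close> reduces the integral to a finite sum of frequencies.\<close>

lemma weak_neighbourhood:
  assumes W: "openin (weak_topology (string_topology G)) W" and \<mu>: "\<mu> \<in> pmeas" "\<mu> \<in> W"
  obtains Q d where "finite Q" "0 < d"
    "\<And>\<nu>. \<nu> \<in> pmeas \<Longrightarrow> (\<And>w. w \<in> Q \<Longrightarrow> \<bar>measure \<nu> (cyl w) - measure \<mu> (cyl w)\<bar> < d) \<Longrightarrow> \<nu> \<in> W"
proof -
  define nb where "nb = (\<lambda>W Q d. finite Q \<and> 0 < (d::real) \<and> (\<forall>\<nu>\<in>pmeas.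
     (\<forall>w\<in>Q. \<bar>measure \<nu> (cyl w) - measure \<mu> (cyl w)\<bar> < d) \<longrightarrow> \<nu> \<in> W))"
  have "generate_topology_on {{\<mu> \<in> pmeas. integral\<^sup>L \<mu> f \<in> V} | f V.
        continuous_map (string_topology G) euclideanreal f \<and> bounded (f ` topspace (string_topology G)) \<and> open V} W"
    using W unfolding weak_topology_def openin_topology_generated_by_iff .
  then have "\<mu> \<in> W \<longrightarrow> (\<exists>Q d. nb W Q d)"
  proof induction
    case (Int A B)
    show ?case
    proof
      assume "\<mu> \<in> A \<inter> B"
      then obtain Q d Q' d' where "nb A Q d" "nb B Q' d'" using Int.IH by blast
      then have "nb (A \<inter> B) (Q \<union> Q') (min d d')" by (auto simp: nb_def)
      then show "\<exists>Q d. nb (A \<inter> B) Q d" by blast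
    qed
  next
    case (UN K)
    show ?case
    proof
      assume "\<mu> \<in> \<Union>K"
      then obtain A Q d where "A \<in> K" "nb A Q d" using UN.IH by blast
      then have "nb (\<Union>K) Q d" by (auto simp: nb_def)
      then show "\<exists>Q d. nb (\<Union>K) Q d" by blast
    qed
  next
    case (Basis W)
    then obtain f V where fV: "continuous_map (string_topology G) euclideanreal f" "open V"
      "W = {\<mu> \<in> pmeas. integral\<^sup>L \<mu> f \<in> V}" by blast
    show ?case
    proof
      assume "\<mu> \<in> W"
      then have "integral\<^sup>L \<mu> f \<in> V" using fV by simp
      then obtain e where e: "0 < e" "\<And>y. \<bar>y - integral\<^sup>L \<mu> f\<bar> < e \<Longrightarrow> y \<in> V"
        using fV(2) unfolding open_dist dist_real_def by blast
      obtain k where k: "\<And>\<nu>. \<nu> \<in> pmeas \<Longrightarrow> \<bar>integral\<^sup>L \<nu> f - (\<Sum>w\<in>words G k. f (ext w) * measure \<nu> (cyl w))\<bar> \<le> e / 4"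
        using integral_step[OF fV(1), of "e / 4"] e by auto
      \<comment> \<open>\<open>S\<close> dominates the coefficients of the word sum; the summand 1
        keeps it positive. With the tolerance \<open>e / (4 * S)\<close> the sums differ by at most
        \<open>e / 4\<close>, and the two approximations cost \<open>e / 4\<close> each.\<close>
      define S where "S = (\<Sum>w\<in>words G k. \<bar>f (ext w)\<bar>) + 1"
      have S: "1 \<le> S" by (simp add: S_def sum_nonneg)
      have "nb W (words G k) (e / (4 * S))"
        unfolding nb_def
      proof (intro conjI ballI impI)
        show "0 < e / (4 * S)" using e S by simp
        fix \<nu> assume \<nu>: "\<nu> \<in> pmeas" and close: "\<forall>w\<in>words G k. \<bar>measure \<nu> (cyl w) - measure \<mu> (cyl w)\<bar> < e / (4 * S)"
        let ?s = "\<lambda>\<nu>. \<Sum>w\<in>words G k. f (ext w) * measure \<nu> (cyl w)"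
        have "\<bar>?s \<nu> - ?s \<mu>\<bar> = \<bar>\<Sum>w\<in>words G k. f (ext w) * (measure \<nu> (cyl w) - measure \<mu> (cyl w))\<bar>"
          by (simp add: sum_subtractf right_diff_distrib)
        also have "\<dots> \<le> (\<Sum>w\<in>words G k. \<bar>f (ext w)\<bar> * (e / (4 * S)))"
          using close by (intro order_trans[OF sum_abs] sum_mono) (simp add: abs_mult mult_left_mono less_imp_le del: times_divide_eq_right)
        also have "\<dots> = (S - 1) * (e / (4 * S))" unfolding sum_distrib_right[symmetric] by (simp add: S_def)
        also have "\<dots> \<le> S * (e / (4 * S))" using S e by (intro mult_right_mono) auto
        also have "\<dots> = e / 4" using S by simp
        finally have "\<bar>integral\<^sup>L \<nu> f - integral\<^sup>L \<mu> f\<bar> < e"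
          using k[OF \<nu>] k[OF \<mu>(1)] e by linarith
        then show "\<nu> \<in> W" using e(2) \<nu> fV(3) by simp
      qed simp
      then show "\<exists>Q d. nb W Q d" by blast
    qed
  qed simp
  then obtain Q d where "nb W Q d" using \<mu> by blast
  then show ?thesis using that by (auto simp: nb_def)
qed

lemma topspace_weak_topology: "topspace (weak_topology (string_topology G)) = pmeas"
proof -
  have "pmeas = {\<mu> \<in> pmeas. integral\<^sup>L \<mu> (\<lambda>_. 0) \<in> (UNIV :: real set)}" by simp
  then have "pmeas \<in> {{\<mu> \<in> pmeas. integral\<^sup>L \<mu> f \<in> V} | f V.
        continuous_map (string_topology G) euclideanreal f \<and> bounded (f ` topspace (string_topology G)) \<and> open V}"
    by (intro CollectI exI[of _ "\<lambda>_. 0"] exI[of _ UNIV]) (auto simp: image_constant_conv)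
  then show ?thesis unfolding weak_topology_def topology_generated_by_topspace by blast
qed

lemma continuous_map_integral:
  assumes f: "continuous_map (string_topology G) euclideanreal f"
  shows "continuous_map (weak_topology (string_topology G)) euclideanreal (\<lambda>\<nu>. integral\<^sup>L \<nu> f)"
proof -
  obtain M where M: "\<And>u. u \<in> strings G \<Longrightarrow> \<bar>f u\<bar> \<le> M"
    using continuous_map_bounded[OF finite_arcs f] by blast
  have "bounded (f ` strings G)" by (rule boundedI[of _ M]) (use M in auto)
  then have "openin (weak_topology (string_topology G)) {\<mu> \<in> pmeas. integral\<^sup>L \<mu> f \<in> V}" if "open V" for V
    unfolding weak_topology_def using f that
    by (intro topology_generated_by_Basis) auto
  then show ?thesis
    by (auto simp: continuous_map_def topspace_weak_topology)
qed

text \<open>Sequential compactness of the space of measures. A diagonal subsequence makes the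
  frequencies of the countably many words converge; the limit is finitely additive on the cylinder
  algebra and extends by Caratheodory, since \<open>cylinder_sets_decseq_empty\<close> provides
  continuity at the empty set.\<close>

lemma prob_measures_seq_compact:
  assumes \<mu>: "\<And>n. \<mu> n \<in> pmeas"
  obtains r \<nu> where "strict_mono (r :: nat \<Rightarrow> nat)" "\<nu> \<in> pmeas"
    "\<And>D. D \<in> cylinder_sets G \<Longrightarrow> (\<lambda>n. measure (\<mu> (r n)) D) \<longlonglongrightarrow> measure \<nu> D"
proof -
  have ps: "prob_space (\<mu> n)" for n using \<mu> by (rule prob_measures_prob_space)
  have "countable (lists (arcs G))" by (intro countable_lists countable_finite) simp
  moreover have "norm (measure (\<mu> n) (cyl w)) \<le> 1" for n w
    using prob_space.prob_le_1[OF ps] by simp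
  ultimately obtain r where r: "strict_mono r"
    "\<And>w. w \<in> lists (arcs G) \<Longrightarrow> \<exists>l. (\<lambda>n. measure (\<mu> (r n)) (cyl w)) \<longlonglongrightarrow> l"
    by (rule function_convergent_subsequence[of "lists (arcs G)" "\<lambda>n w. measure (\<mu> n) (cyl w)"]) blast+
  have "convergent (\<lambda>n. measure (\<mu> (r n)) D)" if D: "D \<in> cylinder_sets G" for D
  proof -
    obtain k Q where Q: "Q \<subseteq> words G k" "\<And>\<nu>. \<nu> \<in> pmeas \<Longrightarrow> measure \<nu> D = (\<Sum>w\<in>Q. measure \<nu> (cyl w))"
      using measure_cylinder_set[OF D] by blast
    have "\<exists>l. (\<lambda>n. measure (\<mu> (r n)) (cyl w)) \<longlonglongrightarrow> l" if "w \<in> Q" for w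
      using r(2)[of w] that Q(1) by (auto simp: words_def)
    then obtain l where "\<And>w. w \<in> Q \<Longrightarrow> (\<lambda>n. measure (\<mu> (r n)) (cyl w)) \<longlonglongrightarrow> l w" by metis
    then have "(\<lambda>n. \<Sum>w\<in>Q. measure (\<mu> (r n)) (cyl w)) \<longlonglongrightarrow> (\<Sum>w\<in>Q. l w)" by (rule tendsto_sum)
    then show ?thesis unfolding convergent_def using Q(2)[OF \<mu>] by auto
  qed
  then obtain f where f: "\<And>D. D \<in> cylinder_sets G \<Longrightarrow> (\<lambda>n. measure (\<mu> (r n)) D) \<longlonglongrightarrow> f D"
    unfolding convergent_def by metis
  have f0: "0 \<le> f D" if "D \<in> cylinder_sets G" for D
    by (rule LIMSEQ_le_const[OF f[OF that]]) auto
  interpret alg: algebra "strings G" "cylinder_sets G" by (rule algebra_cylinder_sets)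
  have fe: "f {} = 0" using LIMSEQ_unique[OF f[OF cylinder_sets_empty]] by simp
  have fadd: "f (A \<union> B) = f A + f B"
    if "A \<in> cylinder_sets G" "B \<in> cylinder_sets G" "A \<inter> B = {}" for A B
  proof -
    have "measure (\<mu> (r n)) (A \<union> B) = measure (\<mu> (r n)) A + measure (\<mu> (r n)) B" for n
    proof -
      interpret prob_space "\<mu> (r n)" by (rule ps)
      show ?thesis using that
        by (intro finite_measure_Union) (auto simp: prob_measures_sets[OF \<mu>] cylinder_sets_in_borel)
    qed
    then have "(\<lambda>n. measure (\<mu> (r n)) (A \<union> B)) \<longlonglongrightarrow> f A + f B"
      using tendsto_add[OF f[OF that(1)] f[OF that(2)]] by simp
    then show ?thesis using LIMSEQ_unique f[OF cylinder_sets_Un[OF that(1,2)]] by blast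
  qed
  have "\<exists>m. (\<forall>s\<in>cylinder_sets G. m s = ennreal (f s)) \<and>
      measure_space (strings G) (sigma_sets (strings G) (cylinder_sets G)) m"
  proof (rule alg.caratheodory_empty_continuous)
    show "positive (cylinder_sets G) (\<lambda>s. ennreal (f s))" by (simp add: positive_def fe)
    show "additive (cylinder_sets G) (\<lambda>s. ennreal (f s))"
      by (auto simp: additive_def fadd f0 ennreal_plus)
    fix A assume "range A \<subseteq> cylinder_sets G" "decseq A" "\<Inter> (range A) = {}"
    then obtain n where n: "\<And>m. n \<le> m \<Longrightarrow> A m = {}"
      using cylinder_sets_decseq_empty[of G A] by auto
    have "eventually (\<lambda>m. ennreal (f (A m)) = 0) sequentially"
      unfolding eventually_sequentially using n fe by (intro exI[of _ n]) auto
    then show "(\<lambda>i. ennreal (f (A i))) \<longlonglongrightarrow> 0" by (rule tendsto_eventually)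
  qed simp
  then obtain m where m: "\<And>s. s \<in> cylinder_sets G \<Longrightarrow> m s = ennreal (f s)"
    "measure_space (strings G) (sigma_sets (strings G) (cylinder_sets G)) m" by blast
  define \<nu> where "\<nu> = measure_of (strings G) (sigma_sets (strings G) (cylinder_sets G)) m"
  have sub: "sigma_sets (strings G) (cylinder_sets G) \<subseteq> Pow (strings G)"
    using sigma_sets_into_sp[OF alg.space_closed] by blast
  interpret sg: sigma_algebra "strings G" "sigma_sets (strings G) (cylinder_sets G)"
    by (rule sigma_algebra_sigma_sets) (rule alg.space_closed)
  have sets_\<nu>: "sets \<nu> = sigma_sets (strings G) (cylinder_sets G)"
    unfolding \<nu>_def using sub by (simp add: sg.sigma_sets_eq)
  have space_\<nu>: "space \<nu> = strings G"
    unfolding \<nu>_def using sub by simp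
  have em: "emeasure \<nu> s = ennreal (f s)" if "s \<in> cylinder_sets G" for s
    unfolding \<nu>_def m(1)[OF that, symmetric]
    using m(2) that by (intro emeasure_measure_of_sigma) (auto simp: measure_space_def)
  have me: "measure \<nu> s = f s" if "s \<in> cylinder_sets G" for s
    using em[OF that] f0[OF that] by (simp add: measure_def)
  have "f (strings G) = 1"
  proof -
    have "measure (\<mu> (r n)) (strings G) = 1" for n
      using prob_space.prob_space[OF ps[of "r n"]] by (simp add: prob_measures_space[OF \<mu>])
    then show ?thesis using LIMSEQ_unique[OF f[OF alg.top]] by simp
  qed
  then have "prob_space \<nu>" by (intro prob_spaceI) (simp add: space_\<nu> em)
  then have "\<nu> \<in> pmeas" by (simp add: prob_measures_iff sets_\<nu> sets_borel_string_topology)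
  then show ?thesis using that[OF r(1)] f me by simp
qed

end

section \<open>Entropy of the shift\<close>

lemma block_Suc_start: "block T l (Suc j) q x = block T l j q (T x)"
proof -
  have "(T ^^ i) (T x) = (T ^^ Suc i) x" for i by (simp add: funpow_swap1)
  moreover have "[Suc j..<Suc j + q] = map Suc [j..<j + q]" by (simp add: map_Suc_upt)
  ultimately show ?thesis by (simp add: block_def del: upt_Suc funpow.simps)
qed

lemma block_eq_iff: "block T l j q x = block T l j q y \<longleftrightarrow> (\<forall>i. j \<le> i \<and> i < j + q \<longrightarrow> l ((T ^^ i) x) = l ((T ^^ i) y))"
  by (auto simp: block_def)

lemma finite_fibres:
  assumes "finite (X ` space M)"
  shows "finite (fibres M X)"
proof -
  have "fibres M X = (\<lambda>y. X -` {y} \<inter> space M) ` X ` space M" by (auto simp: fibres_def)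
  with assms show ?thesis by simp
qed

lemma partition_on_fibres: "partition_on (space M) (fibres M X)"
  by (auto simp: partition_on_def fibres_def disjoint_def)

lemma fibres_subset_sets: "simple_function M X \<Longrightarrow> fibres M X \<subseteq> sets M"
  by (auto simp: fibres_def dest: simple_functionD)

definition entropy_rate :: "'a measure \<Rightarrow> ('a \<Rightarrow> 'a) \<Rightarrow> ('a \<Rightarrow> 'b) \<Rightarrow> real" where
  "entropy_rate M T l = lim (\<lambda>n. ent M (block T l 0 n) / real n)"

text \<open>From \<open>ln y \<le> y - 1\<close> at \<open>y = 1 / sqrt x\<close>. The bound tends
  to 0 with \<open>x\<close> and thus controls cells of small mass.\<close>

lemma minus_xlnx_le_sqrt:
  fixes x :: real
  assumes "0 \<le> x"
  shows "- (x * ln x) \<le> 2 * sqrt x"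
proof (cases "x = 0")
  case False
  then have x: "0 < x" using assms by simp
  have "ln (1 / sqrt x) \<le> 1 / sqrt x - 1" using x by (intro ln_le_minus_one) simp
  then have "- ln x \<le> 2 / sqrt x" using x by (simp add: ln_div ln_sqrt)
  then have "x * - ln x \<le> x * (2 / sqrt x)" using x by (intro mult_left_mono) auto
  also have "x * (2 / sqrt x) = 2 * sqrt x" using x by (simp add: field_simps)
  finally show ?thesis by simp
qed simp

text \<open>The counterpart for cells of mass close to 1.\<close>

lemma minus_xlnx_le_diff:
  fixes x :: real
  assumes "0 < x"
  shows "- (x * ln x) \<le> 1 - x"
proof -
  have "ln (1 / x) \<le> 1 / x - 1" using assms by (intro ln_le_minus_one) simp
  then have "x * - ln x \<le> x * (1 / x - 1)" using assms by (intro mult_left_mono) (auto simp: ln_div)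
  then show ?thesis using assms by (simp add: algebra_simps)
qed

context prob_space begin

context
  fixes T :: "'a \<Rightarrow> 'a"
  assumes T: "T \<in> measurable M M" and inv: "distr M M T = M"
begin

lemma ent_block_shift:
  assumes l: "simple_function M l"
  shows "ent M (block T l j q) = ent M (block T l 0 q)"
proof (induction j)
  case (Suc j)
  have "ent M (block T l (Suc j) q) = ent M (\<lambda>x. block T l j q (T x))"
    by (rule ent_cong) (rule block_Suc_start)
  also have "\<dots> = ent (distr M M T) (block T l j q)"
    by (rule ent_distr[OF T simple_function_block[OF T l], symmetric])
  finally show ?case using Suc inv by simp
qed simp

lemma ent_block_le:
  assumes l: "simple_function M l"
  shows "ent M (block T l 0 n) \<le> real n * ent M l"
proof (induction n)
  case 0
  have "ent M (block T l 0 0) \<le> ln (card {[] :: 'b list})"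
    by (intro ent_le_card simple_function_block[OF T l]) (auto simp: block_def)
  then show ?case by simp
next
  case (Suc n)
  have "ent M (block T l n 1) = ent M (block T l 0 1)" by (rule ent_block_shift[OF l])
  also have "\<dots> \<le> ent M l" by (rule ent_mono[OF l]) (simp add: block_def)
  finally show ?case
    using ent_block_add[OF T l, of n 1] Suc by (simp add: algebra_simps)
qed

lemma
  assumes l: "simple_function M l"
  shows entropy_rate_tendsto: "(\<lambda>n. ent M (block T l 0 n) / real n) \<longlonglongrightarrow> entropy_rate M T l"
    and entropy_rate_le: "0 < q \<Longrightarrow> entropy_rate M T l \<le> ent M (block T l 0 q) / real q"
proof -
  have "real q * ent M (block T l 0 n) \<le> real n * ent M (block T l 0 q) + real q * ent M (block T l 0 q)" for n q
  proof -
    have "(\<Sum>j<n. ent M (block T l j q)) = (\<Sum>j<n. ent M (block T l 0 q))"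
      by (intro sum.cong refl ent_block_shift[OF l])
    then show ?thesis using ent_block_window[OF T l, of q n] by simp
  qed
  then obtain L where L: "(\<lambda>n. ent M (block T l 0 n) / real n) \<longlonglongrightarrow> L"
    "\<And>q. 0 < q \<Longrightarrow> L \<le> ent M (block T l 0 q) / real q"
    by (rule converges_of_window[OF ent_nonneg]) blast
  have "entropy_rate M T l = L" unfolding entropy_rate_def by (rule limI[OF L(1)])
  then show "(\<lambda>n. ent M (block T l 0 n) / real n) \<longlonglongrightarrow> entropy_rate M T l"
    "0 < q \<Longrightarrow> entropy_rate M T l \<le> ent M (block T l 0 q) / real q"
    using L by auto
qed

lemma entropy_wrt_fibres:
  assumes l: "simple_function M l"
  shows "entropy_wrt_partition M T (fibres M l) = entropy_rate M T l"
  unfolding entropy_wrt_partition_def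
proof (rule limI, rule Lim_transform_eventually[OF entropy_rate_tendsto[OF l]])
  have Tsp: "T \<in> space M \<rightarrow> space M" using measurable_space[OF T] by auto
  show "\<forall>\<^sub>F n in sequentially. ent M (block T l 0 n) / real n =
      partition_entropy M (dynamical_refinement M T (fibres M l) n) / real n"
    using eventually_gt_at_top[of "0::nat"]
    by eventually_elim (simp add: dynamical_refinement_fibres[OF Tsp] partition_entropy_fibres)
qed

lemma entropy_rate_le_KS_entropy:
  assumes l: "simple_function M l"
  shows "ereal (entropy_rate M T l) \<le> KS_entropy M T"
  unfolding KS_entropy_def entropy_wrt_fibres[OF l, symmetric]
  using simple_functionD(1)[OF l] fibres_subset_sets[OF l]
  by (intro SUP_upper) (simp add: finite_fibres partition_on_fibres)

text \<open>Labels with values in \<open>'a set\<close> suffice, because a partition can be labelled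
  by its own cells.\<close>

lemma KS_entropy_leI:
  assumes "\<And>l :: 'a \<Rightarrow> 'a set. simple_function M l \<Longrightarrow> ereal (entropy_rate M T l) \<le> c"
  shows "KS_entropy M T \<le> c"
  unfolding KS_entropy_def
proof (rule SUP_least)
  fix \<xi> assume "\<xi> \<in> {\<xi>. finite \<xi> \<and> \<xi> \<subseteq> sets M \<and> partition_on (space M) \<xi>}"
  then have \<xi>: "finite \<xi>" "\<xi> \<subseteq> sets M" "partition_on (space M) \<xi>" by auto
  define l where "l = (\<lambda>x. THE A. A \<in> \<xi> \<and> x \<in> A)"
  have l: "l x = A" if "A \<in> \<xi>" "x \<in> A" for x A
    using that \<xi>(3) unfolding l_def by (intro the_equality) (auto simp: partition_on_def disjoint_def)
  have lx: "l x \<in> \<xi> \<and> x \<in> l x" if "x \<in> space M" for x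
  proof -
    have "x \<in> \<Union>\<xi>" using that \<xi>(3) by (simp add: partition_on_def)
    then obtain A where "A \<in> \<xi>" "x \<in> A" by blast
    then show ?thesis using l by simp
  qed
  have "simple_function M l"
    unfolding simple_function_def
  proof
    have "l ` space M \<subseteq> \<xi>" using lx by blast
    then show "finite (l ` space M)" using \<xi>(1) by (rule finite_subset)
    show "\<forall>A\<in>l ` space M. l -` {A} \<inter> space M \<in> sets M"
    proof
      fix A assume "A \<in> l ` space M"
      then have A: "A \<in> \<xi>" using lx by blast
      then have "l -` {A} \<inter> space M = A"
        using l[OF A] lx sets.sets_into_space[of A M] \<xi>(2) by auto
      then show "l -` {A} \<inter> space M \<in> sets M" using A \<xi>(2) by auto
    qed
  qed
  then show "ereal (entropy_wrt_partition M T \<xi>) \<le> c"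
    using assms entropy_wrt_fibres partition_on_eq_fibres[OF \<xi>(3)] unfolding l_def by metis
qed

text \<open>The \<open>l\<close>-name of length \<open>n\<close> is recovered from the
  \<open>\<eta>\<close>-name and the \<open>E\<close>-name. The former is determined by the
  \<open>\<alpha>\<close>-name of length \<open>n + k\<close>, the latter costs at most
  \<open>ent M E\<close> per step, and the extra \<open>k\<close> letters disappear after division
  by \<open>n\<close>.\<close>

lemma entropy_rate_le_add:
  assumes l: "simple_function M l" and \<eta>: "simple_function M \<eta>" and E: "simple_function M E"
    and \<alpha>: "simple_function M \<alpha>"
    and lE: "\<And>x y. x \<in> space M \<Longrightarrow> y \<in> space M \<Longrightarrow> \<eta> x = \<eta> y \<Longrightarrow> E x = E y \<Longrightarrow> l x = l y"
    and \<eta>\<alpha>: "\<And>x y. x \<in> space M \<Longrightarrow> y \<in> space M \<Longrightarrow> block T \<alpha> 0 k x = block T \<alpha> 0 k y \<Longrightarrow> \<eta> x = \<eta> y"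
  shows "entropy_rate M T l \<le> entropy_rate M T \<alpha> + ent M E"
proof -
  note sb = simple_function_block[OF T]
  have Tk: "(T ^^ i) x \<in> space M" if "x \<in> space M" for i x
    using that measurable_space[OF T] by (induction i) auto
  have le: "ent M (block T l 0 n) \<le> ent M (block T \<alpha> 0 (n + k)) + real n * ent M E" for n
  proof -
    have "ent M (block T l 0 n) \<le> ent M (\<lambda>x. (block T \<eta> 0 n x, block T E 0 n x))"
      by (rule ent_mono) (auto simp: block_eq_iff Tk intro!: lE simple_function_Pair sb \<eta> E)
    also have "\<dots> \<le> ent M (block T \<eta> 0 n) + ent M (block T E 0 n)"
      by (intro ent_pair_le sb \<eta> E)
    also have "ent M (block T \<eta> 0 n) \<le> ent M (block T \<alpha> 0 (n + k))"
    proof (rule ent_mono[OF sb[OF \<alpha>]])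
      fix x y assume xy: "x \<in> space M" "y \<in> space M" "block T \<alpha> 0 (n + k) x = block T \<alpha> 0 (n + k) y"
      have "\<eta> ((T ^^ i) x) = \<eta> ((T ^^ i) y)" if "i < n" for i
      proof (rule \<eta>\<alpha>)
        have "(T ^^ j) ((T ^^ i) z) = (T ^^ (j + i)) z" for j z by (simp add: funpow_add)
        then show "block T \<alpha> 0 k ((T ^^ i) x) = block T \<alpha> 0 k ((T ^^ i) y)"
          using xy(3) that by (auto simp: block_eq_iff)
      qed (use xy Tk in auto)
      then show "block T \<eta> 0 n x = block T \<eta> 0 n y" by (simp add: block_eq_iff)
    qed
    finally show ?thesis using ent_block_le[OF E, of n] by linarith
  qed
  \<comment> \<open>Division by \<open>n\<close> is written as division by \<open>n + k\<close>
    times \<open>1 + k / n\<close>, so that the shifted sequence of quotients can be used.\<close>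
  have "(\<lambda>n. ent M (block T \<alpha> 0 (n + k)) / real (n + k) * (1 + real k / real n))
      \<longlonglongrightarrow> entropy_rate M T \<alpha> * (1 + 0)"
    by (intro tendsto_intros LIMSEQ_ignore_initial_segment entropy_rate_tendsto \<alpha>
        tendsto_divide_0[OF tendsto_const] filterlim_real_sequentially filterlim_at_infinity_imp_filterlim_at_top
        filterlim_at_top_imp_at_infinity)
  then have lim: "(\<lambda>n. ent M (block T \<alpha> 0 (n + k)) / real (n + k) * (1 + real k / real n) + ent M E)
      \<longlonglongrightarrow> entropy_rate M T \<alpha> + ent M E" by (intro tendsto_add) auto
  show ?thesis
  proof (rule LIMSEQ_le[OF entropy_rate_tendsto[OF l] lim], intro exI allI impI)
    fix n :: nat assume n: "1 \<le> n"
    then have "ent M (block T \<alpha> 0 (n + k)) / real (n + k) * (1 + real k / real n) = ent M (block T \<alpha> 0 (n + k)) / real n"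
    proof -
      have "1 + real k / real n = real (n + k) / real n" using n by (simp add: field_simps)
      then show ?thesis using n by (simp del: of_nat_add)
    qed
    moreover have "ent M (block T l 0 n) / real n \<le> (ent M (block T \<alpha> 0 (n + k)) + real n * ent M E) / real n"
      using le by (intro divide_right_mono) auto
    ultimately show "ent M (block T l 0 n) / real n \<le>
        ent M (block T \<alpha> 0 (n + k)) / real (n + k) * (1 + real k / real n) + ent M E"
      using n by (simp add: add_divide_distrib)
  qed
qed

end

text \<open>The label records \<open>None\<close> on agreement and the correct value otherwise. The
  cell of \<open>None\<close> has mass at least \<open>1 - d > 0\<close> and contributes at most
  \<open>d\<close>; each of the at most \<open>card S\<close> other cells has mass at most
  \<open>d\<close> and contributes at most \<open>2 * sqrt d\<close>.\<close>

lemma ent_error_le: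
  assumes l: "simple_function M l" and \<eta>: "simple_function M \<eta>" and S: "finite S" "l ` space M \<subseteq> S"
    and d: "measure M {x \<in> space M. l x \<noteq> \<eta> x} \<le> d" "d < 1"
  shows "ent M (\<lambda>x. if l x = \<eta> x then None else Some (l x)) \<le> d + real (card S) * (2 * sqrt d)"
proof -
  let ?E = "\<lambda>x. if l x = \<eta> x then None else Some (l x)"
  have meas: "{x \<in> space M. l x \<noteq> \<eta> x} \<in> sets M"
  proof -
    have "simple_function M (\<lambda>x. (l x = \<eta> x))" by (rule simple_function_compose2[OF l \<eta>])
    then have "(\<lambda>x. (l x = \<eta> x)) -` {False} \<inter> space M \<in> sets M" by (rule simple_functionD)
    moreover have "(\<lambda>x. (l x = \<eta> x)) -` {False} \<inter> space M = {x \<in> space M. l x \<noteq> \<eta> x}" by auto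
    ultimately show ?thesis by simp
  qed
  let ?p = "\<lambda>y. measure M (?E -` {y} \<inter> space M)"
  have "?E ` space M \<subseteq> insert None (Some ` S)" using S(2) by auto
  then have "ent M ?E = - (\<Sum>y\<in>insert None (Some ` S). ?p y * ln (?p y))"
    using S(1) by (intro ent_superset) auto
  also have "\<dots> = - (?p None * ln (?p None)) + (\<Sum>y\<in>Some ` S. - (?p y * ln (?p y)))"
    using S(1) by (subst sum.insert) (auto simp: sum_negf)
  also have "\<dots> \<le> d + (\<Sum>y\<in>Some ` S. 2 * sqrt d)"
  proof (rule add_mono)
    have "?E -` {None} \<inter> space M = space M - {x \<in> space M. l x \<noteq> \<eta> x}" by auto
    then have "?p None = 1 - measure M {x \<in> space M. l x \<noteq> \<eta> x}" using meas by (simp add: prob_compl)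
    then show "- (?p None * ln (?p None)) \<le> d"
      using minus_xlnx_le_diff[of "?p None"] d by linarith
    show "(\<Sum>y\<in>Some ` S. - (?p y * ln (?p y))) \<le> (\<Sum>y\<in>Some ` S. 2 * sqrt d)"
    proof (rule sum_mono)
      fix y assume "y \<in> Some ` S"
      then have "?E -` {y} \<inter> space M \<subseteq> {x \<in> space M. l x \<noteq> \<eta> x}" by auto
      then have "?p y \<le> d" by (rule order_trans[OF finite_measure_mono[OF _ meas] d(1)])
      then have "sqrt (?p y) \<le> sqrt d" by simp
      then show "- (?p y * ln (?p y)) \<le> 2 * sqrt d"
        using minus_xlnx_le_sqrt[of "?p y", OF measure_nonneg] by linarith
    qed
  qed
  also have "(\<Sum>y\<in>Some ` S. 2 * sqrt d) = real (card S) * (2 * sqrt d)"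
    by (simp add: card_image)
  finally show ?thesis by simp
qed

end

section \<open>Entropy of the shift from word frequencies\<close>

context string_graph begin

abbreviation "imeas \<equiv> invariant_measures (string_topology G) shift_map"

text \<open>The sum runs over all words, not only those charged by \<open>\<nu>\<close>. The index
  set is then the same for every measure, and continuity under convergence of cylinder frequencies
  can be read off term by term.\<close>

definition word_entropy :: "(nat \<Rightarrow> 'e) measure \<Rightarrow> nat \<Rightarrow> real" where
  "word_entropy \<nu> n = - (\<Sum>w\<in>words G n. measure \<nu> (cyl w) * ln (measure \<nu> (cyl w)))"

definition shift_entropy :: "(nat \<Rightarrow> 'e) measure \<Rightarrow> real" where
  "shift_entropy \<nu> = entropy_rate \<nu> shift_map (\<lambda>u. u 0)"

lemma shift_measurable:
  assumes "\<mu> \<in> pmeas" "\<nu> \<in> pmeas"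
  shows "shift_map \<in> measurable \<mu> \<nu>"
proof (rule measurable_sigma_sets[of _ "strings G" "cylinder_sets G"])
  show "sets \<nu> = sigma_sets (strings G) (cylinder_sets G)"
    using assms(2) by (simp add: prob_measures_sets sets_borel_string_topology)
  show "cylinder_sets G \<subseteq> Pow (strings G)" by (auto simp: cylinder_sets_def)
  show "shift_map \<in> space \<mu> \<rightarrow> strings G"
    using assms(1) by (auto simp: prob_measures_space shift_map_strings)
  show "shift_map -` D \<inter> space \<mu> \<in> sets \<mu>" if "D \<in> cylinder_sets G" for D
    using assms(1) cylinder_sets_in_borel[OF cylinder_sets_vimage_shift[OF that]]
    by (simp add: prob_measures_space prob_measures_sets)
qed

lemma invariantD:
  assumes "\<mu> \<in> imeas"
  shows "\<mu> \<in> pmeas" "shift_map \<in> measurable \<mu> \<mu>" "distr \<mu> \<mu> shift_map = \<mu>"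
  using assms by (auto simp: invariant_measures_def)

lemma invariantI:
  assumes \<mu>: "\<mu> \<in> pmeas"
    and eq: "\<And>D. D \<in> cylinder_sets G \<Longrightarrow> measure \<mu> (shift_map -` D \<inter> strings G) = measure \<mu> D"
  shows "\<mu> \<in> imeas"
proof -
  have T: "shift_map \<in> measurable \<mu> \<mu>" by (rule shift_measurable[OF \<mu> \<mu>])
  have "distr \<mu> \<mu> shift_map \<in> pmeas"
    using prob_space.prob_space_distr[OF prob_measures_prob_space[OF \<mu>] T]
    by (simp add: prob_measures_iff prob_measures_sets[OF \<mu>])
  then have "distr \<mu> \<mu> shift_map = \<mu>"
    by (rule prob_measure_eqI[OF _ \<mu>])
      (simp add: measure_distr[OF T] prob_measures_sets[OF \<mu>] cylinder_sets_in_borel prob_measures_space[OF \<mu>] eq)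
  with T \<mu> show ?thesis by (simp add: invariant_measures_def)
qed

lemma block_shift: "block shift_map (\<lambda>u. u 0) j n u = map u [j..<j + n]"
  by (simp add: block_def shift_map_funpow)

lemma simple_function_prefix:
  assumes "\<nu> \<in> pmeas"
  shows "simple_function \<nu> (\<lambda>u. map u [0..<n])"
  unfolding simple_function_def
proof
  have sub: "(\<lambda>u. map u [0..<n]) ` space \<nu> \<subseteq> words G n"
    by (auto simp: prob_measures_space[OF assms] prefix_in_words)
  then show "finite ((\<lambda>u. map u [0..<n]) ` space \<nu>)" by (rule finite_subset) simp
  show "\<forall>w\<in>(\<lambda>u. map u [0..<n]) ` space \<nu>. (\<lambda>u. map u [0..<n]) -` {w} \<inter> space \<nu> \<in> sets \<nu>"
  proof
    fix w assume "w \<in> (\<lambda>u. map u [0..<n]) ` space \<nu>"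
    then have "w \<in> words G n" using sub by blast
    then have "(\<lambda>u. map u [0..<n]) -` {w} \<inter> space \<nu> = cyl w"
      by (auto simp: prob_measures_space[OF assms] mem_cylinder_words)
    then show "(\<lambda>u. map u [0..<n]) -` {w} \<inter> space \<nu> \<in> sets \<nu>"
      by (simp add: prob_measures_sets[OF assms] cylinder_in_borel)
  qed
qed

lemma simple_function_letter:
  assumes "\<nu> \<in> pmeas"
  shows "simple_function \<nu> (\<lambda>u. u 0)"
  using simple_function_compose1[OF simple_function_prefix[OF assms, of 1], of hd] by simp

lemma word_entropy_eq:
  assumes "\<nu> \<in> pmeas"
  shows "word_entropy \<nu> n = ent \<nu> (\<lambda>u. map u [0..<n])"
    and "word_entropy \<nu> n = ent \<nu> (block shift_map (\<lambda>u. u 0) 0 n)"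
proof -
  have "ent \<nu> (\<lambda>u. map u [0..<n]) = - (\<Sum>y\<in>words G n.
      measure \<nu> ((\<lambda>u. map u [0..<n]) -` {y} \<inter> space \<nu>) * ln (measure \<nu> ((\<lambda>u. map u [0..<n]) -` {y} \<inter> space \<nu>)))"
    by (intro ent_superset) (auto simp: prob_measures_space[OF assms] prefix_in_words)
  also have "\<dots> = word_entropy \<nu> n"
  proof -
    have "(\<lambda>u. map u [0..<n]) -` {y} \<inter> space \<nu> = cyl y" if "y \<in> words G n" for y
      using that by (auto simp: prob_measures_space[OF assms] mem_cylinder_words)
    then show ?thesis unfolding word_entropy_def by simp
  qed
  finally show *: "word_entropy \<nu> n = ent \<nu> (\<lambda>u. map u [0..<n])" by simp
  show "word_entropy \<nu> n = ent \<nu> (block shift_map (\<lambda>u. u 0) 0 n)"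
    unfolding * by (rule ent_cong) (simp add: block_shift)
qed

lemma shift_entropy_tendsto:
  assumes "\<mu> \<in> imeas"
  shows "(\<lambda>n. word_entropy \<mu> n / real n) \<longlonglongrightarrow> shift_entropy \<mu>"
  unfolding shift_entropy_def word_entropy_eq(2)[OF invariantD(1)[OF assms]]
  by (rule prob_space.entropy_rate_tendsto[OF prob_measures_prob_space invariantD(2,3)])
    (use invariantD[OF assms] assms simple_function_letter in auto)

lemma shift_entropy_nonneg:
  assumes "\<mu> \<in> imeas"
  shows "0 \<le> shift_entropy \<mu>"
proof (rule LIMSEQ_le_const[OF shift_entropy_tendsto[OF assms]], intro exI allI impI)
  fix n show "0 \<le> word_entropy \<mu> n / real n"
    unfolding word_entropy_eq(1)[OF invariantD(1)[OF assms]]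
    by (rule divide_nonneg_nonneg[OF prob_space.ent_nonneg[OF prob_measures_prob_space[OF invariantD(1)[OF assms]]]]) simp
qed

text \<open>Induction over the generated sigma-algebra. The statement is proved for all tolerances
  at once, since a countable union needs a smaller tolerance for each of its members.\<close>

lemma cylinder_set_approx:
  assumes \<mu>: "\<mu> \<in> pmeas" and A: "A \<in> sets \<mu>" and d: "0 < d"
  shows "\<exists>D\<in>cylinder_sets G. measure \<mu> ((A - D) \<union> (D - A)) < d"
proof -
  interpret prob_space \<mu> using \<mu> by (rule prob_measures_prob_space)
  interpret alg: algebra "strings G" "cylinder_sets G" by (rule algebra_cylinder_sets)
  have sets_\<mu>: "sets \<mu> = sigma_sets (strings G) (cylinder_sets G)"
    using \<mu> by (simp add: prob_measures_sets sets_borel_string_topology)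
  have cs: "D \<in> sets \<mu>" if "D \<in> cylinder_sets G" for D
    using that by (simp add: sets_\<mu>)
  have sp: "space \<mu> = strings G" by (simp add: prob_measures_space[OF \<mu>])
  have "A \<in> sigma_sets (strings G) (cylinder_sets G)" using A by (simp add: sets_\<mu>)
  then have "\<forall>d>0. \<exists>D\<in>cylinder_sets G. measure \<mu> ((A - D) \<union> (D - A)) < d"
  proof induction
    case (Basic A)
    then show ?case by (intro allI impI bexI[of _ A]) auto
  next
    case Empty
    then show ?case by (intro allI impI bexI[of _ "{}"]) auto
  next
    case (Compl A)
    show ?case
    proof (intro allI impI)
      fix d :: real assume "0 < d"
      then obtain D where D: "D \<in> cylinder_sets G" "measure \<mu> ((A - D) \<union> (D - A)) < d" using Compl by blast
      have "D \<subseteq> strings G" using D(1) by (auto simp: cylinder_sets_def)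
      moreover have "A \<subseteq> strings G" using Compl(1) sigma_sets_into_sp[OF alg.space_closed] by blast
      ultimately have "(strings G - A - (strings G - D)) \<union> (strings G - D - (strings G - A)) = (A - D) \<union> (D - A)" by auto
      then show "\<exists>D\<in>cylinder_sets G. measure \<mu> ((strings G - A - D) \<union> (D - (strings G - A))) < d"
        using D cylinder_sets_Diff by metis
    qed
  next
    case (Union A)
    have AS: "A i \<in> sets \<mu>" for i using Union(1) by (simp add: sets_\<mu>)
    show ?case
    proof (intro allI impI)
      fix d :: real assume d: "0 < d"
      \<comment> \<open>Partial unions: continuity from below lets a finite \<open>n\<close> capture
        all but \<open>d / 2\<close> of the union.\<close>
      define F where "F = (\<lambda>n. \<Union>i<n. A i)"
      have FS: "F n \<in> sets \<mu>" for n unfolding F_def using AS by auto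
      have "(\<lambda>n. measure \<mu> (F n)) \<longlonglongrightarrow> measure \<mu> (\<Union>n. F n)"
      proof (rule finite_Lim_measure_incseq)
        show "incseq F" unfolding incseq_def F_def by (intro allI impI UN_mono) auto
      qed (use FS in auto)
      moreover have UF: "(\<Union>n. F n) = (\<Union>i. A i)" by (auto simp: F_def)
      ultimately have "\<forall>\<^sub>F n in sequentially. measure \<mu> (\<Union>i. A i) - d / 2 < measure \<mu> (F n)"
        using d by (intro order_tendstoD) auto
      then obtain n where n: "measure \<mu> (\<Union>i. A i) - d / 2 < measure \<mu> (F n)"
        by (auto simp: eventually_sequentially)
      \<comment> \<open>The errors of \<open>n\<close> sets then add up to at most
        \<open>d / 2\<close>; the added 1 covers \<open>n = 0\<close>.\<close>
      define e where "e = d / (2 * (real n + 1))"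
      have e: "0 < e" using d by (simp add: e_def)
      have "\<forall>i. \<exists>D\<in>cylinder_sets G. measure \<mu> ((A i - D) \<union> (D - A i)) < e"
        using Union.IH e by blast
      then obtain D where D: "\<And>i. D i \<in> cylinder_sets G" "\<And>i. measure \<mu> ((A i - D i) \<union> (D i - A i)) < e"
        by metis
      define U where "U = (\<Union>i<n. D i)"
      have U: "U \<in> cylinder_sets G" unfolding U_def using D(1) by (intro cylinder_sets_UN) auto
      let ?R = "(\<Union>i. A i) - F n" and ?S = "\<Union>i<n. (A i - D i) \<union> (D i - A i)"
      have "((\<Union>i. A i) - U) \<union> (U - (\<Union>i. A i)) \<subseteq> ?R \<union> ?S" by (auto simp: F_def U_def)
      then have "measure \<mu> (((\<Union>i. A i) - U) \<union> (U - (\<Union>i. A i))) \<le> measure \<mu> (?R \<union> ?S)"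
        using AS FS D(1) cs by (intro finite_measure_mono) (auto intro!: sets.countable_UN sets.finite_UN)
      also have "\<dots> \<le> measure \<mu> ?R + measure \<mu> ?S"
        using AS FS D(1) cs by (intro measure_Un_le) (auto intro!: sets.countable_UN sets.finite_UN)
      also have "measure \<mu> ?R = measure \<mu> (\<Union>i. A i) - measure \<mu> (F n)"
        using AS FS by (intro finite_measure_Diff) (auto simp: F_def)
      also have "measure \<mu> ?S \<le> (\<Sum>i<n. measure \<mu> ((A i - D i) \<union> (D i - A i)))"
        using AS D(1) cs by (intro finite_measure_subadditive_finite) auto
      also have "\<dots> \<le> (\<Sum>i<n. e)" using D(2) by (intro sum_mono less_imp_le)
      also have "\<dots> \<le> d / 2" using d by (simp add: e_def field_simps)
      finally have "measure \<mu> (((\<Union>i. A i) - U) \<union> (U - (\<Union>i. A i))) < d" using n by linarith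
      with U show "\<exists>D\<in>cylinder_sets G. measure \<mu> (((\<Union>i. A i) - D) \<union> (D - (\<Union>i. A i))) < d" by blast
    qed
  qed
  with d show ?thesis by blast
qed

text \<open>Each level set of \<open>l\<close> is replaced by a cylinder set up to a small symmetric
  difference; outside these differences the cylinder sets still identify the value of
  \<open>l\<close>.\<close>

lemma simple_function_approx:
  assumes \<mu>: "\<mu> \<in> pmeas" and l: "simple_function \<mu> l" and d: "0 < d"
  obtains \<eta> k where "simple_function \<mu> \<eta>" "measure \<mu> {u \<in> space \<mu>. l u \<noteq> \<eta> u} \<le> d"
    "\<And>u v. u \<in> strings G \<Longrightarrow> v \<in> strings G \<Longrightarrow> map u [0..<k] = map v [0..<k] \<Longrightarrow> \<eta> u = \<eta> v"
proof -
  interpret prob_space \<mu> using \<mu> by (rule prob_measures_prob_space)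
  have sp: "space \<mu> = strings G" by (simp add: prob_measures_space[OF \<mu>])
  let ?S = "l ` space \<mu>"
  have S: "finite ?S" using l by (rule simple_functionD)
  define A where "A = (\<lambda>y. l -` {y} \<inter> space \<mu>)"
  have A: "A y \<in> sets \<mu>" for y unfolding A_def using l by (rule simple_functionD)
  define e where "e = d / (real (card ?S) + 1)"
  have e: "0 < e" using d by (simp add: e_def)
  obtain D where D: "\<And>y. D y \<in> cylinder_sets G" "\<And>y. measure \<mu> ((A y - D y) \<union> (D y - A y)) < e"
    using cylinder_set_approx[OF \<mu> A e] by metis
  have Dm: "D y \<in> sets \<mu>" for y using cylinder_sets_in_borel[OF D(1)] by (simp add: prob_measures_sets[OF \<mu>])
  have "\<forall>y. \<exists>k. \<forall>u\<in>strings G. \<forall>v\<in>strings G. (\<forall>i<k. u i = v i) \<longrightarrow> u \<in> D y \<longrightarrow> v \<in> D y"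
    using D(1) unfolding cylinder_sets_def by blast
  then obtain k where k: "\<And>y u v. u \<in> strings G \<Longrightarrow> v \<in> strings G \<Longrightarrow> (\<forall>i<k y. u i = v i) \<Longrightarrow> u \<in> D y \<Longrightarrow> v \<in> D y"
    by metis
  obtain K where K: "\<And>y. y \<in> ?S \<Longrightarrow> k y \<le> K"
    using finite_nat_set_iff_bounded_le[of "k ` ?S"] S by auto
  \<comment> \<open>The sets \<open>D y\<close> may overlap or leave points uncovered. There the
    choice is arbitrary, but this can happen only inside the symmetric differences.\<close>
  define \<eta> where "\<eta> = (\<lambda>u. SOME y. y \<in> ?S \<and> u \<in> D y)"
  have det: "\<eta> u = \<eta> v" if "u \<in> strings G" "v \<in> strings G" "map u [0..<K] = map v [0..<K]" for u v
  proof -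
    have "u \<in> D y \<longleftrightarrow> v \<in> D y" if y: "y \<in> ?S" for y
    proof -
      have "\<forall>i<k y. u i = v i" "\<forall>i<k y. v i = u i" using \<open>map u [0..<K] = map v [0..<K]\<close> K[OF y] by auto
      then show ?thesis using k \<open>u \<in> strings G\<close> \<open>v \<in> strings G\<close> by blast
    qed
    \<comment> \<open>The two predicates are equal as functions, so \<open>SOME\<close> returns the
      same value for both strings.\<close>
    then have "(\<lambda>y. y \<in> ?S \<and> u \<in> D y) = (\<lambda>y. y \<in> ?S \<and> v \<in> D y)" by (intro ext) blast
    then show ?thesis unfolding \<eta>_def by (rule arg_cong)
  qed
  \<comment> \<open>Being determined by a prefix, \<open>\<eta>\<close> is the simple prefix map
    followed by a function of words.\<close>
  have "simple_function \<mu> \<eta>"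
  proof (subst simple_function_cong)
    show "\<eta> u = \<eta> (ext (map u [0..<K]))" if u: "u \<in> space \<mu>" for u
    proof (rule det)
      have w: "map u [0..<K] \<in> words G K" using u by (simp add: sp prefix_in_words)
      show "ext (map u [0..<K]) \<in> strings G" by (rule ext_strings[OF w])
      show "map u [0..<K] = map (ext (map u [0..<K])) [0..<K]"
        using ext_in[OF w] w by (simp add: mem_cylinder_words)
    qed (use u sp in simp)
    show "simple_function \<mu> (\<lambda>u. \<eta> (ext (map u [0..<K])))"
      by (rule simple_function_compose1[OF simple_function_prefix[OF \<mu>], of "\<lambda>w. \<eta> (ext w)"])
  qed
  moreover have "measure \<mu> {u \<in> space \<mu>. l u \<noteq> \<eta> u} \<le> d"
  proof -
    have sub: "{u \<in> space \<mu>. l u \<noteq> \<eta> u} \<subseteq> (\<Union>y\<in>?S. (A y - D y) \<union> (D y - A y))"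
    proof
      fix u assume u: "u \<in> {u \<in> space \<mu>. l u \<noteq> \<eta> u}"
      show "u \<in> (\<Union>y\<in>?S. (A y - D y) \<union> (D y - A y))"
      proof (rule ccontr)
        assume n: "u \<notin> (\<Union>y\<in>?S. (A y - D y) \<union> (D y - A y))"
        have "u \<in> D y \<longleftrightarrow> l u = y" if "y \<in> ?S" for y
          using n that u by (auto simp: A_def)
        then have "\<eta> u = l u" unfolding \<eta>_def using u by (intro some_equality) auto
        then show False using u by simp
      qed
    qed
    have "measure \<mu> {u \<in> space \<mu>. l u \<noteq> \<eta> u} \<le> measure \<mu> (\<Union>y\<in>?S. (A y - D y) \<union> (D y - A y))"
      using A Dm S sub by (intro finite_measure_mono sets.finite_UN) auto
    also have "\<dots> \<le> (\<Sum>y\<in>?S. measure \<mu> ((A y - D y) \<union> (D y - A y)))"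
      using A Dm S by (intro finite_measure_subadditive_finite) auto
    also have "\<dots> \<le> (\<Sum>y\<in>?S. e)" using D(2) by (intro sum_mono less_imp_le)
    also have "\<dots> = real (card ?S) * e" by simp
    also have "\<dots> \<le> d" using d by (simp add: e_def field_simps)
    finally show ?thesis .
  qed
  ultimately show ?thesis using det by (rule that)
qed

text \<open>The Kolmogorov--Sinai generator theorem for the partition by the first letter: a general
  label \<open>l\<close> agrees with a label \<open>\<eta>\<close> read off finitely many letters outside a set of small measure, and the
  error \<open>E\<close> costs at most its small entropy per time step, since \<open>l\<close> is a function of \<open>\<eta>\<close> and \<open>E\<close>.\<close>

lemma KS_entropy_eq:
  assumes \<mu>: "\<mu> \<in> imeas"
  shows "KS_entropy \<mu> shift_map = ereal (shift_entropy \<mu>)"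
proof (rule antisym)
  note inv = invariantD[OF \<mu>]
  interpret prob_space \<mu> using inv(1) by (rule prob_measures_prob_space)
  note letter = simple_function_letter[OF inv(1)]
  show "ereal (shift_entropy \<mu>) \<le> KS_entropy \<mu> shift_map"
    unfolding shift_entropy_def by (rule entropy_rate_le_KS_entropy[OF inv(2,3) letter])
  show "KS_entropy \<mu> shift_map \<le> ereal (shift_entropy \<mu>)"
  proof (rule KS_entropy_leI[OF inv(2,3)])
    fix l :: "(nat \<Rightarrow> 'e) \<Rightarrow> (nat \<Rightarrow> 'e) set" assume l: "simple_function \<mu> l"
    let ?S = "l ` space \<mu>"
    have S: "finite ?S" using l by (rule simple_functionD)
    have le: "entropy_rate \<mu> shift_map l \<le> shift_entropy \<mu> + (d + real (card ?S) * (2 * sqrt d))"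
      if d: "0 < d" "d < 1" for d
    proof -
      obtain \<eta> k where \<eta>: "simple_function \<mu> \<eta>" "measure \<mu> {u \<in> space \<mu>. l u \<noteq> \<eta> u} \<le> d"
        "\<And>u v. u \<in> strings G \<Longrightarrow> v \<in> strings G \<Longrightarrow> map u [0..<k] = map v [0..<k] \<Longrightarrow> \<eta> u = \<eta> v"
        using simple_function_approx[OF inv(1) l d(1)] by blast
      let ?E = "\<lambda>x. if l x = \<eta> x then None else Some (l x)"
      have E: "simple_function \<mu> ?E"
        by (rule simple_function_compose2[OF l \<eta>(1), of "\<lambda>a b. if a = b then None else Some a"])
      have "entropy_rate \<mu> shift_map l \<le> shift_entropy \<mu> + ent \<mu> ?E"
        unfolding shift_entropy_def
      proof (rule entropy_rate_le_add[OF inv(2,3) l \<eta>(1) E letter])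
        show "l x = l y" if "\<eta> x = \<eta> y" "?E x = ?E y" for x y
          using that by (auto split: if_splits)
        show "\<eta> x = \<eta> y" if "x \<in> space \<mu>" "y \<in> space \<mu>"
          "block shift_map (\<lambda>u. u 0) 0 k x = block shift_map (\<lambda>u. u 0) 0 k y" for x y
          using \<eta>(3)[of x y] that by (simp add: block_shift prob_measures_space[OF inv(1)])
      qed
      also have "ent \<mu> ?E \<le> d + real (card ?S) * (2 * sqrt d)"
        by (rule ent_error_le[OF l \<eta>(1) S _ \<eta>(2) d(2)]) simp
      finally show ?thesis by simp
    qed
    have "((\<lambda>d. shift_entropy \<mu> + (d + real (card ?S) * (2 * sqrt d))) \<longlongrightarrow>
        shift_entropy \<mu> + (0 + real (card ?S) * (2 * sqrt 0))) (at_right 0)"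
      by (intro tendsto_intros)
    then have "((\<lambda>d. shift_entropy \<mu> + (d + real (card ?S) * (2 * sqrt d))) \<longlongrightarrow> shift_entropy \<mu>) (at_right 0)" by simp
    moreover have "\<forall>\<^sub>F d in at_right 0. entropy_rate \<mu> shift_map l \<le> shift_entropy \<mu> + (d + real (card ?S) * (2 * sqrt d))"
      using eventually_at_right_less[of "0::real"] eventually_at_right_real[OF zero_less_one]
      by eventually_elim (auto intro: le)
    ultimately have "entropy_rate \<mu> shift_map l \<le> shift_entropy \<mu>"
      by (intro tendsto_lowerbound[of _ _ "at_right (0::real)"]) auto
    then show "ereal (entropy_rate \<mu> shift_map l) \<le> ereal (shift_entropy \<mu>)" by simp
  qed
qed

lemma mixture_invariant:
  assumes \<nu>: "\<And>i. i \<in> I \<Longrightarrow> \<nu> i \<in> imeas" and p: "\<And>i. i \<in> I \<Longrightarrow> 0 \<le> p i" "(\<Sum>i\<in>I. p i) = 1"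
  shows "mixture (borel_algebra (string_topology G)) I p \<nu> \<in> imeas"
proof (rule invariantI)
  have P: "\<nu> i \<in> pmeas" if "i \<in> I" for i using \<nu>[OF that] by (rule invariantD)
  then show "mixture (borel_algebra (string_topology G)) I p \<nu> \<in> pmeas"
    using p by (intro mixture_in_prob_measures)
  fix D assume D: "D \<in> cylinder_sets G"
  have "measure (\<nu> i) (shift_map -` D \<inter> strings G) = measure (\<nu> i) D" if i: "i \<in> I" for i
  proof -
    note inv = invariantD[OF \<nu>[OF i]]
    have "measure (distr (\<nu> i) (\<nu> i) shift_map) D = measure (\<nu> i) (shift_map -` D \<inter> strings G)"
      using measure_distr[OF inv(2), of D]
      by (simp add: prob_measures_sets[OF inv(1)] cylinder_sets_in_borel[OF D] prob_measures_space[OF inv(1)])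
    then show ?thesis using inv(3) by simp
  qed
  then show "measure (mixture (borel_algebra (string_topology G)) I p \<nu>) (shift_map -` D \<inter> strings G)
    = measure (mixture (borel_algebra (string_topology G)) I p \<nu>) D"
    using P p D by (simp add: measure_mixture_prob_measures cylinder_sets_in_borel cylinder_sets_vimage_shift)
qed

lemma word_entropy_mixture:
  assumes \<nu>: "\<And>i. i \<in> I \<Longrightarrow> \<nu> i \<in> pmeas" and p: "\<And>i. i \<in> I \<Longrightarrow> 0 \<le> p i" "(\<Sum>i\<in>I. p i) = 1"
  shows "(\<Sum>i\<in>I. p i * word_entropy (\<nu> i) n) \<le> word_entropy (mixture (borel_algebra (string_topology G)) I p \<nu>) n"
proof -
  let ?B = "borel_algebra (string_topology G)"
  have m: "mixture ?B I p \<nu> \<in> pmeas" using assms by (intro mixture_in_prob_measures)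
  have "simple_function ?B (\<lambda>u. map u [0..<n])"
    using simple_function_prefix[OF m, of n] by (simp add: simple_function_def)
  then have "(\<Sum>i\<in>I. p i * ent (\<nu> i) (\<lambda>u. map u [0..<n])) \<le> ent (mixture ?B I p \<nu>) (\<lambda>u. map u [0..<n])"
    using assms by (intro ent_mixture) (auto simp: prob_measures_iff)
  then show ?thesis using word_entropy_eq(1)[OF \<nu>] word_entropy_eq(1)[OF m] by simp
qed

lemma shift_entropy_mixture:
  assumes \<nu>: "\<And>i. i \<in> I \<Longrightarrow> \<nu> i \<in> imeas" and p: "\<And>i. i \<in> I \<Longrightarrow> 0 \<le> p i" "(\<Sum>i\<in>I. p i) = 1"
  shows "(\<Sum>i\<in>I. p i * shift_entropy (\<nu> i)) \<le> shift_entropy (mixture (borel_algebra (string_topology G)) I p \<nu>)"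
proof (rule LIMSEQ_le)
  show "(\<lambda>n. \<Sum>i\<in>I. p i * (word_entropy (\<nu> i) n / real n)) \<longlonglongrightarrow> (\<Sum>i\<in>I. p i * shift_entropy (\<nu> i))"
    using \<nu> by (intro tendsto_intros shift_entropy_tendsto)
  show "(\<lambda>n. word_entropy (mixture (borel_algebra (string_topology G)) I p \<nu>) n / real n)
      \<longlonglongrightarrow> shift_entropy (mixture (borel_algebra (string_topology G)) I p \<nu>)"
    using assms by (intro shift_entropy_tendsto mixture_invariant)
  show "\<exists>N. \<forall>n\<ge>N. (\<Sum>i\<in>I. p i * (word_entropy (\<nu> i) n / real n))
      \<le> word_entropy (mixture (borel_algebra (string_topology G)) I p \<nu>) n / real n"
  proof (intro exI allI impI)
    fix n :: nat
    have "(\<Sum>i\<in>I. p i * word_entropy (\<nu> i) n) / real n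
        \<le> word_entropy (mixture (borel_algebra (string_topology G)) I p \<nu>) n / real n"
      using assms by (intro divide_right_mono word_entropy_mixture invariantD) auto
    then show "(\<Sum>i\<in>I. p i * (word_entropy (\<nu> i) n / real n))
        \<le> word_entropy (mixture (borel_algebra (string_topology G)) I p \<nu>) n / real n"
      by (simp add: sum_divide_distrib)
  qed
qed

end

section \<open>Counting typical words\<close>

lemma sum_lists_Suc:
  fixes F :: "'a list \<Rightarrow> real"
  shows "(\<Sum>ws\<in>{ws. set ws \<subseteq> W \<and> length ws = Suc N}. F ws) =
    (\<Sum>w\<in>W. \<Sum>ws\<in>{ws. set ws \<subseteq> W \<and> length ws = N}. F (w # ws))"
proof -
  have inj: "inj_on (\<lambda>(w, ws). w # ws) (W \<times> {ws. set ws \<subseteq> W \<and> length ws = N})"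
    by (auto simp: inj_on_def)
  have "{ws. set ws \<subseteq> W \<and> length ws = Suc N} = (\<lambda>(w, ws). w # ws) ` (W \<times> {ws. set ws \<subseteq> W \<and> length ws = N})"
    by (auto simp: length_Suc_conv image_iff)
  then show ?thesis
    by (simp only: sum.reindex[OF inj] sum.cartesian_product) (simp add: case_prod_unfold)
qed

context
  fixes W :: "'a set" and p :: "'a \<Rightarrow> real"
  assumes fin: "finite W" and p: "\<And>w. w \<in> W \<Longrightarrow> 0 < p w" "(\<Sum>w\<in>W. p w) = 1"
begin

text \<open>\<open>prod_list (map p ws)\<close> is the probability of \<open>ws\<close> under
  independent draws with law \<open>p\<close>. Finite sums over lists thus stand in for a product
  measure.\<close>

lemma sum_weights_lists: "(\<Sum>ws\<in>{ws. set ws \<subseteq> W \<and> length ws = N}. prod_list (map p ws)) = 1"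
proof (induction N)
  case 0
  have "{ws. set ws \<subseteq> W \<and> length ws = 0} = {[]}" by auto
  then show ?case by simp
next
  case (Suc N)
  then show ?case unfolding sum_lists_Suc by (simp add: p flip: sum_distrib_left)
qed

text \<open>Induction on the number of draws, splitting off the first one. After expanding the
  square, the cross term carries the mean of the remaining draws, which is zero, so variances
  add.\<close>

lemma
  assumes g: "(\<Sum>w\<in>W. p w * g w) = 0"
  shows mean_lists: "(\<Sum>ws\<in>{ws. set ws \<subseteq> W \<and> length ws = N}. prod_list (map p ws) * sum_list (map g ws)) = 0"
    and variance_lists: "(\<Sum>ws\<in>{ws. set ws \<subseteq> W \<and> length ws = N}. prod_list (map p ws) * (sum_list (map g ws))\<^sup>2)
      = real N * (\<Sum>w\<in>W. p w * (g w)\<^sup>2)"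
proof -
  let ?L = "\<lambda>N. {ws. set ws \<subseteq> W \<and> length ws = N}"
  have L0: "?L 0 = {[]}" by auto
  show mean: "(\<Sum>ws\<in>?L N. prod_list (map p ws) * sum_list (map g ws)) = 0" for N
  proof (induction N)
    case (Suc N)
    have "(\<Sum>ws\<in>?L (Suc N). prod_list (map p ws) * sum_list (map g ws)) =
      (\<Sum>w\<in>W. p w * g w * (\<Sum>ws\<in>?L N. prod_list (map p ws)) +
         p w * (\<Sum>ws\<in>?L N. prod_list (map p ws) * sum_list (map g ws)))"
      unfolding sum_lists_Suc
      by (intro sum.cong refl) (simp add: sum_distrib_left sum.distrib[symmetric] algebra_simps)
    also have "\<dots> = 0" by (simp add: Suc sum_weights_lists g)
    finally show ?case .
  qed (simp add: L0)
  show "(\<Sum>ws\<in>?L N. prod_list (map p ws) * (sum_list (map g ws))\<^sup>2) = real N * (\<Sum>w\<in>W. p w * (g w)\<^sup>2)"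
  proof (induction N)
    case (Suc N)
    let ?S = "\<Sum>ws\<in>?L N. prod_list (map p ws) * (sum_list (map g ws))\<^sup>2"
    have "(\<Sum>ws\<in>?L (Suc N). prod_list (map p ws) * (sum_list (map g ws))\<^sup>2) =
      (\<Sum>w\<in>W. p w * (g w)\<^sup>2 * (\<Sum>ws\<in>?L N. prod_list (map p ws)) +
         2 * p w * g w * (\<Sum>ws\<in>?L N. prod_list (map p ws) * sum_list (map g ws)) + p w * ?S)"
      unfolding sum_lists_Suc
      by (intro sum.cong refl) (simp add: sum_distrib_left sum.distrib[symmetric] algebra_simps power2_sum)
    also have "\<dots> = (\<Sum>w\<in>W. p w * (g w)\<^sup>2) + (\<Sum>w\<in>W. p w) * ?S"
      by (simp add: mean sum_weights_lists sum.distrib sum_distrib_right)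
    finally show ?case by (simp add: Suc p algebra_simps)
  qed (simp add: L0)
qed

text \<open>Chebyshev's inequality for all statistics in \<open>J\<close> simultaneously. The
  tolerance \<open>real N\<close>, one unit per draw, is generous; it is enough because the draws
  will be words of large length \<open>m\<close>, over which the unit is spread.\<close>

lemma typical_lists:
  fixes g :: "'i \<Rightarrow> 'a \<Rightarrow> real"
  assumes J: "finite J"
  obtains N\<^sub>0 where "\<And>N. N\<^sub>0 \<le> N \<Longrightarrow> 1 / 2 \<le> (\<Sum>ws\<in>{ws. set ws \<subseteq> W \<and> length ws = N \<and>
      (\<forall>i\<in>J. \<bar>sum_list (map (g i) ws) - real N * (\<Sum>w\<in>W. p w * g i w)\<bar> \<le> real N)}. prod_list (map p ws))"
proof -
  let ?L = "\<lambda>N. {ws. set ws \<subseteq> W \<and> length ws = N}"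
  define h where "h = (\<lambda>i w. g i w - (\<Sum>w\<in>W. p w * g i w))"
  have h0: "(\<Sum>w\<in>W. p w * h i w) = 0" for i
    unfolding h_def by (simp add: right_diff_distrib sum_subtractf p flip: sum_distrib_right)
  have hsum: "sum_list (map (h i) ws) = sum_list (map (g i) ws) - real (length ws) * (\<Sum>w\<in>W. p w * g i w)" for i ws
    by (induction ws) (auto simp: h_def algebra_simps)
  define V where "V = (\<Sum>i\<in>J. \<Sum>w\<in>W. p w * (h i w)\<^sup>2)"
  have V: "0 \<le> V" unfolding V_def using p by (intro sum_nonneg mult_nonneg_nonneg) (auto intro: less_imp_le)
  obtain N\<^sub>0 :: nat where N0: "2 * V < real N\<^sub>0" using reals_Archimedean2 by blast
  show ?thesis
  proof (rule that[of "N\<^sub>0"])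
    fix N assume "N\<^sub>0 \<le> N"
    then have N: "2 * V < real N" "0 < real N" using N0 V by linarith+
    have finL: "finite (?L N)" using fin by (rule finite_lists_length_eq)
    define T where "T = {ws. set ws \<subseteq> W \<and> length ws = N \<and>
      (\<forall>i\<in>J. \<bar>sum_list (map (g i) ws) - real N * (\<Sum>w\<in>W. p w * g i w)\<bar> \<le> real N)}"
    have TL: "T \<subseteq> ?L N" by (auto simp: T_def)
    have pn: "0 \<le> prod_list (map p ws)" if "set ws \<subseteq> W" for ws
      using that by (induction ws) (auto simp: p(1)[THEN less_imp_le] intro!: mult_nonneg_nonneg)
    have "(\<Sum>ws\<in>?L N - T. prod_list (map p ws)) \<le>
      (\<Sum>ws\<in>?L N - T. \<Sum>i\<in>J. prod_list (map p ws) * (sum_list (map (h i) ws))\<^sup>2 / (real N)\<^sup>2)"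
    proof (rule sum_mono)
      fix ws assume ws: "ws \<in> ?L N - T"
      \<comment> \<open>Outside \<open>T\<close> some centred sum exceeds \<open>N\<close>, so its
        square over \<open>N * N\<close> is at least 1. Summing over \<open>i\<close> is the union
        bound and leaves a total probability of at most \<open>V / N\<close>.\<close>
      then obtain i where i: "i \<in> J" "real N < \<bar>sum_list (map (h i) ws)\<bar>"
        by (auto simp: T_def hsum not_le)
      have "(real N)\<^sup>2 \<le> \<bar>sum_list (map (h i) ws)\<bar>\<^sup>2" using i(2) by (intro power_mono) auto
      then have "1 \<le> (sum_list (map (h i) ws))\<^sup>2 / (real N)\<^sup>2" using N by simp
      then have "prod_list (map p ws) * 1 \<le> prod_list (map p ws) * ((sum_list (map (h i) ws))\<^sup>2 / (real N)\<^sup>2)"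
        using ws pn by (intro mult_left_mono) auto
      also have "\<dots> = prod_list (map p ws) * (sum_list (map (h i) ws))\<^sup>2 / (real N)\<^sup>2" by simp
      also have "\<dots> \<le> (\<Sum>i\<in>J. prod_list (map p ws) * (sum_list (map (h i) ws))\<^sup>2 / (real N)\<^sup>2)"
        using ws pn J i(1) by (intro member_le_sum) auto
      finally show "prod_list (map p ws) \<le> (\<Sum>i\<in>J. prod_list (map p ws) * (sum_list (map (h i) ws))\<^sup>2 / (real N)\<^sup>2)"
        by simp
    qed
    also have "\<dots> \<le> (\<Sum>ws\<in>?L N. \<Sum>i\<in>J. prod_list (map p ws) * (sum_list (map (h i) ws))\<^sup>2 / (real N)\<^sup>2)"
      using finL pn by (intro sum_mono2 sum_nonneg) auto
    also have "\<dots> = (\<Sum>i\<in>J. (\<Sum>ws\<in>?L N. prod_list (map p ws) * (sum_list (map (h i) ws))\<^sup>2) / (real N)\<^sup>2)"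
      by (subst sum.swap) (simp add: sum_divide_distrib)
    also have "\<dots> = real N * V / (real N)\<^sup>2"
      by (simp only: variance_lists[OF h0] V_def sum_distrib_left sum_divide_distrib)
    also have "\<dots> = V / real N" by (simp add: power2_eq_square)
    also have "\<dots> \<le> 1 / 2" using N by (simp add: field_simps)
    finally have "(\<Sum>ws\<in>?L N - T. prod_list (map p ws)) \<le> 1 / 2" .
    moreover have "(\<Sum>ws\<in>?L N - T. prod_list (map p ws)) = 1 - (\<Sum>ws\<in>T. prod_list (map p ws))"
      using sum_diff[OF finL TL, of "\<lambda>ws. prod_list (map p ws)"] by (simp add: sum_weights_lists)
    ultimately show "1 / 2 \<le> (\<Sum>ws\<in>{ws. set ws \<subseteq> W \<and> length ws = N \<and>
      (\<forall>i\<in>J. \<bar>sum_list (map (g i) ws) - real N * (\<Sum>w\<in>W. p w * g i w)\<bar> \<le> real N)}. prod_list (map p ws))"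
      unfolding T_def by linarith
  qed
qed

lemma prod_list_eq_exp:
  "set ws \<subseteq> W \<Longrightarrow> prod_list (map p ws) = exp (- sum_list (map (\<lambda>w. - ln (p w)) ws))"
proof (induction ws)
  case (Cons w ws)
  then have "0 < p w" using p(1) by simp
  then show ?case using Cons by (simp add: exp_diff exp_minus divide_inverse)
qed simp

text \<open>Asymptotic equipartition: a typical list has probability at most
  \<open>exp (- (N * (H - 1)))\<close> for \<open>H\<close> the entropy of \<open>p\<close>, and the
  typical lists have total probability at least \<open>1 / 2\<close>, so they must be
  numerous.\<close>

lemma card_typical_lists:
  fixes g :: "'i \<Rightarrow> 'a \<Rightarrow> real"
  assumes J: "finite J"
  obtains N\<^sub>0 where "\<And>N. N\<^sub>0 \<le> N \<Longrightarrow> \<exists>T. finite T \<and> exp (real N * ((\<Sum>w\<in>W. - (p w * ln (p w))) - 1)) / 2 \<le> real (card T) \<and>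
     (\<forall>ws\<in>T. set ws \<subseteq> W \<and> length ws = N \<and> (\<forall>i\<in>J. \<bar>sum_list (map (g i) ws) - real N * (\<Sum>w\<in>W. p w * g i w)\<bar> \<le> real N))"
proof -
  \<comment> \<open>The information \<open>- ln (p w)\<close>, whose mean is the entropy, joins the
    given statistics as the case \<open>None\<close>.\<close>
  define g' where "g' = (\<lambda>j. case j of None \<Rightarrow> (\<lambda>w. - ln (p w)) | Some i \<Rightarrow> g i)"
  define H where "H = (\<Sum>w\<in>W. - (p w * ln (p w)))"
  have "finite (insert None (Some ` J))" using J by simp
  then obtain N\<^sub>0 where N0: "\<And>N. N\<^sub>0 \<le> N \<Longrightarrow> 1 / 2 \<le> (\<Sum>ws\<in>{ws. set ws \<subseteq> W \<and> length ws = N \<and>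
      (\<forall>i\<in>insert None (Some ` J). \<bar>sum_list (map (g' i) ws) - real N * (\<Sum>w\<in>W. p w * g' i w)\<bar> \<le> real N)}. prod_list (map p ws))"
    by (rule typical_lists[where g=g']) blast
  show ?thesis
  proof (rule that[of "N\<^sub>0"])
    fix N assume N: "N\<^sub>0 \<le> N"
    define T where "T = {ws. set ws \<subseteq> W \<and> length ws = N \<and>
      (\<forall>i\<in>insert None (Some ` J). \<bar>sum_list (map (g' i) ws) - real N * (\<Sum>w\<in>W. p w * g' i w)\<bar> \<le> real N)}"
    have "finite T" by (rule finite_subset[OF _ finite_lists_length_eq[OF fin, of N]]) (auto simp: T_def)
    have "1 / 2 \<le> (\<Sum>ws\<in>T. prod_list (map p ws))" unfolding T_def by (rule N0[OF N])
    also have "\<dots> \<le> (\<Sum>ws\<in>T. exp (- (real N * (H - 1))))"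
    proof (rule sum_mono)
      fix ws assume ws: "ws \<in> T"
      then have "\<bar>sum_list (map (\<lambda>w. - ln (p w)) ws) - real N * H\<bar> \<le> real N"
        unfolding T_def H_def by (auto simp: g'_def)
      then show "prod_list (map p ws) \<le> exp (- (real N * (H - 1)))"
        using ws by (subst prod_list_eq_exp) (auto simp: T_def algebra_simps)
    qed
    also have "\<dots> = real (card T) * exp (- (real N * (H - 1)))" by simp
    finally have "1 / 2 * exp (real N * (H - 1)) \<le> real (card T) * exp (- (real N * (H - 1))) * exp (real N * (H - 1))"
      by (intro mult_right_mono) auto
    then have "exp (real N * (H - 1)) / 2 \<le> real (card T)"
      by (simp only: mult.assoc exp_add[symmetric]) simp
    moreover have "\<forall>ws\<in>T. set ws \<subseteq> W \<and> length ws = N \<and> (\<forall>i\<in>J. \<bar>sum_list (map (g i) ws) - real N * (\<Sum>w\<in>W. p w * g i w)\<bar> \<le> real N)"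
      by (auto simp: T_def g'_def)
    ultimately show "\<exists>T. finite T \<and> exp (real N * ((\<Sum>w\<in>W. - (p w * ln (p w))) - 1)) / 2 \<le> real (card T) \<and>
     (\<forall>ws\<in>T. set ws \<subseteq> W \<and> length ws = N \<and> (\<forall>i\<in>J. \<bar>sum_list (map (g i) ws) - real N * (\<Sum>w\<in>W. p w * g i w)\<bar> \<le> real N))"
      using \<open>finite T\<close> unfolding H_def by blast
  qed
qed

end

text \<open>Bookkeeping for one visit count: \<open>b\<close> is the count over \<open>n\<close>
  letters, split into the glued part \<open>b\<^sub>1\<close> and the padding
  \<open>b\<^sub>2\<close>; \<open>s\<close> is the sum over the drawn words, \<open>t\<close> its
  mean, \<open>z\<close> and \<open>y\<close> the expected counts for the drawn letters and for all
  \<open>n\<close> letters. The number \<open>r\<close> of remaining letters enters twice, in the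
  actual and in the expected count.\<close>

lemma abs_diff_chain_le:
  fixes b :: real
  assumes "b = b\<^sub>1 + b\<^sub>2" "b\<^sub>2 \<in> {0..r'}" "r' \<le> r" "\<bar>b\<^sub>1 - s\<bar> \<le> A" "\<bar>s - t\<bar> \<le> B" "\<bar>t - z\<bar> \<le> C"
    "0 \<le> y - z" "y - z \<le> r"
  shows "\<bar>b - y\<bar> \<le> 2 * r + A + B + C"
proof -
  have "b\<^sub>1 - s \<le> A" "- (b\<^sub>1 - s) \<le> A" "s - t \<le> B" "- (s - t) \<le> B" "t - z \<le> C" "- (t - z) \<le> C"
    "0 \<le> b\<^sub>2" "b\<^sub>2 \<le> r'"
    using assms by (auto simp: abs_le_iff)
  with assms(1,3,7,8) show ?thesis unfolding abs_le_iff by linarith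
qed

section \<open>Birkhoff sums of cylinder indicators\<close>

definition birkhoff_sum :: "((nat \<Rightarrow> 'e) \<Rightarrow> real) \<Rightarrow> nat \<Rightarrow> (nat \<Rightarrow> 'e) \<Rightarrow> real" where
  "birkhoff_sum f n u = (\<Sum>k<n. f ((shift_map ^^ k) u))"

lemma birkhoff_sum_add: "birkhoff_sum f (m + n) u = birkhoff_sum f m u + birkhoff_sum f n ((shift_map ^^ m) u)"
proof (induction n)
  case (Suc n)
  have "(shift_map ^^ (m + n)) u = (shift_map ^^ n) ((shift_map ^^ m) u)"
    by (simp add: shift_map_funpow algebra_simps)
  with Suc show ?case by (simp add: birkhoff_sum_def)
qed (simp add: birkhoff_sum_def)

lemma birkhoff_sum_bounds:
  assumes "\<And>u. f u \<in> {0..1}"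
  shows "birkhoff_sum f n u \<in> {0..real n}"
proof -
  have "0 \<le> birkhoff_sum f n u"
    unfolding birkhoff_sum_def using assms by (auto intro!: sum_nonneg)
  moreover have "birkhoff_sum f n u \<le> (\<Sum>k<n. 1)"
    unfolding birkhoff_sum_def by (rule sum_mono) (use assms in simp)
  ultimately show ?thesis by simp
qed

text \<open>An occurrence of \<open>q\<close> that starts before \<open>m - K\<close> is read inside
  the common prefix; only the last \<open>K\<close> starting positions can differ.\<close>

lemma birkhoff_sum_indicator_agree:
  assumes q: "length q \<le> K" and uv: "u \<in> strings G" "v \<in> strings G" "\<And>i. i < m \<Longrightarrow> u i = v i"
  shows "\<bar>birkhoff_sum (indicator (cylinder G q)) m u - birkhoff_sum (indicator (cylinder G q)) m v\<bar> \<le> real K"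
proof -
  let ?f = "indicator (cylinder G q) :: _ \<Rightarrow> real"
  have "\<bar>?f ((shift_map ^^ j) u) - ?f ((shift_map ^^ j) v)\<bar> \<le> (if j \<in> {m - K..<m} then 1 else 0)" if "j < m" for j
  proof (cases "j < m - K")
    case True
    then have eq: "map ((shift_map ^^ j) u) [0..<length q] = map ((shift_map ^^ j) v) [0..<length q]"
      using q uv(3) by (auto simp: shift_map_funpow)
    have "(shift_map ^^ j) u \<in> cylinder G q \<longleftrightarrow> (shift_map ^^ j) v \<in> cylinder G q"
      unfolding cylinder_def mem_Collect_eq eq using uv shift_map_funpow_strings[of _ G j] by blast
    then show ?thesis by (simp add: indicator_def)
  next
    case False
    then show ?thesis using that by (auto simp: indicator_def)
  qed
  then have "(\<Sum>j<m. \<bar>?f ((shift_map ^^ j) u) - ?f ((shift_map ^^ j) v)\<bar>) \<le> (\<Sum>j<m. if j \<in> {m - K..<m} then 1 else 0)"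
    by (intro sum_mono) auto
  also have "\<dots> = real (card ({..<m} \<inter> {m - K..<m}))"
    unfolding sum.inter_restrict[OF finite_lessThan, symmetric] by simp
  also have "\<dots> \<le> real (card {m - K..<m})" by (intro of_nat_mono card_mono) auto
  also have "\<dots> \<le> real K" by simp
  finally show ?thesis
    unfolding birkhoff_sum_def sum_subtractf[symmetric] by (rule order_trans[OF sum_abs])
qed

lemma cylinder_append:
  assumes "u \<in> cylinder G (p @ q)"
  shows "u \<in> cylinder G p" "(shift_map ^^ length p) u \<in> cylinder G q"
proof -
  have u: "u \<in> strings G" "map u [0..<length p + length q] = p @ q" using assms by (auto simp: cylinder_def)
  have "map u [0..<length p] @ map u [length p..<length p + length q] = p @ q"
    using u(2) upt_add_eq_append[of 0 "length p" "length q"] by simp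
  then have *: "map u [0..<length p] = p" "map u [length p..<length p + length q] = q"
    by (auto simp: append_eq_append_conv)
  show "u \<in> cylinder G p" using u(1) *(1) by (simp add: cylinder_def)
  have "map ((shift_map ^^ length p) u) [0..<length q] = map u [length p..<length p + length q]"
    by (intro nth_equalityI) (auto simp: shift_map_funpow add.commute)
  then show "(shift_map ^^ length p) u \<in> cylinder G q"
    using *(2) shift_map_funpow_strings[OF u(1)] by (simp add: cylinder_def)
qed

context string_graph begin

text \<open>By invariance the exact mean over \<open>\<mu>\<close> is
  \<open>m * measure \<mu> (cyl q)\<close>. Replacing a string by the representative of its
  \<open>m\<close>-prefix changes each Birkhoff sum by at most \<open>K\<close>.\<close>

lemma mean_birkhoff_sum:
  assumes \<mu>: "\<mu> \<in> imeas" and q: "length q \<le> K"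
  shows "\<bar>(\<Sum>w\<in>words G m. measure \<mu> (cyl w) * birkhoff_sum (indicator (cyl q)) m (ext w)) - real m * measure \<mu> (cyl q)\<bar> \<le> real K"
proof -
  note inv = invariantD[OF \<mu>]
  interpret prob_space \<mu> using inv(1) by (rule prob_measures_prob_space)
  let ?f = "indicator (cyl q) :: _ \<Rightarrow> real"
  have q_sets [measurable]: "cyl q \<in> sets \<mu>" by (simp add: prob_measures_sets[OF inv(1)] cylinder_in_borel)
  have Tj: "shift_map ^^ j \<in> measurable \<mu> \<mu>" for j using inv(2) by (rule measurable_compose_n)
  have inv_j: "(\<integral>u. ?f ((shift_map ^^ j) u) \<partial>\<mu>) = measure \<mu> (cyl q)" for j
  proof (induction j)
    case (Suc j)
    have meas: "(\<lambda>u. ?f ((shift_map ^^ j) u)) \<in> borel_measurable \<mu>"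
      by (rule measurable_compose[OF Tj]) measurable
    have "(\<integral>u. ?f ((shift_map ^^ Suc j) u) \<partial>\<mu>) = (\<integral>u. ?f ((shift_map ^^ j) (shift_map u)) \<partial>\<mu>)"
      by (simp add: funpow_swap1)
    also have "\<dots> = (\<integral>u. ?f ((shift_map ^^ j) u) \<partial>(distr \<mu> \<mu> shift_map))"
      by (rule integral_distr[OF inv(2) meas, symmetric])
    finally show ?case using Suc inv(3) by simp
  qed simp
  have int_j: "integrable \<mu> (\<lambda>u. ?f ((shift_map ^^ j) u))" for j
    by (rule integrable_const_bound[of _ 1]) (auto intro: measurable_compose[OF Tj])
  have int_b: "integrable \<mu> (birkhoff_sum ?f m)"
    unfolding birkhoff_sum_def using int_j by (intro Bochner_Integration.integrable_sum)
  have b: "(\<integral>u. birkhoff_sum ?f m u \<partial>\<mu>) = real m * measure \<mu> (cyl q)"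
    unfolding birkhoff_sum_def using int_j inv_j by simp
  define h where "h = (\<lambda>w. birkhoff_sum ?f m (ext w))"
  note int_h = integral_prefix[OF inv(1), of h m]
  have "\<bar>(\<integral>u. h (map u [0..<m]) \<partial>\<mu>) - (\<integral>u. birkhoff_sum ?f m u \<partial>\<mu>)\<bar>
      = \<bar>\<integral>u. h (map u [0..<m]) - birkhoff_sum ?f m u \<partial>\<mu>\<bar>"
    using int_h(1) int_b by simp
  also have "\<dots> \<le> (\<integral>u. real K \<partial>\<mu>)"
  proof (rule order_trans[OF integral_abs_bound integral_mono])
    fix u assume "u \<in> space \<mu>"
    then have u: "u \<in> strings G" by (simp add: prob_measures_space[OF inv(1)])
    have w: "map u [0..<m] \<in> words G m" using u by (rule prefix_in_words)
    show "\<bar>h (map u [0..<m]) - birkhoff_sum ?f m u\<bar> \<le> real K"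
      unfolding h_def using ext_in[OF w] u
      by (intro birkhoff_sum_indicator_agree q) (auto simp: mem_cylinder_map)
  qed (use int_h(1) int_b in auto)
  finally have "\<bar>(\<Sum>w\<in>words G m. h w * measure \<mu> (cyl w)) - real m * measure \<mu> (cyl q)\<bar> \<le> real K"
    unfolding int_h(2) b by (simp add: prob_space)
  then show ?thesis by (simp add: h_def mult.commute)
qed

section \<open>Gluing words along connecting paths\<close>

definition conn :: "'v \<Rightarrow> 'v \<Rightarrow> 'e list" where
  "conn v v' = (SOME p. awalk v p v')"

lemma conn_awalk: "v \<in> verts G \<Longrightarrow> v' \<in> verts G \<Longrightarrow> awalk v (conn v v') v'"
  unfolding conn_def using someI_ex[OF ex_awalk] by blast

lemma conn_bounded: "\<exists>L. \<forall>v\<in>verts G. \<forall>v'\<in>verts G. length (conn v v') \<le> L"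
proof -
  have "finite ((\<lambda>(v, v'). length (conn v v')) ` (verts G \<times> verts G))" by simp
  then obtain L where "\<forall>x\<in>(\<lambda>(v, v'). length (conn v v')) ` (verts G \<times> verts G). x \<le> L"
    using finite_nat_set_iff_bounded_le by blast
  then show ?thesis by auto
qed

fun chain :: "'v \<Rightarrow> 'e list list \<Rightarrow> 'e list" where
  "chain v [] = []"
| "chain v (w # ws) = conn v (tail G (hd w)) @ w @ chain (head G (last w)) ws"

fun gaps :: "'v \<Rightarrow> 'e list list \<Rightarrow> nat list" where
  "gaps v [] = []"
| "gaps v (w # ws) = length (conn v (tail G (hd w))) # gaps (head G (last w)) ws"

lemma length_gaps: "length (gaps v ws) = length ws"
  by (induction ws arbitrary: v) auto

text \<open>Equal gap lengths align the two chains, and the factors, all of length \<open>m\<close>,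
  can be cut out one after the other. The remainders \<open>r\<close> and \<open>r'\<close> allow
  for padding to a common length.\<close>

lemma chain_inj:
  assumes "chain v ws @ r = chain v ws' @ r'" "gaps v ws = gaps v ws'"
    "set ws \<subseteq> words G m" "set ws' \<subseteq> words G m"
  shows "ws = ws'"
  using assms
proof (induction ws arbitrary: v ws')
  case Nil
  then show ?case by (cases ws') auto
next
  case (Cons w ws)
  then obtain x xs where ws': "ws' = x # xs" by (cases ws') auto
  have "length w = m" "length x = m" using Cons.prems ws' by (auto simp: words_def)
  then have "w = x" "chain (head G (last w)) ws @ r = chain (head G (last x)) xs @ r'"
    using Cons.prems(1,2) ws' by (auto simp: append_eq_append_conv)
  then show ?case using Cons ws' by auto
qed

context
  fixes L m :: nat
  assumes L: "\<And>v v'. v \<in> verts G \<Longrightarrow> v' \<in> verts G \<Longrightarrow> length (conn v v') \<le> L" and m: "0 < m"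
begin

lemma word_ends:
  assumes "w \<in> words G m"
  shows "tail G (hd w) \<in> verts G" "head G (last w) \<in> verts G"
proof -
  have "set w \<subseteq> arcs G" "w \<noteq> []" using assms m by (auto simp: words_def)
  then show "tail G (hd w) \<in> verts G" "head G (last w) \<in> verts G" by (auto simp: subset_eq)
qed

lemma chain_awalk:
  assumes "v \<in> verts G" "set ws \<subseteq> words G m"
  shows "\<exists>v'. awalk v (chain v ws) v'"
  using assms
proof (induction ws arbitrary: v)
  case Nil
  then show ?case by (auto simp: awalk_Nil_iff)
next
  case (Cons w ws)
  then have w: "w \<in> words G m" by simp
  obtain v' where "awalk (head G (last w)) (chain (head G (last w)) ws) v'"
    using Cons word_ends[OF w] by auto
  then have "awalk v (conn v (tail G (hd w)) @ w @ chain (head G (last w)) ws) v'"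
    using conn_awalk[OF Cons.prems(1) word_ends(1)[OF w]] words_awalk[OF w m]
    by (blast intro: awalk_appendI)
  then show ?case by auto
qed

lemma length_chain:
  assumes "v \<in> verts G" "set ws \<subseteq> words G m"
  shows "length ws * m \<le> length (chain v ws)" "length (chain v ws) \<le> length ws * (m + L)"
  using assms
proof (induction ws arbitrary: v)
  case (Cons w ws)
  {
    case 1
    then have w: "w \<in> words G m" "length w = m" by (auto simp: words_def)
    then show ?case using Cons.IH(1)[OF word_ends(2)[OF w(1)]] 1 by simp
  next
    case 2
    then have w: "w \<in> words G m" "length w = m" by (auto simp: words_def)
    then show ?case using Cons.IH(2)[OF word_ends(2)[OF w(1)]] L[OF 2(1) word_ends(1)[OF w(1)]] 2 by simp
  }
qed auto

lemma gaps_le: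
  assumes "v \<in> verts G" "set ws \<subseteq> words G m"
  shows "set (gaps v ws) \<subseteq> {..L}"
  using assms
proof (induction ws arbitrary: v)
  case (Cons w ws)
  then have w: "w \<in> words G m" by simp
  then show ?case using Cons.IH[OF word_ends(2)[OF w]] L[OF Cons.prems(1) word_ends(1)[OF w]] Cons.prems by simp
qed simp

text \<open>Each factor costs at most \<open>L\<close> for the path in front of it and at most
  \<open>K\<close> for replacing the actual continuation by its representative.\<close>

lemma birkhoff_sum_chain:
  assumes "v \<in> verts G" "set ws \<subseteq> words G m" "u \<in> cyl (chain v ws)" "length q \<le> K"
  shows "\<bar>birkhoff_sum (indicator (cyl q)) (length (chain v ws)) u
      - sum_list (map (\<lambda>w. birkhoff_sum (indicator (cyl q)) m (ext w)) ws)\<bar> \<le> real (length ws) * (real L + real K)"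
  using assms
proof (induction ws arbitrary: v u)
  case Nil
  then show ?case by (simp add: birkhoff_sum_def)
next
  case (Cons w ws)
  let ?f = "indicator (cyl q) :: _ \<Rightarrow> real"
  let ?c = "conn v (tail G (hd w))" and ?r = "chain (head G (last w)) ws"
  have w: "w \<in> words G m" "length w = m" using Cons.prems by (auto simp: words_def)
  let ?u' = "(shift_map ^^ length ?c) u"
  let ?u'' = "(shift_map ^^ length w) ?u'"
  have u: "?u' \<in> cyl w" "?u'' \<in> cyl ?r"
    using cylinder_append[of u G ?c "w @ ?r"] cylinder_append[of ?u' G w ?r] Cons.prems(3) by auto
  have split: "birkhoff_sum ?f (length (chain v (w # ws))) u =
    birkhoff_sum ?f (length ?c) u + (birkhoff_sum ?f m ?u' + birkhoff_sum ?f (length ?r) ?u'')"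
    using w(2) by (simp add: birkhoff_sum_add del: funpow.simps)
  have "birkhoff_sum ?f (length ?c) u \<in> {0..real (length ?c)}" by (rule birkhoff_sum_bounds) auto
  moreover have "length ?c \<le> L" by (rule L[OF Cons.prems(1) word_ends(1)[OF w(1)]])
  moreover have "\<bar>birkhoff_sum ?f m ?u' - birkhoff_sum ?f m (ext w)\<bar> \<le> real K"
  proof (rule birkhoff_sum_indicator_agree[OF Cons.prems(4)])
    show "?u' i = ext w i" if "i < m" for i
    proof -
      have "map ?u' [0..<m] = map (ext w) [0..<m]"
        using u(1) ext_in[OF w(1)] w(1) by (simp add: mem_cylinder_words)
      then show ?thesis using that by simp
    qed
  qed (use u(1) ext_strings[OF w(1)] in \<open>auto simp: cylinder_def\<close>)
  moreover have "\<bar>birkhoff_sum ?f (length ?r) ?u''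
      - sum_list (map (\<lambda>w. birkhoff_sum ?f m (ext w)) ws)\<bar> \<le> real (length ws) * (real L + real K)"
    using Cons.IH[OF word_ends(2)[OF w(1)] _ u(2) Cons.prems(4)] Cons.prems(2) by simp
  ultimately show ?case
    unfolding split by (simp add: algebra_simps) linarith
qed

end

text \<open>Words of length \<open>m\<close> drawn independently with the probabilities \<open>\<mu>[w]\<close> and joined by bounded connecting
  paths form long words; for large \<open>m\<close> the typical ones have the local statistics of \<open>\<mu>\<close>, and there are
  enough of them. Ergodicity of \<open>\<mu>\<close> plays no role. A joined word determines its factors
  only together with the gap lengths, which costs the harmless factor \<open>(L + 1) ^ N\<close>.\<close>

lemma many_typical_words:
  assumes \<mu>: "\<mu> \<in> imeas" and Q: "finite Q" and d: "0 < d" and e: "0 < e"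
  obtains n\<^sub>0 where "\<And>n. n\<^sub>0 \<le> n \<Longrightarrow> \<exists>S\<subseteq>words G n. exp (real n * (shift_entropy \<mu> - e)) \<le> real (card S) \<and>
    (\<forall>w\<in>S. \<forall>u\<in>cyl w. \<forall>q\<in>Q. \<bar>measure (empirical_measure G n u) (cyl q) - measure \<mu> (cyl q)\<bar> < d)"
proof -
  note inv = invariantD[OF \<mu>]
  interpret \<mu>: prob_space \<mu> using inv(1) by (rule prob_measures_prob_space)
  define h where "h = shift_entropy \<mu>"
  have h0: "0 \<le> h" unfolding h_def by (rule shift_entropy_nonneg[OF \<mu>])
  obtain L where L: "\<And>v v'. v \<in> verts G \<Longrightarrow> v' \<in> verts G \<Longrightarrow> length (conn v v') \<le> L"
    using conn_bounded by blast
  obtain K where K: "\<And>q. q \<in> Q \<Longrightarrow> length q \<le> K"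
    using finite_nat_set_iff_bounded_le[of "length ` Q"] Q by auto
  define lL where "lL = ln (real L + 1)"
  obtain m\<^sub>0 :: nat where m0: "max (2 * (1 + lL + h * L) / e) (2 * (3 * L + 2 * K + 1) / d) < real m\<^sub>0"
    using reals_Archimedean2 by blast
  define m where "m = Suc m\<^sub>0"
  have m: "0 < m" "2 * (1 + lL + h * L) / e < real m" "2 * (3 * L + 2 * K + 1) / d < real m"
    using m0 by (auto simp: m_def)
  \<comment> \<open>Per drawn word, 1 is lost to the deviation of the information, \<open>lL\<close>
    to the unknown gap length and \<open>h * L\<close> to the connecting path: at most
    \<open>e / 2\<close> per letter. Likewise \<open>3 * L + 2 * K + 1\<close> bounds the error of a
    visit count per drawn word, at most \<open>d / 2\<close> per letter.\<close>
  have me: "2 * (1 + lL + h * L) \<le> e * real m" and md: "2 * (3 * L + 2 * K + 1) \<le> d * real m"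
    using m(2,3) d e by (auto simp: field_simps)
  define p where "p = (\<lambda>w. measure \<mu> (cyl w))"
  \<comment> \<open>Words of measure zero are dropped, so that the weights are positive and
    \<open>ln (p w)\<close> is a genuine logarithm.\<close>
  define W where "W = {w \<in> words G m. 0 < p w}"
  have W: "finite W" "W \<subseteq> words G m" "\<And>w. w \<in> W \<Longrightarrow> 0 < p w" by (auto simp: W_def)
  have p0: "p w = 0" if "w \<in> words G m - W" for w
    using that zero_less_measure_iff[of \<mu> "cyl w"] by (auto simp: W_def p_def)
  have sumW: "(\<Sum>w\<in>W. F w) = (\<Sum>w\<in>words G m. F w)" if "\<And>w. p w = 0 \<Longrightarrow> F w = 0" for F :: "_ \<Rightarrow> real"
    using W p0 that by (intro sum.mono_neutral_left) auto
  have pW: "(\<Sum>w\<in>W. p w) = 1" using sumW[of p] sum_measure_cyl[OF inv(1), of m] by (simp add: p_def)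
  define g where "g = (\<lambda>q w. birkhoff_sum (indicator (cyl q)) m (ext w))"
  define H where "H = (\<Sum>w\<in>W. - (p w * ln (p w)))"
  have H: "real m * h \<le> H"
  proof -
    have "H = word_entropy \<mu> m"
      unfolding H_def word_entropy_def sumW[of "\<lambda>w. - (p w * ln (p w))", simplified]
      by (simp add: sum_negf p_def)
    then show ?thesis
      using \<mu>.entropy_rate_le[OF inv(2,3) simple_function_letter[OF inv(1)] m(1)] m(1)
      by (simp add: h_def shift_entropy_def word_entropy_eq(2)[OF inv(1)] field_simps)
  qed
  have Eg: "\<bar>(\<Sum>w\<in>W. p w * g q w) - real m * p q\<bar> \<le> real K" if "q \<in> Q" for q
    using mean_birkhoff_sum[OF \<mu> K[OF that], of m] sumW[of "\<lambda>w. p w * g q w"]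
    by (simp add: p_def g_def)
  obtain N\<^sub>0 where N0: "\<And>N. N\<^sub>0 \<le> N \<Longrightarrow> \<exists>T. finite T \<and> exp (real N * (H - 1)) / 2 \<le> real (card T) \<and>
     (\<forall>ws\<in>T. set ws \<subseteq> W \<and> length ws = N \<and> (\<forall>q\<in>Q. \<bar>sum_list (map (g q) ws) - real N * (\<Sum>w\<in>W. p w * g q w)\<bar> \<le> real N))"
    unfolding H_def by (rule card_typical_lists[OF W(1,3) pW Q, of g]) blast+
  obtain n\<^sub>1 :: nat where n1: "max (2 * (h * (m + L) + ln 2) / e) (4 * (m + L) / d) < real n\<^sub>1"
    using reals_Archimedean2 by blast
  obtain v\<^sub>0 where v0: "v\<^sub>0 \<in> verts G" using verts_ne by auto
  show ?thesis
  proof (rule that[of "max n\<^sub>1 (N\<^sub>0 * (m + L)) + 1"])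
    fix n assume "max n\<^sub>1 (N\<^sub>0 * (m + L)) + 1 \<le> n"
    then have n: "n\<^sub>1 \<le> n" "N\<^sub>0 * (m + L) \<le> n" "0 < n" by auto
    \<comment> \<open>The size of \<open>n\<close> absorbs what occurs only once: the incomplete
      last piece, shorter than \<open>m + L\<close>, and the factor \<open>1 / 2\<close> of the
      typical lists.\<close>
    have ne: "2 * (h * (m + L) + ln 2) \<le> e * real n" and nd: "4 * (m + L) < d * real n"
    proof -
      have "2 * (h * (m + L) + ln 2) / e < real n" "4 * (m + L) / d < real n"
        using n1 n(1) by auto
      then show "2 * (h * (m + L) + ln 2) \<le> e * real n" "4 * (m + L) < d * real n"
        using d e by (auto simp: field_simps)
    qed
    \<comment> \<open>Each drawn word is allotted \<open>m + L\<close> letters, so that a chain of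
      \<open>N\<close> words always fits into length \<open>n\<close>.\<close>
    define N where "N = n div (m + L)"
    have NN: "N\<^sub>0 \<le> N" using n(2) m(1) by (simp add: N_def less_eq_div_iff_mult_less_eq)
    have Nn: "N * (m + L) \<le> n" "n < (N + 1) * (m + L)"
      using m(1) dividend_less_div_times[of "m + L" n] div_times_less_eq_dividend[of n "m + L"]
      by (auto simp: N_def)
    have Nm: "real N * real m \<le> real n" "real n - real N * real m \<le> real N * L + (m + L)"
      "0 \<le> real n - real N * real m"
    proof -
      have "real (N * (m + L)) \<le> real n" "real n < real ((N + 1) * (m + L))"
        using Nn by (simp_all only: of_nat_le_iff of_nat_less_iff)
      then have le: "real N * real m + real N * real L \<le> real n"
        "real n < real N * real m + real N * real L + (real m + real L)"
        by (simp_all add: algebra_simps)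
      have "0 \<le> real N * real L" by simp
      with le show "real N * real m \<le> real n" "real n - real N * real m \<le> real N * L + (m + L)"
        "0 \<le> real n - real N * real m"
        by linarith+
    qed
    obtain T where T: "finite T" "exp (real N * (H - 1)) / 2 \<le> real (card T)"
      "\<And>ws. ws \<in> T \<Longrightarrow> set ws \<subseteq> W \<and> length ws = N"
      "\<And>ws q. ws \<in> T \<Longrightarrow> q \<in> Q \<Longrightarrow> \<bar>sum_list (map (g q) ws) - real N * (\<Sum>w\<in>W. p w * g q w)\<bar> \<le> real N"
      using N0[OF NN] by blast
    have TW: "set ws \<subseteq> words G m" "length ws = N" if "ws \<in> T" for ws using T(3)[OF that] W(2) by auto
    define c where "c = chain v\<^sub>0"
    \<comment> \<open>Chains have varying lengths; they are prolonged along an admissible string and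
      cut at \<open>n\<close>.\<close>
    define word where "word = (\<lambda>ws. map (ext (c ws)) [0..<n])"
    have cw: "c ws \<in> words G (length (c ws))" if "ws \<in> T" for ws
      using chain_awalk[OF L m(1) v0 TW(1)[OF that]] awalk_in_words unfolding c_def by blast
    have len: "N * m \<le> length (c ws)" "length (c ws) \<le> n" if "ws \<in> T" for ws
      using length_chain[OF L m(1) v0 TW(1)[OF that]] TW(2)[OF that] Nn(1) unfolding c_def by auto
    have word_append: "\<exists>r. word ws = c ws @ r" if "ws \<in> T" for ws
    proof -
      have "[0..<n] = [0..<length (c ws)] @ [length (c ws)..<n]"
        using upt_add_eq_append[of 0 "length (c ws)" "n - length (c ws)"] len(2)[OF that] by simp
      moreover have "map (ext (c ws)) [0..<length (c ws)] = c ws"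
        using ext_in[OF cw[OF that]] by (simp add: cylinder_def)
      ultimately show ?thesis by (simp add: word_def)
    qed
    have word_in: "word ws \<in> words G n" if "ws \<in> T" for ws
      unfolding word_def using ext_strings[OF cw[OF that]] by (rule prefix_in_words)
    have "inj_on (\<lambda>ws. (word ws, gaps v\<^sub>0 ws)) T"
    proof (rule inj_onI)
      fix ws ws' assume *: "ws \<in> T" "ws' \<in> T" "(word ws, gaps v\<^sub>0 ws) = (word ws', gaps v\<^sub>0 ws')"
      obtain r r' where "word ws = c ws @ r" "word ws' = c ws' @ r'" using word_append * by blast
      then have "chain v\<^sub>0 ws @ r = chain v\<^sub>0 ws' @ r'" using *(3) by (simp add: c_def)
      then show "ws = ws'" by (rule chain_inj) (use * TW(1) in auto)
    qed
    then have "card T \<le> card (word ` T \<times> {xs. set xs \<subseteq> {..L} \<and> length xs = N})"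
    proof (rule card_inj_on_le)
      show "(\<lambda>ws. (word ws, gaps v\<^sub>0 ws)) ` T \<subseteq> word ` T \<times> {xs. set xs \<subseteq> {..L} \<and> length xs = N}"
        using gaps_le[OF L m(1) v0] TW by (auto simp: length_gaps)
    qed (use T(1) in \<open>simp add: finite_lists_length_eq\<close>)
    also have "\<dots> = card (word ` T) * (L + 1) ^ N"
      by (simp add: card_cartesian_product card_lists_length_eq)
    finally have "real (card T) \<le> real (card (word ` T) * (L + 1) ^ N)" by (simp only: of_nat_le_iff)
    also have "\<dots> = real (card (word ` T)) * exp (real N * lL)"
      by (simp add: lL_def exp_of_nat_mult add.commute)
    finally have "exp (real N * (H - 1)) / 2 \<le> real (card (word ` T)) * exp (real N * lL)" using T(2) by linarith
    then have "exp (real N * (H - 1)) * exp (- ln 2) * exp (- (real N * lL)) \<le> real (card (word ` T))"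
      by (simp add: exp_minus field_simps)
    then have "exp (real N * (H - 1) - ln 2 - real N * lL) \<le> real (card (word ` T))"
      by (simp add: exp_diff exp_minus divide_simps)
    \<comment> \<open>With \<open>N * H \<ge> N * m * h\<close> and
      \<open>n - N * m \<le> N * L + (m + L)\<close>, the losses per drawn word amount to at most
      \<open>e * n / 2\<close>, and so do the losses that occur once.\<close>
    moreover have "real n * (h - e) \<le> real N * (H - 1) - ln 2 - real N * lL"
    proof -
      have "h * (real n - real N * real m) \<le> h * (real N * L + (m + L))"
        using Nm(2) h0 by (intro mult_left_mono) auto
      moreover have "real N * (real m * h) \<le> real N * H" using H by (intro mult_left_mono) auto
      moreover have "real N * (2 * (1 + lL + h * L)) \<le> real N * (e * real m)"
        using me by (intro mult_left_mono) auto
      moreover have "e * (real N * real m) \<le> e * real n" using Nm(1) e by (intro mult_left_mono) auto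
      ultimately show ?thesis using ne by (simp add: algebra_simps)
    qed
    ultimately have card: "exp (real n * (h - e)) \<le> real (card (word ` T))"
      by (meson exp_le_cancel_iff order_trans)
    have close: "\<bar>measure (empirical_measure G n u) (cyl q) - measure \<mu> (cyl q)\<bar> < d"
      if ws: "ws \<in> T" and u: "u \<in> cyl (word ws)" and q: "q \<in> Q" for ws u q
    proof -
      let ?f = "indicator (cyl q) :: _ \<Rightarrow> real"
      have us: "u \<in> strings G" using u by (simp add: cylinder_def)
      obtain r where "word ws = c ws @ r" using word_append[OF ws] by blast
      then have uc: "u \<in> cyl (c ws)" using cylinder_append(1)[of u G "c ws" r] u by simp
      let ?l = "length (c ws)"
      have "birkhoff_sum ?f n u = birkhoff_sum ?f ?l u + birkhoff_sum ?f (n - ?l) ((shift_map ^^ ?l) u)"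
        using birkhoff_sum_add[of ?f ?l "n - ?l" u] len(2)[OF ws] by simp
      moreover have "birkhoff_sum ?f (n - ?l) ((shift_map ^^ ?l) u) \<in> {0..real (n - ?l)}"
        by (rule birkhoff_sum_bounds) auto
      moreover have "real (n - ?l) \<le> real n - real N * real m"
      proof -
        have "real (N * m) \<le> real ?l" using len(1)[OF ws] by (simp only: of_nat_le_iff)
        then show ?thesis using len(2)[OF ws] by (simp add: of_nat_diff)
      qed
      moreover have "\<bar>birkhoff_sum ?f ?l u - sum_list (map (g q) ws)\<bar> \<le> real N * (real L + real K)"
        using birkhoff_sum_chain[OF L m(1) v0 TW(1)[OF ws] _ K[OF q], of u] uc TW(2)[OF ws]
        by (simp add: c_def g_def)
      moreover note T(4)[OF ws q]
      moreover have "\<bar>real N * (\<Sum>w\<in>W. p w * g q w) - real N * (real m * p q)\<bar> \<le> real N * real K"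
      proof -
        have "\<bar>real N * (\<Sum>w\<in>W. p w * g q w) - real N * (real m * p q)\<bar>
            = real N * \<bar>(\<Sum>w\<in>W. p w * g q w) - real m * p q\<bar>"
          by (simp only: right_diff_distrib[symmetric] abs_mult abs_of_nat)
        also have "\<dots> \<le> real N * real K" using Eg[OF q] by (intro mult_left_mono) auto
        finally show ?thesis .
      qed
      moreover have "0 \<le> (real n - real N * real m) * p q" "(real n - real N * real m) * p q \<le> real n - real N * real m"
        using Nm(3) by (auto simp: p_def intro!: mult_right_le_one_le)
      ultimately have "\<bar>birkhoff_sum ?f n u - real n * p q\<bar> \<le>
         2 * (real n - real N * real m) + real N * (real L + real K) + real N + real N * real K"
        unfolding left_diff_distrib mult.assoc by (rule abs_diff_chain_le)
      also have "\<dots> \<le> real N * (3 * L + 2 * K + 1) + 2 * (m + L)"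
        using Nm(2) by (simp add: algebra_simps)
      also have "\<dots> < d * real n"
      proof -
        have "real N * (2 * (3 * L + 2 * K + 1)) \<le> real N * (d * real m)"
          using md by (intro mult_left_mono) auto
        moreover have "d * (real N * real m) \<le> d * real n" using Nm(1) d by (intro mult_left_mono) auto
        ultimately show ?thesis using nd by (simp add: algebra_simps)
      qed
      finally have "\<bar>birkhoff_sum ?f n u - real n * p q\<bar> < d * real n" .
      moreover have "measure (empirical_measure G n u) (cyl q) - p q = (birkhoff_sum ?f n u - real n * p q) / real n"
        using n(3) by (simp add: measure_empirical_measure[OF us cylinder_in_borel] birkhoff_sum_def field_simps)
      ultimately have "\<bar>measure (empirical_measure G n u) (cyl q) - p q\<bar> < d"
        using n(3) by (simp only: abs_divide abs_of_nat pos_divide_less_eq of_nat_0_less_iff)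
      then show ?thesis by (simp add: p_def)
    qed
    show "\<exists>S\<subseteq>words G n. exp (real n * (shift_entropy \<mu> - e)) \<le> real (card S) \<and>
      (\<forall>w\<in>S. \<forall>u\<in>cyl w. \<forall>q\<in>Q. \<bar>measure (empirical_measure G n u) (cyl q) - measure \<mu> (cyl q)\<bar> < d)"
      using word_in card close unfolding h_def by (intro exI[of _ "word ` T"]) auto
  qed
qed

end

section \<open>Bounds for the multifractal sums\<close>

text \<open>Away from 0 this is continuity of \<open>ln\<close>. At \<open>l = 0\<close> the value
  is 0 by \<open>ln 0 = 0\<close>, and \<open>minus_xlnx_le_sqrt\<close> squeezes the terms.\<close>

lemma tendsto_xlnx:
  fixes x :: "nat \<Rightarrow> real"
  assumes x: "x \<longlonglongrightarrow> l" "\<And>n. x n \<in> {0..1}"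
  shows "(\<lambda>n. x n * ln (x n)) \<longlonglongrightarrow> l * ln l"
proof (cases "l = 0")
  case True
  have "(\<lambda>n. 2 * sqrt (x n)) \<longlonglongrightarrow> 2 * sqrt l" by (intro tendsto_intros x)
  moreover have "norm (x n * ln (x n)) \<le> 2 * sqrt (x n)" for n
  proof -
    have "x n * ln (x n) \<le> 0" using x(2)[of n] by (cases "x n = 0") (auto simp: mult_le_0_iff)
    then show ?thesis using minus_xlnx_le_sqrt[of "x n"] x(2)[of n] by simp
  qed
  ultimately have "(\<lambda>n. x n * ln (x n)) \<longlonglongrightarrow> 0"
    using True by (intro Lim_null_comparison[of "\<lambda>n. x n * ln (x n)" "\<lambda>n. 2 * sqrt (x n)"]) auto
  then show ?thesis using True by simp
next
  case False
  then show ?thesis by (intro tendsto_intros x)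
qed

context string_graph begin

lemma bdd_above_exp_sum:
  assumes \<phi>: "continuous_map (string_topology G) euclideanreal \<phi>"
  shows "bdd_above ((\<lambda>u. exp (\<Sum>k<n. \<phi> ((shift_map ^^ k) u))) ` cyl w)"
proof -
  obtain M where M: "\<And>u. u \<in> strings G \<Longrightarrow> \<bar>\<phi> u\<bar> \<le> M"
    using continuous_map_bounded[OF finite_arcs \<phi>] by blast
  show ?thesis
  proof (rule bdd_aboveI2)
    fix u assume "u \<in> cyl w"
    then have u: "u \<in> strings G" by (simp add: cylinder_def)
    have "(\<Sum>k<n. \<phi> ((shift_map ^^ k) u)) \<le> (\<Sum>k<n. M)"
      using M[OF shift_map_funpow_strings[OF u]] by (intro sum_mono) (auto simp: abs_le_iff)
    then show "exp (\<Sum>k<n. \<phi> ((shift_map ^^ k) u)) \<le> exp (real n * M)" by simp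
  qed
qed

text \<open>The typical words for \<open>\<mu>\<close> are admissible because all their empirical
  measures lie in \<open>W\<close>. Half of \<open>e\<close> is spent on their number, half on their
  weights.\<close>

lemma multifractal_sum_lower:
  assumes \<phi>: "continuous_map (string_topology G) euclideanreal \<phi>"
    and \<mu>: "\<mu> \<in> imeas" and W: "openin (weak_topology (string_topology G)) W" "\<mu> \<in> W"
    and WC: "\<And>\<nu>. \<nu> \<in> W \<Longrightarrow> U \<nu> \<in> C" and e: "0 < e"
  shows "\<forall>\<^sub>F n in sequentially. exp (real n * (shift_entropy \<mu> + integral\<^sup>L \<mu> \<phi> - e)) \<le> multifractal_sum G U C \<phi> n"
proof -
  \<comment> \<open>Shrinking \<open>W\<close> makes the Birkhoff averages of \<open>\<phi>\<close>
    along typical words nearly equal to its integral.\<close>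
  define W' where "W' = W \<inter> {\<nu> \<in> pmeas. integral\<^sup>L \<nu> \<phi> \<in> ball (integral\<^sup>L \<mu> \<phi>) (e / 2)}"
  have "openin (weak_topology (string_topology G)) W'"
    unfolding W'_def using W(1) openin_continuous_map_preimage[OF continuous_map_integral[OF \<phi>], of "ball (integral\<^sup>L \<mu> \<phi>) (e / 2)"]
    by (intro openin_Int) (auto simp: topspace_weak_topology)
  moreover have "\<mu> \<in> W'" using W(2) e invariantD(1)[OF \<mu>] by (simp add: W'_def)
  ultimately obtain Q d where Q: "finite Q" "0 < d"
    "\<And>\<nu>. \<nu> \<in> pmeas \<Longrightarrow> (\<And>w. w \<in> Q \<Longrightarrow> \<bar>measure \<nu> (cyl w) - measure \<mu> (cyl w)\<bar> < d) \<Longrightarrow> \<nu> \<in> W'"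
    using weak_neighbourhood[OF _ invariantD(1)[OF \<mu>]] by blast
  obtain n\<^sub>0 where n0: "\<And>n. n\<^sub>0 \<le> n \<Longrightarrow> \<exists>S\<subseteq>words G n. exp (real n * (shift_entropy \<mu> - e / 2)) \<le> real (card S) \<and>
    (\<forall>w\<in>S. \<forall>u\<in>cyl w. \<forall>q\<in>Q. \<bar>measure (empirical_measure G n u) (cyl q) - measure \<mu> (cyl q)\<bar> < d)"
    using many_typical_words[OF \<mu> Q(1,2), of "e / 2"] e by auto
  have "exp (real n * (shift_entropy \<mu> + integral\<^sup>L \<mu> \<phi> - e)) \<le> multifractal_sum G U C \<phi> n"
    if "n\<^sub>0 \<le> n" and n: "0 < n" for n
  proof -
    obtain S where S: "S \<subseteq> words G n" "exp (real n * (shift_entropy \<mu> - e / 2)) \<le> real (card S)"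
      "\<And>w u q. w \<in> S \<Longrightarrow> u \<in> cyl w \<Longrightarrow> q \<in> Q \<Longrightarrow> \<bar>measure (empirical_measure G n u) (cyl q) - measure \<mu> (cyl q)\<bar> < d"
      using n0[OF \<open>n\<^sub>0 \<le> n\<close>] by blast
    have emp: "empirical_measure G n u \<in> W'" if "w \<in> S" "u \<in> cyl w" for w u
    proof (rule Q(3))
      show "empirical_measure G n u \<in> pmeas"
        using that(2) n by (intro empirical_measure_in_prob_measures) (auto simp: cylinder_def)
    qed (rule S(3)[OF that])
    let ?A = "{es \<in> words G n. (\<lambda>u. U (empirical_measure G n u)) ` cyl es \<subseteq> C}"
    let ?s = "\<lambda>es. SUP u\<in>cyl es. exp (\<Sum>k<n. \<phi> ((shift_map ^^ k) u))"
    have sub: "S \<subseteq> ?A" using S(1) emp WC by (fastforce simp: W'_def)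
    have low: "exp (real n * (integral\<^sup>L \<mu> \<phi> - e / 2)) \<le> ?s w" if w: "w \<in> S" for w
    proof -
      have x: "ext w \<in> cyl w" using ext_in S(1) w by blast
      then have xs: "ext w \<in> strings G" by (simp add: cylinder_def)
      have "integral\<^sup>L \<mu> \<phi> - e / 2 < integral\<^sup>L (empirical_measure G n (ext w)) \<phi>"
      proof -
        have "\<bar>integral\<^sup>L \<mu> \<phi> - integral\<^sup>L (empirical_measure G n (ext w)) \<phi>\<bar> < e / 2"
          using emp[OF w x] by (simp add: W'_def dist_real_def)
        then show ?thesis by linarith
      qed
      then have "real n * (integral\<^sup>L \<mu> \<phi> - e / 2) \<le> (\<Sum>k<n. \<phi> ((shift_map ^^ k) (ext w)))"
        using n by (simp add: integral_empirical_measure[OF xs n \<phi>] field_simps)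
      then have "exp (real n * (integral\<^sup>L \<mu> \<phi> - e / 2)) \<le> exp (\<Sum>k<n. \<phi> ((shift_map ^^ k) (ext w)))" by simp
      also have "\<dots> \<le> ?s w" by (rule cSUP_upper[OF x bdd_above_exp_sum[OF \<phi>]])
      finally show ?thesis .
    qed
    have nonneg: "0 \<le> ?s w" if "w \<in> words G n" for w
    proof -
      have "0 \<le> exp (\<Sum>k<n. \<phi> ((shift_map ^^ k) (ext w)))" by simp
      also have "\<dots> \<le> ?s w" by (rule cSUP_upper[OF ext_in[OF that] bdd_above_exp_sum[OF \<phi>]])
      finally show ?thesis .
    qed
    have "exp (real n * (shift_entropy \<mu> + integral\<^sup>L \<mu> \<phi> - e)) =
      exp (real n * (shift_entropy \<mu> - e / 2)) * exp (real n * (integral\<^sup>L \<mu> \<phi> - e / 2))"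
      by (simp add: algebra_simps flip: exp_add)
    also have "\<dots> \<le> real (card S) * exp (real n * (integral\<^sup>L \<mu> \<phi> - e / 2))"
      using S(2) by (intro mult_right_mono) auto
    also have "\<dots> = (\<Sum>w\<in>S. exp (real n * (integral\<^sup>L \<mu> \<phi> - e / 2)))" by simp
    also have "\<dots> \<le> (\<Sum>w\<in>S. ?s w)" using low by (intro sum_mono)
    also have "\<dots> \<le> (\<Sum>w\<in>?A. ?s w)" using sub nonneg by (intro sum_mono2) auto
    finally show ?thesis by (simp add: multifractal_sum_def)
  qed
  then show ?thesis unfolding eventually_sequentially by (intro exI[of _ "max n\<^sub>0 1"]) auto
qed

section \<open>Upper bound by Misiurewicz's construction\<close>

lemma word_entropy_le:
  assumes "\<nu> \<in> pmeas"
  shows "word_entropy \<nu> n \<le> real n * ln (real (card (arcs G)))"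
proof -
  interpret prob_space \<nu> using assms by (rule prob_measures_prob_space)
  have "word_entropy \<nu> n \<le> ln (real (card (words G n)))"
    unfolding word_entropy_eq(1)[OF assms]
    by (rule ent_le_card[OF simple_function_prefix[OF assms]])
      (auto simp: prob_measures_space[OF assms] prefix_in_words)
  also have "\<dots> \<le> ln (real (card (arcs G) ^ n))"
  proof -
    have "words G n \<noteq> {}" using strings_ne prefix_in_words by blast
    then have "0 < card (words G n)" by (simp add: card_gt_0_iff)
    then show ?thesis using card_words_le[of G n] by (intro ln_mono) auto
  qed
  also have "\<dots> = real n * ln (real (card (arcs G)))"
    using arcs_ne by (simp add: ln_realpow card_gt_0_iff)
  finally show ?thesis .
qed

lemma return_pmeas: "u \<in> strings G \<Longrightarrow> return (borel_algebra (string_topology G)) u \<in> pmeas"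
  by (intro return_in_prob_measures) simp

text \<open>An atomic measure \<open>\<sigma>\<close> with Gibbs weights on one point per admissible
  cylinder satisfies the exact identity entropy plus energy equals \<open>ln A\<close>; its average
  \<open>\<nu>\<close> over \<open>n\<close> shifts is nearly invariant and lies in
  \<open>{U \<in> C}\<close>. All errors are explicit and vanish as \<open>n\<close> grows with
  \<open>q\<close> fixed: \<open>ln 2 / n\<close> from the choice of points, \<open>1 / n\<close>
  from invariance, and the boundary term of the window inequality.\<close>

lemma misiurewicz_step:
  assumes \<phi>: "continuous_map (string_topology G) euclideanreal \<phi>"
    and mix: "\<And>(I :: 'e list set) p \<nu>. finite I \<Longrightarrow> (\<And>i. i \<in> I \<Longrightarrow> \<nu> i \<in> pmeas) \<Longrightarrow> (\<And>i. i \<in> I \<Longrightarrow> U (\<nu> i) \<in> C)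
      \<Longrightarrow> (\<And>i. i \<in> I \<Longrightarrow> 0 \<le> p i) \<Longrightarrow> sum p I = 1 \<Longrightarrow> U (mixture (borel_algebra (string_topology G)) I p \<nu>) \<in> C"
    and n: "0 < n" and c: "exp (real n * c) < multifractal_sum G U C \<phi> n"
  shows "\<exists>\<nu>\<in>pmeas. U \<nu> \<in> C \<and>
    (\<forall>D\<in>cylinder_sets G. \<bar>measure \<nu> (shift_map -` D \<inter> strings G) - measure \<nu> D\<bar> \<le> 1 / real n) \<and>
    (\<forall>q. real q * (c - ln 2 / real n) \<le> word_entropy \<nu> q + real q * integral\<^sup>L \<nu> \<phi>
       + real q * (real q * ln (real (card (arcs G)))) / real n)"
proof -
  let ?B = "borel_algebra (string_topology G)"
  let ?S = "\<lambda>u. \<Sum>k<n. \<phi> ((shift_map ^^ k) u)"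
  define I where "I = {es \<in> words G n. (\<lambda>u. U (empirical_measure G n u)) ` cyl es \<subseteq> C}"
  have I: "finite I" "I \<subseteq> words G n" by (auto simp: I_def)
  \<comment> \<open>A point reaching half of the supremum costs a factor 2 in the sum, hence
    \<open>ln 2\<close>.\<close>
  have "\<exists>u\<in>cyl w. (SUP u\<in>cyl w. exp (?S u)) \<le> 2 * exp (?S u)" if "w \<in> words G n" for w
  proof -
    have ne: "cyl w \<noteq> {}" using that by (rule cylinder_ne)
    have "0 < exp (?S (ext w))" by simp
    also have "\<dots> \<le> (SUP u\<in>cyl w. exp (?S u))"
      by (rule cSUP_upper[OF ext_in[OF that] bdd_above_exp_sum[OF \<phi>]])
    finally have "(SUP u\<in>cyl w. exp (?S u)) / 2 < (SUP u\<in>cyl w. exp (?S u))" by simp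
    then obtain u where "u \<in> cyl w" "(SUP u\<in>cyl w. exp (?S u)) / 2 < exp (?S u)"
      using less_cSUP_iff[OF ne bdd_above_exp_sum[OF \<phi>]] by auto
    then show ?thesis by (intro bexI[of _ u]) auto
  qed
  then obtain x where x: "\<And>w. w \<in> words G n \<Longrightarrow> x w \<in> cyl w"
    "\<And>w. w \<in> words G n \<Longrightarrow> (SUP u\<in>cyl w. exp (?S u)) \<le> 2 * exp (?S (x w))"
    by metis
  have xs: "x w \<in> strings G" if "w \<in> I" for w using x(1)[of w] that I(2) by (auto simp: cylinder_def)
  define A where "A = (\<Sum>w\<in>I. exp (?S (x w)))"
  have "multifractal_sum G U C \<phi> n \<le> (\<Sum>w\<in>I. 2 * exp (?S (x w)))"
    unfolding multifractal_sum_def I_def using x(2) by (intro sum_mono) auto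
  then have "exp (real n * c) < 2 * A" using c by (simp add: A_def sum_distrib_left)
  then have A0: "0 < A" and A: "exp (real n * c) / 2 < A" using exp_gt_zero[of "real n * c"] by linarith+
  have "ln (exp (real n * c) / 2) < ln A" using A A0 by (subst ln_less_cancel_iff) auto
  then have lnA: "real n * c - ln 2 \<le> ln A" by (simp add: ln_div)
  define p where "p = (\<lambda>w. exp (?S (x w)) / A)"
  have p: "\<And>w. w \<in> I \<Longrightarrow> 0 \<le> p w" "(\<Sum>w\<in>I. p w) = 1"
    using A0 by (auto simp: p_def A_def simp flip: sum_divide_distrib)
  \<comment> \<open>The point masses sit in distinct \<open>n\<close>-cylinders, so the
    probabilities of the \<open>n\<close>-words are exactly the weights \<open>p\<close>.\<close>
  define \<sigma> where "\<sigma> = mixture ?B I p (\<lambda>w. return ?B (x w))"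
  have \<sigma>: "\<sigma> \<in> pmeas" unfolding \<sigma>_def using p xs by (intro mixture_in_prob_measures return_pmeas)
  interpret \<sigma>: prob_space \<sigma> using \<sigma> by (rule prob_measures_prob_space)
  have m\<sigma>: "measure \<sigma> D = (\<Sum>w\<in>I. p w * indicator D (x w))" if "D \<in> sets ?B" for D
    unfolding \<sigma>_def using p xs that
    by (subst measure_mixture_prob_measures) (auto simp: measure_return return_pmeas)
  define \<nu> where "\<nu> = mixture ?B I p (\<lambda>w. empirical_measure G n (x w))"
  have emp: "empirical_measure G n (x w) \<in> pmeas" if "w \<in> I" for w
    using xs[OF that] n by (rule empirical_measure_in_prob_measures)
  have \<nu>: "\<nu> \<in> pmeas" unfolding \<nu>_def using p emp by (intro mixture_in_prob_measures)
  have m\<nu>: "measure \<nu> D = (\<Sum>w\<in>I. p w * ((\<Sum>k<n. indicator D ((shift_map ^^ k) (x w))) / real n))"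
    if "D \<in> sets ?B" for D
    unfolding \<nu>_def using p emp xs that
    by (subst measure_mixture_prob_measures) (auto simp: measure_empirical_measure intro!: sum.cong)
  have U: "U \<nu> \<in> C"
    unfolding \<nu>_def
  proof (rule mix[OF I(1) emp])
    show "U (empirical_measure G n (x w)) \<in> C" if "w \<in> I" for w
      using that x(1)[of w] I(2) by (auto simp: I_def)
  qed (use p in auto)
  have inv: "\<bar>measure \<nu> (shift_map -` D \<inter> strings G) - measure \<nu> D\<bar> \<le> 1 / real n"
    if D: "D \<in> cylinder_sets G" for D
  proof -
    \<comment> \<open>Shifting an orbit segment by one step exchanges only its end points, so the
      visit counts differ by at most 1.\<close>
    have "measure \<nu> (shift_map -` D \<inter> strings G) - measure \<nu> D =
      (\<Sum>w\<in>I. p w * ((indicator D ((shift_map ^^ n) (x w)) - indicator D (x w)) / real n))"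
    proof -
      have "(\<Sum>k<n. indicator (shift_map -` D \<inter> strings G) ((shift_map ^^ k) u)) -
          (\<Sum>k<n. indicator D ((shift_map ^^ k) u)) = (indicator D ((shift_map ^^ n) u) - indicator D u :: real)"
        if u: "u \<in> strings G" for u
      proof -
        have "(\<Sum>k<n. indicator (shift_map -` D \<inter> strings G) ((shift_map ^^ k) u) :: real) =
          (\<Sum>k<n. indicator D ((shift_map ^^ Suc k) u))"
          using shift_map_funpow_strings[OF u] by (intro sum.cong) (auto simp: indicator_def)
        then show ?thesis
          using sum_lessThan_telescope[of "\<lambda>k. indicator D ((shift_map ^^ k) u) :: real" n]
          by (simp add: sum_subtractf)
      qed
      then have *: "(\<Sum>k<n. indicator (shift_map -` D \<inter> strings G) ((shift_map ^^ k) (x w))) / real n -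
          (\<Sum>k<n. indicator D ((shift_map ^^ k) (x w))) / real n
          = (indicator D ((shift_map ^^ n) (x w)) - indicator D (x w)) / real n" if "w \<in> I" for w
        using xs[OF that] by (simp only: diff_divide_distrib[symmetric])
      show ?thesis
        unfolding m\<nu>[OF cylinder_sets_in_borel[OF D]] m\<nu>[OF cylinder_sets_in_borel[OF cylinder_sets_vimage_shift[OF D]]]
          sum_subtractf[symmetric] right_diff_distrib[symmetric]
        by (intro sum.cong refl) (simp only: *)
    qed
    also have "\<bar>\<dots>\<bar> \<le> (\<Sum>w\<in>I. p w * (1 / real n))"
    proof (rule order_trans[OF sum_abs sum_mono])
      fix w assume w: "w \<in> I"
      have "\<bar>(indicator D ((shift_map ^^ n) (x w)) - indicator D (x w)) / real n\<bar> \<le> 1 / real n"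
        by (auto simp: indicator_def)
      then show "\<bar>p w * ((indicator D ((shift_map ^^ n) (x w)) - indicator D (x w)) / real n)\<bar> \<le> p w * (1 / real n)"
        unfolding abs_mult using p(1)[OF w] by (intro mult_mono) auto
    qed
    also have "\<dots> = 1 / real n" unfolding sum_distrib_right[symmetric] p(2) by simp
    finally show ?thesis .
  qed
  have int: "real n * integral\<^sup>L \<nu> \<phi> = (\<Sum>w\<in>I. p w * ?S (x w))"
  proof -
    have "integral\<^sup>L \<nu> \<phi> = (\<Sum>w\<in>I. p w * integral\<^sup>L (empirical_measure G n (x w)) \<phi>)"
      unfolding \<nu>_def by (rule integral_mixture[OF emp p \<phi>])
    also have "\<dots> = (\<Sum>w\<in>I. p w * (?S (x w) / real n))"
      by (intro sum.cong refl) (simp only: integral_empirical_measure[OF xs n \<phi>])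
    also have "\<dots> = (\<Sum>w\<in>I. p w * ?S (x w)) / real n"
      unfolding sum_divide_distrib[of _ I] by simp
    finally show ?thesis using n by simp
  qed
  \<comment> \<open>As \<open>ln (p w)\<close> is the Birkhoff sum minus \<open>ln A\<close>, the
    entropy of the Gibbs weights is \<open>ln A\<close> minus the mean Birkhoff sum.\<close>
  have H\<sigma>: "word_entropy \<sigma> n = ln A - real n * integral\<^sup>L \<nu> \<phi>"
  proof -
    have \<sigma>w: "measure \<sigma> (cyl w) = (if w \<in> I then p w else 0)" if w: "w \<in> words G n" for w
    proof -
      have "measure \<sigma> (cyl w) = (\<Sum>w'\<in>I. p w' * indicator (cyl w) (x w'))"
        by (rule m\<sigma>[OF cylinder_in_borel])
      also have "\<dots> = (\<Sum>w'\<in>I. if w' = w then p w' else 0)"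
      proof (rule sum.cong[OF refl])
        fix w' assume "w' \<in> I"
        then have w': "w' \<in> words G n" using I by blast
        then have "x w' \<in> cyl w \<longleftrightarrow> w' = w"
          using x(1)[OF w'] w by (auto simp: mem_cylinder_words)
        then show "p w' * indicator (cyl w) (x w') = (if w' = w then p w' else 0)"
          by (cases "w' = w") (simp_all add: indicator_def)
      qed
      finally show ?thesis using I(1) by simp
    qed
    have "word_entropy \<sigma> n = - (\<Sum>w\<in>words G n. if w \<in> I then p w * ln (p w) else 0)"
      unfolding word_entropy_def by (intro arg_cong[where f=uminus] sum.cong) (auto simp: \<sigma>w)
    also have "\<dots> = - (\<Sum>w\<in>I. p w * ln (p w))"
      using I by (simp add: sum.inter_restrict[symmetric] Int_absorb1)
    also have "\<dots> = - (\<Sum>w\<in>I. p w * (?S (x w) - ln A))"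
      using A0 by (simp add: p_def ln_div)
    also have "\<dots> = ln A - (\<Sum>w\<in>I. p w * ?S (x w))"
      by (simp add: right_diff_distrib sum_subtractf p(2) flip: sum_distrib_right)
    finally show ?thesis by (simp add: int)
  qed
  have Tk: "shift_map ^^ k \<in> measurable \<sigma> \<sigma>" for k
    by (rule measurable_compose_n[OF shift_measurable[OF \<sigma> \<sigma>]])
  \<comment> \<open>\<open>\<nu>\<close> is the average of these images of \<open>\<sigma>\<close>.
    The entropy of the window at \<open>k\<close> under \<open>\<sigma>\<close> is the word entropy
    of \<open>\<tau> k\<close>, so concavity bounds the sum over windows by
    \<open>n * word_entropy \<nu> q\<close>.\<close>
  define \<tau> where "\<tau> = (\<lambda>k. distr \<sigma> \<sigma> (shift_map ^^ k))"
  have \<tau>: "\<tau> k \<in> pmeas" for k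
    using \<sigma>.prob_space_distr[OF Tk] by (simp add: \<tau>_def prob_measures_iff prob_measures_sets[OF \<sigma>])
  have ent: "(\<Sum>k<n. ent \<sigma> (block shift_map (\<lambda>u. u 0) k q)) \<le> real n * word_entropy \<nu> q" for q
  proof -
    have "\<nu> = mixture ?B {..<n} (\<lambda>_. 1 / real n) \<tau>"
    proof (rule prob_measure_eqI[OF \<nu>])
      show "mixture ?B {..<n} (\<lambda>_. 1 / real n) \<tau> \<in> pmeas"
        using n \<tau> by (intro mixture_in_prob_measures) auto
      fix D assume D: "D \<in> cylinder_sets G"
      have "measure (\<tau> k) D = (\<Sum>w\<in>I. p w * indicator D ((shift_map ^^ k) (x w)))" for k
      proof -
        have DS: "D \<in> sets \<sigma>" by (simp add: prob_measures_sets[OF \<sigma>] cylinder_sets_in_borel[OF D])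
        have "measure (\<tau> k) D = measure \<sigma> ((shift_map ^^ k) -` D \<inter> space \<sigma>)"
          unfolding \<tau>_def by (rule measure_distr[OF Tk DS])
        also have "\<dots> = (\<Sum>w\<in>I. p w * indicator ((shift_map ^^ k) -` D \<inter> space \<sigma>) (x w))"
          using measurable_sets[OF Tk DS] by (intro m\<sigma>) (simp add: prob_measures_sets[OF \<sigma>])
        also have "\<dots> = (\<Sum>w\<in>I. p w * indicator D ((shift_map ^^ k) (x w)))"
          using xs by (intro sum.cong) (auto simp: indicator_def prob_measures_space[OF \<sigma>])
        finally show ?thesis .
      qed
      then have "measure (mixture ?B {..<n} (\<lambda>_. 1 / real n) \<tau>) D =
          (\<Sum>k<n. \<Sum>w\<in>I. 1 / real n * (p w * indicator D ((shift_map ^^ k) (x w))))"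
        using \<tau> by (subst measure_mixture_prob_measures)
          (auto simp: cylinder_sets_in_borel[OF D] sum_divide_distrib)
      also have "\<dots> = measure \<nu> D"
        unfolding m\<nu>[OF cylinder_sets_in_borel[OF D]]
        by (subst sum.swap) (simp add: sum_distrib_left sum_divide_distrib)
      finally show "measure \<nu> D = measure (mixture ?B {..<n} (\<lambda>_. 1 / real n) \<tau>) D" by simp
    qed
    then have "(\<Sum>k<n. 1 / real n * word_entropy (\<tau> k) q) \<le> word_entropy \<nu> q"
      using word_entropy_mixture[of "{..<n}" \<tau> "\<lambda>_. 1 / real n" q] \<tau> n by simp
    moreover have "word_entropy (\<tau> k) q = ent \<sigma> (block shift_map (\<lambda>u. u 0) k q)" for k
    proof -
      have "word_entropy (\<tau> k) q = ent (\<tau> k) (\<lambda>u. map u [0..<q])" by (rule word_entropy_eq(1)[OF \<tau>])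
      also have "\<dots> = ent \<sigma> (\<lambda>u. map ((shift_map ^^ k) u) [0..<q])"
        unfolding \<tau>_def by (rule ent_distr[OF Tk simple_function_prefix[OF \<sigma>]])
      also have "\<dots> = ent \<sigma> (block shift_map (\<lambda>u. u 0) k q)"
        by (rule ent_cong) (auto simp: block_def shift_map_funpow intro!: nth_equalityI simp: add.commute)
      finally show ?thesis .
    qed
    ultimately show ?thesis using n by (simp add: field_simps flip: sum_divide_distrib)
  qed
  have "real q * (c - ln 2 / real n) \<le> word_entropy \<nu> q + real q * integral\<^sup>L \<nu> \<phi>
       + real q * (real q * ln (real (card (arcs G)))) / real n" for q
  proof -
    have "real q * word_entropy \<sigma> n \<le> (\<Sum>k<n. ent \<sigma> (block shift_map (\<lambda>u. u 0) k q)) + real q * word_entropy \<sigma> q"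
      unfolding word_entropy_eq(2)[OF \<sigma>]
      by (rule \<sigma>.ent_block_window[OF shift_measurable[OF \<sigma> \<sigma>] simple_function_letter[OF \<sigma>]])
    also have "\<dots> \<le> real n * word_entropy \<nu> q + real q * (real q * ln (real (card (arcs G))))"
      using ent word_entropy_le[OF \<sigma>] by (intro add_mono mult_left_mono) auto
    finally have "real q * (real n * c - ln 2 - real n * integral\<^sup>L \<nu> \<phi>) \<le>
        real n * word_entropy \<nu> q + real q * (real q * ln (real (card (arcs G))))"
      using mult_left_mono[OF lnA, of "real q"] unfolding H\<sigma> by (simp add: right_diff_distrib)
    then have "real q * (real n * c - ln 2 - real n * integral\<^sup>L \<nu> \<phi>) / real n \<le>
        (real n * word_entropy \<nu> q + real q * (real q * ln (real (card (arcs G))))) / real n"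
      by (intro divide_right_mono) auto
    moreover have "real q * (real n * c - ln 2 - real n * integral\<^sup>L \<nu> \<phi>) / real n
      = real q * (c - ln 2 / real n) - real q * integral\<^sup>L \<nu> \<phi>"
      using n by (simp add: field_simps)
    moreover have "(real n * word_entropy \<nu> q + real q * (real q * ln (real (card (arcs G))))) / real n =
      word_entropy \<nu> q + real q * (real q * ln (real (card (arcs G)))) / real n"
      using n by (simp add: add_divide_distrib)
    ultimately show ?thesis by linarith
  qed
  with \<nu> U inv show ?thesis by blast
qed

text \<open>Convergence on cylinders is weak convergence, since a weak neighbourhood contains one
  given by finitely many cylinders.\<close>

lemma weak_limit_eventually:
  assumes \<mu>: "\<mu> \<in> pmeas" and \<nu>: "\<And>n. \<nu> n \<in> pmeas"
    and lim: "\<And>D. D \<in> cylinder_sets G \<Longrightarrow> (\<lambda>n. measure (\<nu> n) D) \<longlonglongrightarrow> measure \<mu> D"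
    and W: "openin (weak_topology (string_topology G)) W" "\<mu> \<in> W"
  shows "\<forall>\<^sub>F n in sequentially. \<nu> n \<in> W"
proof -
  obtain Q d where Q: "finite Q" "0 < d"
    "\<And>\<nu>. \<nu> \<in> pmeas \<Longrightarrow> (\<And>w. w \<in> Q \<Longrightarrow> \<bar>measure \<nu> (cyl w) - measure \<mu> (cyl w)\<bar> < d) \<Longrightarrow> \<nu> \<in> W"
    using weak_neighbourhood[OF W(1) \<mu> W(2)] by blast
  have "\<forall>\<^sub>F n in sequentially. \<forall>w\<in>Q. dist (measure (\<nu> n) (cyl w)) (measure \<mu> (cyl w)) < d"
    using Q(1,2) tendstoD[OF lim[OF cylinder_in_cylinder_sets]] by (simp add: eventually_ball_finite)
  then show ?thesis by eventually_elim (auto simp: dist_real_def intro: Q(3)[OF \<nu>])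
qed

text \<open>A subsequential limit of the measures from \<open>misiurewicz_step\<close>. The
  invariance defect tends to zero, and the complement of \<open>{U \<in> C}\<close> is weakly open,
  so the limit cannot leave \<open>C\<close>.\<close>

lemma exists_equilibrium:
  assumes \<phi>: "continuous_map (string_topology G) euclideanreal \<phi>"
    and mix: "\<And>(I :: 'e list set) p \<nu>. finite I \<Longrightarrow> (\<And>i. i \<in> I \<Longrightarrow> \<nu> i \<in> pmeas) \<Longrightarrow> (\<And>i. i \<in> I \<Longrightarrow> U (\<nu> i) \<in> C)
      \<Longrightarrow> (\<And>i. i \<in> I \<Longrightarrow> 0 \<le> p i) \<Longrightarrow> sum p I = 1 \<Longrightarrow> U (mixture (borel_algebra (string_topology G)) I p \<nu>) \<in> C"
    and closed: "openin (weak_topology (string_topology G)) {\<nu> \<in> pmeas. U \<nu> \<notin> C}"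
    and freq: "\<exists>\<^sub>F n in sequentially. exp (real n * c) < multifractal_sum G U C \<phi> n"
  shows "\<exists>\<mu>\<in>imeas. U \<mu> \<in> C \<and> c \<le> shift_entropy \<mu> + integral\<^sup>L \<mu> \<phi>"
proof -
  have "\<exists>n>m. exp (real n * c) < multifractal_sum G U C \<phi> n" for m
    using freq unfolding frequently_sequentially by (meson Suc_le_lessD)
  then have "\<exists>n>m. 0 < n \<and> exp (real n * c) < multifractal_sum G U C \<phi> n" for m by (metis gr_zeroI not_less_zero)
  then obtain s where s: "\<And>m. m < s m" "\<And>m. 0 < s m" "\<And>m. exp (real (s m) * c) < multifractal_sum G U C \<phi> (s m)"
    by metis
  have "\<forall>m. \<exists>\<nu>\<in>pmeas. U \<nu> \<in> C \<and>
    (\<forall>D\<in>cylinder_sets G. \<bar>measure \<nu> (shift_map -` D \<inter> strings G) - measure \<nu> D\<bar> \<le> 1 / real (s m)) \<and>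
    (\<forall>q. real q * (c - ln 2 / real (s m)) \<le> word_entropy \<nu> q + real q * integral\<^sup>L \<nu> \<phi>
       + real q * (real q * ln (real (card (arcs G)))) / real (s m))"
    using misiurewicz_step[where U=U and C=C, OF \<phi> mix s(2,3)] by blast
  then obtain \<nu> where \<nu>: "\<And>m. \<nu> m \<in> pmeas" "\<And>m. U (\<nu> m) \<in> C"
    "\<And>m D. D \<in> cylinder_sets G \<Longrightarrow> \<bar>measure (\<nu> m) (shift_map -` D \<inter> strings G) - measure (\<nu> m) D\<bar> \<le> 1 / real (s m)"
    "\<And>m q. real q * (c - ln 2 / real (s m)) \<le> word_entropy (\<nu> m) q + real q * integral\<^sup>L (\<nu> m) \<phi>
       + real q * (real q * ln (real (card (arcs G)))) / real (s m)"
    by metis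
  obtain r \<mu> where r: "strict_mono (r :: nat \<Rightarrow> nat)" and \<mu>: "\<mu> \<in> pmeas"
    and lim: "\<And>D. D \<in> cylinder_sets G \<Longrightarrow> (\<lambda>n. measure (\<nu> (r n)) D) \<longlonglongrightarrow> measure \<mu> D"
    using prob_measures_seq_compact[of \<nu>, OF \<nu>(1)] by blast
  have sr: "filterlim (\<lambda>n. real (s (r n))) at_top sequentially"
  proof (rule filterlim_at_top_mono[OF filterlim_real_sequentially])
    show "\<forall>\<^sub>F n in sequentially. real n \<le> real (s (r n))"
      using s(1) seq_suble[OF r] by (intro always_eventually allI) (meson le_trans less_imp_le of_nat_mono)
  qed
  have s0: "(\<lambda>n. a / real (s (r n))) \<longlonglongrightarrow> 0" for a
    by (intro tendsto_divide_0[OF tendsto_const] filterlim_at_top_imp_at_infinity sr)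
  have "\<mu> \<in> imeas"
  proof (rule invariantI[OF \<mu>])
    fix D assume D: "D \<in> cylinder_sets G"
    have "(\<lambda>n. measure (\<nu> (r n)) (shift_map -` D \<inter> strings G) - measure (\<nu> (r n)) D)
        \<longlonglongrightarrow> measure \<mu> (shift_map -` D \<inter> strings G) - measure \<mu> D"
      by (intro tendsto_diff lim D cylinder_sets_vimage_shift)
    moreover have "(\<lambda>n. measure (\<nu> (r n)) (shift_map -` D \<inter> strings G) - measure (\<nu> (r n)) D) \<longlonglongrightarrow> 0"
      by (rule Lim_null_comparison[OF _ s0[of 1]]) (use \<nu>(3)[OF D] in simp)
    ultimately show "measure \<mu> (shift_map -` D \<inter> strings G) = measure \<mu> D"
      using LIMSEQ_unique by fastforce
  qed
  moreover have "U \<mu> \<in> C"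
  proof (rule ccontr)
    assume "U \<mu> \<notin> C"
    then have "\<forall>\<^sub>F n in sequentially. \<nu> (r n) \<in> {\<nu> \<in> pmeas. U \<nu> \<notin> C}"
      using \<mu> by (intro weak_limit_eventually[OF \<mu> \<nu>(1) lim closed]) auto
    then show False using \<nu>(2) by (auto simp: eventually_sequentially)
  qed
  moreover have "c \<le> shift_entropy \<mu> + integral\<^sup>L \<mu> \<phi>"
  proof -
    have int: "(\<lambda>n. integral\<^sup>L (\<nu> (r n)) \<phi>) \<longlonglongrightarrow> integral\<^sup>L \<mu> \<phi>"
    proof (rule topological_tendstoI)
      fix V :: "real set" assume V: "open V" "integral\<^sup>L \<mu> \<phi> \<in> V"
      have "\<forall>\<^sub>F n in sequentially. \<nu> (r n) \<in> {\<nu> \<in> pmeas. integral\<^sup>L \<nu> \<phi> \<in> V}"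
        using \<mu> V openin_continuous_map_preimage[OF continuous_map_integral[OF \<phi>], of V]
        by (intro weak_limit_eventually[OF \<mu> \<nu>(1) lim]) (auto simp: topspace_weak_topology)
      then show "\<forall>\<^sub>F n in sequentially. integral\<^sup>L (\<nu> (r n)) \<phi> \<in> V" by eventually_elim simp
    qed
    have ent: "(\<lambda>n. word_entropy (\<nu> (r n)) q) \<longlonglongrightarrow> word_entropy \<mu> q" for q
      unfolding word_entropy_def
      by (intro tendsto_minus tendsto_sum tendsto_xlnx lim cylinder_in_cylinder_sets)
        (use prob_space.prob_le_1[OF prob_measures_prob_space[OF \<nu>(1)]] in auto)
    \<comment> \<open>Here \<open>q\<close> is fixed while \<open>n\<close> tends to infinity. Word
      entropies of fixed length are continuous, whereas the entropy of the shift is recovered only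
      afterwards, as \<open>q\<close> grows.\<close>
    have le: "real q * (c - 0) \<le> word_entropy \<mu> q + real q * integral\<^sup>L \<mu> \<phi> + 0" for q
    proof (rule LIMSEQ_le)
      show "(\<lambda>n. real q * (c - ln 2 / real (s (r n)))) \<longlonglongrightarrow> real q * (c - 0)"
        by (intro tendsto_intros s0)
      show "(\<lambda>n. word_entropy (\<nu> (r n)) q + real q * integral\<^sup>L (\<nu> (r n)) \<phi>
         + real q * (real q * ln (real (card (arcs G)))) / real (s (r n)))
         \<longlonglongrightarrow> word_entropy \<mu> q + real q * integral\<^sup>L \<mu> \<phi> + 0"
        by (intro tendsto_intros s0 ent int)
    qed (use \<nu>(4) in blast)
    have "(\<lambda>q. word_entropy \<mu> q / real q + integral\<^sup>L \<mu> \<phi>) \<longlonglongrightarrow> shift_entropy \<mu> + integral\<^sup>L \<mu> \<phi>"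
      by (intro tendsto_intros shift_entropy_tendsto \<open>\<mu> \<in> imeas\<close>)
    then show ?thesis
    proof (rule LIMSEQ_le_const, intro exI allI impI)
      fix q :: nat assume "1 \<le> q"
      then show "c \<le> word_entropy \<mu> q / real q + integral\<^sup>L \<mu> \<phi>"
        using le[of q] by (simp add: field_simps)
    qed
  qed
  ultimately show ?thesis by blast
qed

end

section \<open>The variational principle\<close>

text \<open>The image of \<open>interior C\<close> under the homothety with centre \<open>y\<close>
  and ratio \<open>t\<close> is open, lies in \<open>C\<close> by convexity, and contains the
  point.\<close>

lemma interior_convex_combination:
  fixes C :: "'x::real_normed_vector set"
  assumes "convex C" "x \<in> interior C" "y \<in> C" "0 < t" "t \<le> 1"
  shows "t *\<^sub>R x + (1 - t) *\<^sub>R y \<in> interior C"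
proof (rule interiorI)
  show "open ((\<lambda>z. (1 - t) *\<^sub>R y + t *\<^sub>R z) ` interior C)"
    using assms(4) by (intro open_affinity) auto
  show "t *\<^sub>R x + (1 - t) *\<^sub>R y \<in> (\<lambda>z. (1 - t) *\<^sub>R y + t *\<^sub>R z) ` interior C"
    using assms(2) by (auto simp: add.commute)
  show "(\<lambda>z. (1 - t) *\<^sub>R y + t *\<^sub>R z) ` interior C \<subseteq> C"
    using assms interior_subset[of C] by (auto intro!: convexD)
qed

text \<open>The root test, with \<open>root n n\<close> tending to 1. Since the limit
  \<open>p\<close> is finite, the sums are eventually positive, and \<open>elog\<close> is then the
  ordinary logarithm.\<close>

lemma multifractal_radius:
  fixes p :: real
  assumes lim: "(\<lambda>n. ereal (1 / real n) * elog (ereal (multifractal_sum G U C \<phi> n))) \<longlonglongrightarrow> ereal p"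
  shows "- elog (fps_conv_radius (dyn_zeta G U C \<phi>)) = ereal p"
proof -
  let ?Z = "multifractal_sum G U C \<phi>"
  have "\<forall>\<^sub>F n in sequentially. ereal (p - 1) < ereal (1 / real n) * elog (ereal (?Z n))"
    by (rule order_tendstoD(1)[OF lim]) simp
  then have pos: "\<forall>\<^sub>F n in sequentially. 0 < n \<and> 0 < ?Z n"
    using eventually_gt_at_top[of "0::nat"]
    by eventually_elim (auto simp: elog_def split: if_splits)
  have "(\<lambda>n. ereal (1 / real n * ln (?Z n))) \<longlonglongrightarrow> ereal p"
    by (rule Lim_transform_eventually[OF lim]) (use pos in eventually_elim, simp add: elog_def)
  then have lnZ: "(\<lambda>n. 1 / real n * ln (?Z n)) \<longlonglongrightarrow> p" by simp
  have "(\<lambda>n. exp (1 / real n * ln (?Z n)) / root n (real n)) \<longlonglongrightarrow> exp p / 1"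
    by (intro tendsto_intros lnZ LIMSEQ_root) simp
  moreover have "\<forall>\<^sub>F n in sequentially. exp (1 / real n * ln (?Z n)) / root n (real n) = root n (norm (fps_nth (dyn_zeta G U C \<phi>) n))"
    using pos
  proof eventually_elim
    case (elim n)
    then have n: "0 < n" and Z: "0 < ?Z n" by auto
    have "root n (?Z n) = exp (1 / real n * ln (?Z n))"
      using n Z by (simp add: root_powr_inverse powr_def)
    moreover have "norm (fps_nth (dyn_zeta G U C \<phi>) n) = ?Z n / real n"
      using Z unfolding dyn_zeta_def by (simp add: norm_divide)
    ultimately show ?case by (simp add: real_root_divide)
  qed
  ultimately have "(\<lambda>n. root n (norm (fps_nth (dyn_zeta G U C \<phi>) n))) \<longlonglongrightarrow> exp p"
    using Lim_transform_eventually by fastforce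
  then have "limsup (\<lambda>n. ereal (root n (norm (fps_nth (dyn_zeta G U C \<phi>) n)))) = ereal (exp p)"
    by (intro lim_imp_Limsup) simp_all
  then have "fps_conv_radius (dyn_zeta G U C \<phi>) = ereal (exp (- p))"
    by (simp add: fps_conv_radius_def conv_radius_def exp_minus)
  then show ?thesis by (simp add: elog_def)
qed

section \<open>Ratios of affine maps and the two suprema\<close>

context string_graph begin

context
  fixes \<Gamma> :: "(nat \<Rightarrow> 'e) measure \<Rightarrow> 'x::real_normed_vector" and \<Delta> :: "(nat \<Rightarrow> 'e) measure \<Rightarrow> real"
    and U :: "(nat \<Rightarrow> 'e) measure \<Rightarrow> 'x"
  assumes \<Gamma>: "continuous_map (weak_topology (string_topology G)) euclidean \<Gamma>"
      "affine_on_measures (string_topology G) \<Gamma>"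
    and \<Delta>: "continuous_map (weak_topology (string_topology G)) euclideanreal \<Delta>"
      "affine_on_measures (string_topology G) \<Delta>"
      "\<And>\<mu>. \<mu> \<in> pmeas \<Longrightarrow> \<Delta> \<mu> \<noteq> 0"
    and U: "\<And>\<mu>. \<mu> \<in> pmeas \<Longrightarrow> U \<mu> = \<Gamma> \<mu> /\<^sub>R \<Delta> \<mu>"
begin

text \<open>Division is continuous on the open set of pairs with nonzero second component, which
  contains every \<open>(\<Gamma> \<mu>, \<Delta> \<mu>)\<close>.\<close>

lemma openin_ratio:
  assumes V: "open V"
  shows "openin (weak_topology (string_topology G)) {\<mu> \<in> pmeas. U \<mu> \<in> V}"
proof -
  let ?D = "{z :: 'x \<times> real. snd z \<noteq> 0}"
  have D: "open ?D" by (intro open_Collect_neq continuous_intros)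
  have "continuous_on ?D (\<lambda>z. fst z /\<^sub>R snd z)" by (intro continuous_intros) auto
  then have "open (?D \<inter> (\<lambda>z. fst z /\<^sub>R snd z) -` V)" using D V by (rule continuous_open_preimage)
  moreover have "continuous_map (weak_topology (string_topology G)) (euclidean :: ('x \<times> real) topology) (\<lambda>\<mu>. (\<Gamma> \<mu>, \<Delta> \<mu>))"
    using \<Gamma>(1) \<Delta>(1) by (simp add: continuous_map_paired flip: prod_topology_euclidean)
  ultimately have "openin (weak_topology (string_topology G))
      {\<mu> \<in> topspace (weak_topology (string_topology G)). (\<Gamma> \<mu>, \<Delta> \<mu>) \<in> ?D \<inter> (\<lambda>z. fst z /\<^sub>R snd z) -` V}"
    by (intro openin_continuous_map_preimage) auto
  also have "{\<mu> \<in> topspace (weak_topology (string_topology G)). (\<Gamma> \<mu>, \<Delta> \<mu>) \<in> ?D \<inter> (\<lambda>z. fst z /\<^sub>R snd z) -` V}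
      = {\<mu> \<in> pmeas. U \<mu> \<in> V}"
    using \<Delta>(3) U by (auto simp: topspace_weak_topology)
  finally show ?thesis .
qed

lemma measure_mix_pmeas:
  assumes "\<mu> \<in> pmeas" "\<nu> \<in> pmeas" "p \<in> {0..1}"
  shows "measure_mix p \<mu> \<nu> \<in> pmeas"
  unfolding measure_mix_eq_mixture[OF assms(1)]
  using assms by (intro mixture_in_prob_measures) (auto simp: UNIV_bool)

text \<open>\<open>\<Delta>\<close> has constant sign, since an affine function with values of both signs vanishes somewhere.
  Hence \<open>U\<close> maps segments to segments.\<close>

lemma ratio_measure_mix:
  assumes \<mu>: "\<mu> \<in> pmeas" and \<nu>: "\<nu> \<in> pmeas" and p: "p \<in> {0..1}"
  obtains t where "t \<in> {0..1}" "0 < p \<Longrightarrow> 0 < t" "U (measure_mix p \<mu> \<nu>) = t *\<^sub>R U \<mu> + (1 - t) *\<^sub>R U \<nu>"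
proof -
  have aff: "\<Delta> (measure_mix q \<mu> \<nu>) = q * \<Delta> \<mu> + (1 - q) * \<Delta> \<nu>" if "q \<in> {0..1}" for q
    using \<Delta>(2) \<mu> \<nu> that by (simp add: affine_on_measures_def)
  have sign: "0 < \<Delta> \<mu> / \<Delta> \<nu>"
  proof (rule ccontr)
    assume "\<not> 0 < \<Delta> \<mu> / \<Delta> \<nu>"
    then have opp: "\<Delta> \<mu> < 0 \<and> 0 < \<Delta> \<nu> \<or> 0 < \<Delta> \<mu> \<and> \<Delta> \<nu> < 0"
      using \<Delta>(3)[OF \<mu>] \<Delta>(3)[OF \<nu>] by (auto simp: zero_less_divide_iff not_less)
    \<comment> \<open>The weight at which the affine function \<open>\<Delta>\<close> would vanish
      on the segment; opposite signs place it in the unit interval.\<close>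
    define q where "q = \<Delta> \<nu> / (\<Delta> \<nu> - \<Delta> \<mu>)"
    have q: "q \<in> {0..1}" using opp by (auto simp: q_def field_simps)
    have "\<Delta> \<nu> - \<Delta> \<mu> \<noteq> 0" using opp by auto
    then have "q * \<Delta> \<mu> + (1 - q) * \<Delta> \<nu> = 0" by (simp add: q_def field_simps)
    then show False using aff[OF q] \<Delta>(3)[OF measure_mix_pmeas[OF \<mu> \<nu> q]] by simp
  qed
  define r where "r = \<Delta> \<mu> / \<Delta> \<nu>"
  have r: "0 < r" using sign by (simp add: r_def)
  have \<Delta>\<mu>: "\<Delta> \<mu> = r * \<Delta> \<nu>" using \<Delta>(3)[OF \<nu>] by (simp add: r_def)
  have den: "0 < p * r + (1 - p)"
  proof (cases "p = 0")
    case False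
    then have "0 < p * r" using p r by simp
    then show ?thesis using p by simp
  qed simp
  \<comment> \<open>In terms of \<open>\<Delta>\<close> this is
    \<open>p * \<Delta> \<mu> / \<Delta> (measure_mix p \<mu> \<nu>)\<close>: dividing by
    \<open>\<Delta>\<close> reweights the segment. Constant sign keeps \<open>t\<close> in the unit
    interval.\<close>
  define t where "t = p * r / (p * r + (1 - p))"
  have t1: "1 - t = (1 - p) / (p * r + (1 - p))" using den by (simp add: t_def field_simps)
  show ?thesis
  proof (rule that[of t])
    show "t \<in> {0..1}" using den p r t1 by (auto simp: t_def intro!: divide_nonneg_pos)
    show "0 < t" if "0 < p" using den r that by (simp add: t_def)
    have mix: "measure_mix p \<mu> \<nu> \<in> pmeas" using measure_mix_pmeas[OF \<mu> \<nu> p] .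
    have \<Delta>m: "\<Delta> (measure_mix p \<mu> \<nu>) = (p * r + (1 - p)) * \<Delta> \<nu>"
      unfolding aff[OF p] \<Delta>\<mu> by (simp add: algebra_simps)
    have \<Gamma>m: "\<Gamma> (measure_mix p \<mu> \<nu>) = p *\<^sub>R \<Gamma> \<mu> + (1 - p) *\<^sub>R \<Gamma> \<nu>"
      using \<Gamma>(2) \<mu> \<nu> p by (simp add: affine_on_measures_def)
    have "U (measure_mix p \<mu> \<nu>) = (p / ((p * r + (1 - p)) * \<Delta> \<nu>)) *\<^sub>R \<Gamma> \<mu> + ((1 - p) / ((p * r + (1 - p)) * \<Delta> \<nu>)) *\<^sub>R \<Gamma> \<nu>"
      unfolding U[OF mix] \<Delta>m \<Gamma>m by (simp add: scaleR_add_right divide_inverse mult.commute)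
    also have "p / ((p * r + (1 - p)) * \<Delta> \<nu>) = t / \<Delta> \<mu>"
    proof -
      have "p / (s * d) = p * r / s / (r * d)" for s d using r by simp
      then show ?thesis unfolding \<Delta>\<mu> t_def .
    qed
    also have "(1 - p) / ((p * r + (1 - p)) * \<Delta> \<nu>) = (1 - t) / \<Delta> \<nu>"
      unfolding t1 by simp
    finally show "U (measure_mix p \<mu> \<nu>) = t *\<^sub>R U \<mu> + (1 - t) *\<^sub>R U \<nu>"
      unfolding U[OF \<mu>] U[OF \<nu>] by (simp add: divide_inverse)
  qed
qed

text \<open>Induction peeling off one measure: the remaining ones, with weights renormalised by
  \<open>sum p I\<close>, form a mixture to be joined by \<open>measure_mix\<close>. If
  \<open>sum p I = 0\<close>, renormalisation is impossible, but then the mixture is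
  \<open>\<nu> j\<close> alone.\<close>

lemma ratio_mixture:
  assumes C: "convex C"
    and I: "finite I" and \<nu>: "\<And>i. i \<in> I \<Longrightarrow> \<nu> i \<in> pmeas" "\<And>i. i \<in> I \<Longrightarrow> U (\<nu> i) \<in> C"
    and p: "\<And>i. i \<in> I \<Longrightarrow> 0 \<le> p i" "sum p I = 1"
  shows "U (mixture (borel_algebra (string_topology G)) I p \<nu>) \<in> C"
proof -
  let ?B = "borel_algebra (string_topology G)"
  have C_mix: "U (measure_mix q \<mu> \<nu>) \<in> C" if m: "\<mu> \<in> pmeas" "\<nu> \<in> pmeas" "q \<in> {0..1}" "U \<mu> \<in> C" "U \<nu> \<in> C" for q \<mu> \<nu>
  proof -
    obtain t where t: "t \<in> {0..1}" "U (measure_mix q \<mu> \<nu>) = t *\<^sub>R U \<mu> + (1 - t) *\<^sub>R U \<nu>"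
      using ratio_measure_mix[OF m(1,2,3)] by blast
    show ?thesis unfolding t(2) using t(1) m(4,5) by (intro convexD[OF C]) auto
  qed
  show ?thesis using I \<nu> p
  proof (induction I arbitrary: p rule: finite_induct)
    case (insert j I)
    have mix: "mixture ?B (insert j I) p \<nu> \<in> pmeas" using insert.prems by (intro mixture_in_prob_measures)
    have m_insert: "measure (mixture ?B (insert j I) p \<nu>) D = (\<Sum>i\<in>insert j I. p i * measure (\<nu> i) D)"
      if "D \<in> cylinder_sets G" for D
      using insert.prems that by (intro measure_mixture_prob_measures cylinder_sets_in_borel)
    have pj: "p j + sum p I = 1" using insert by simp
    have pI: "0 \<le> sum p I" using insert.prems(3) by (intro sum_nonneg) simp
    show ?case
    proof (cases "sum p I = 0")
      case True
      then have "\<forall>i\<in>I. p i = 0" using insert by (simp add: sum_nonneg_eq_0_iff)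
      then have "mixture ?B (insert j I) p \<nu> = \<nu> j"
      proof (intro prob_measure_eqI[OF mix] insert.prems(1) insertI1)
        fix D assume "D \<in> cylinder_sets G"
        from m_insert[OF this] \<open>\<forall>i\<in>I. p i = 0\<close>
        show "measure (mixture ?B (insert j I) p \<nu>) D = measure (\<nu> j) D"
          using insert.hyps pj True by simp
      qed
      then show ?thesis using insert.prems(2)[of j] by simp
    next
      case False
      define q where "q = (\<lambda>i. p i / sum p I)"
      have q: "\<And>i. i \<in> I \<Longrightarrow> 0 \<le> q i" "sum q I = 1"
        using insert.prems(3) pI False by (auto simp: q_def simp flip: sum_divide_distrib)
      have \<nu>I: "\<And>i. i \<in> I \<Longrightarrow> \<nu> i \<in> pmeas" "\<And>i. i \<in> I \<Longrightarrow> U (\<nu> i) \<in> C" "\<nu> j \<in> pmeas" "U (\<nu> j) \<in> C"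
        using insert.prems(1,2) by auto
      have m: "mixture ?B I q \<nu> \<in> pmeas" using \<nu>I q by (intro mixture_in_prob_measures)
      have "mixture ?B (insert j I) p \<nu> = measure_mix (p j) (\<nu> j) (mixture ?B I q \<nu>)"
      proof (rule prob_measure_eqI[OF mix])
        show "measure_mix (p j) (\<nu> j) (mixture ?B I q \<nu>) \<in> pmeas"
          using \<nu>I m pj pI insert.prems(3)[of j] by (intro measure_mix_pmeas) auto
        fix D assume D: "D \<in> cylinder_sets G"
        have "measure (measure_mix (p j) (\<nu> j) (mixture ?B I q \<nu>)) D =
          p j * measure (\<nu> j) D + (1 - p j) * measure (mixture ?B I q \<nu>) D"
          unfolding measure_mix_eq_mixture[OF \<nu>I(3)] using \<nu>I m pj pI insert.prems(3)[of j]
          by (subst measure_mixture_prob_measures) (auto simp: UNIV_bool cylinder_sets_in_borel[OF D] split: if_splits)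
        also have "measure (mixture ?B I q \<nu>) D = (\<Sum>i\<in>I. q i * measure (\<nu> i) D)"
          using \<nu>I q by (intro measure_mixture_prob_measures cylinder_sets_in_borel[OF D])
        also have "(1 - p j) * (\<Sum>i\<in>I. q i * measure (\<nu> i) D) = (\<Sum>i\<in>I. p i * measure (\<nu> i) D)"
        proof -
          have "1 - p j = sum p I" using pj by simp
          then show ?thesis using False by (simp add: q_def sum_distrib_left)
        qed
        also have "p j * measure (\<nu> j) D + (\<Sum>i\<in>I. p i * measure (\<nu> i) D) = measure (mixture ?B (insert j I) p \<nu>) D"
          using insert.hyps by (simp add: m_insert[OF D])
        finally show "measure (mixture ?B (insert j I) p \<nu>) D = measure (measure_mix (p j) (\<nu> j) (mixture ?B I q \<nu>)) D"
          by simp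
      qed
      moreover have "U (mixture ?B I q \<nu>) \<in> C" using insert.IH[OF \<nu>I(1,2) q] by blast
      ultimately show ?thesis
        using C_mix[OF \<nu>I(3) m] \<nu>I(4) insert.prems(3)[of j] pj pI by auto
    qed
  qed simp
qed

lemma free_energy_measure_mix:
  assumes \<phi>: "continuous_map (string_topology G) euclideanreal \<phi>"
    and \<mu>: "\<mu> \<in> imeas" and \<nu>: "\<nu> \<in> imeas" and p: "p \<in> {0..1}"
  shows "measure_mix p \<mu> \<nu> \<in> imeas"
    and "p * (shift_entropy \<mu> + integral\<^sup>L \<mu> \<phi>) + (1 - p) * (shift_entropy \<nu> + integral\<^sup>L \<nu> \<phi>)
      \<le> shift_entropy (measure_mix p \<mu> \<nu>) + integral\<^sup>L (measure_mix p \<mu> \<nu>) \<phi>"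
proof -
  let ?p = "\<lambda>b. if b then p else 1 - p" and ?\<nu> = "\<lambda>b. if b then \<mu> else \<nu>"
  let ?m = "mixture (borel_algebra (string_topology G)) UNIV ?p ?\<nu>"
  have eq: "measure_mix p \<mu> \<nu> = ?m" by (rule measure_mix_eq_mixture[OF invariantD(1)[OF \<mu>]])
  have \<nu>': "\<And>b. ?\<nu> b \<in> imeas" and p': "\<And>b. 0 \<le> ?p b" "sum ?p UNIV = 1"
    using \<mu> \<nu> p by (auto simp: UNIV_bool)
  show "measure_mix p \<mu> \<nu> \<in> imeas" unfolding eq by (rule mixture_invariant[OF \<nu>' p'])
  have "p * shift_entropy \<mu> + (1 - p) * shift_entropy \<nu> \<le> shift_entropy ?m"
    using shift_entropy_mixture[of UNIV ?\<nu> ?p, OF \<nu>' p'] by (simp add: UNIV_bool add.commute)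
  moreover have "integral\<^sup>L ?m \<phi> = p * integral\<^sup>L \<mu> \<phi> + (1 - p) * integral\<^sup>L \<nu> \<phi>"
    using integral_mixture[of UNIV ?\<nu> ?p, OF invariantD(1)[OF \<nu>'] p' \<phi>] by (simp add: UNIV_bool add.commute)
  ultimately show "p * (shift_entropy \<mu> + integral\<^sup>L \<mu> \<phi>) + (1 - p) * (shift_entropy \<nu> + integral\<^sup>L \<nu> \<phi>)
      \<le> shift_entropy (measure_mix p \<mu> \<nu>) + integral\<^sup>L (measure_mix p \<mu> \<nu>) \<phi>"
    unfolding eq by (simp add: algebra_simps)
qed

text \<open>The measure \<open>\<mu>\<^sub>0\<close> is used twice: mixing with it pushes values of
  \<open>U\<close> into the interior, and its free energy keeps \<open>P\<close> above
  \<open>-\<infinity>\<close>.\<close>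

lemma multifractal_pressure:
  assumes C: "closed C" "convex C" and \<phi>: "continuous_map (string_topology G) euclideanreal \<phi>"
    and \<mu>\<^sub>0: "\<mu>\<^sub>0 \<in> imeas" "U \<mu>\<^sub>0 \<in> interior C"
  defines "P \<equiv> SUP \<mu>\<in>{\<mu> \<in> imeas. U \<mu> \<in> C}. KS_entropy \<mu> shift_map + ereal (integral\<^sup>L \<mu> \<phi>)"
  shows "(SUP \<mu>\<in>{\<mu> \<in> imeas. U \<mu> \<in> interior C}. KS_entropy \<mu> shift_map + ereal (integral\<^sup>L \<mu> \<phi>)) = P"
    and "lower_pressure G U C \<phi> = P" and "upper_pressure G U C \<phi> = P"
    and "- elog (fps_conv_radius (dyn_zeta G U C \<phi>)) = P"
proof -
  define F where "F = (\<lambda>\<mu>. shift_entropy \<mu> + integral\<^sup>L \<mu> \<phi>)"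
  let ?Z = "multifractal_sum G U C \<phi>"
  let ?X = "\<lambda>n. ereal (1 / real n) * elog (ereal (?Z n))"
  define Q where "Q = (SUP \<mu>\<in>{\<mu> \<in> imeas. U \<mu> \<in> interior C}. ereal (F \<mu>))"
  have Q_eq: "(SUP \<mu>\<in>{\<mu> \<in> imeas. U \<mu> \<in> interior C}. KS_entropy \<mu> shift_map + ereal (integral\<^sup>L \<mu> \<phi>)) = Q"
    unfolding Q_def F_def by (intro SUP_cong refl) (simp add: KS_entropy_eq)
  have P_eq: "P = (SUP \<mu>\<in>{\<mu> \<in> imeas. U \<mu> \<in> C}. ereal (F \<mu>))"
    unfolding P_def F_def by (intro SUP_cong refl) (simp add: KS_entropy_eq)
  have "Q \<le> P" unfolding P_eq Q_def using interior_subset[of C] by (intro SUP_subset_mono) auto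
  have "P \<le> Q"
    unfolding P_eq
  proof (rule SUP_least)
    fix \<mu> assume "\<mu> \<in> {\<mu> \<in> imeas. U \<mu> \<in> C}"
    then have \<mu>: "\<mu> \<in> imeas" "U \<mu> \<in> C" by auto
    \<comment> \<open>A positive share of \<open>\<mu>\<^sub>0\<close> suffices for the interior,
      and concavity of the free energy limits the loss, which vanishes as \<open>t\<close> tends to
      0.\<close>
    have le: "ereal (t * F \<mu>\<^sub>0 + (1 - t) * F \<mu>) \<le> Q" if t: "0 < t" "t < 1" for t
    proof -
      have t': "t \<in> {0..1}" using t by simp
      obtain s where s: "s \<in> {0..1}" "0 < s" "U (measure_mix t \<mu>\<^sub>0 \<mu>) = s *\<^sub>R U \<mu>\<^sub>0 + (1 - s) *\<^sub>R U \<mu>"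
        using ratio_measure_mix[OF invariantD(1)[OF \<mu>\<^sub>0(1)] invariantD(1)[OF \<mu>(1)] t'] t(1) by blast
      have "U (measure_mix t \<mu>\<^sub>0 \<mu>) \<in> interior C"
        unfolding s(3) using s by (intro interior_convex_combination C(2) \<mu>\<^sub>0 \<mu>) auto
      then have "ereal (F (measure_mix t \<mu>\<^sub>0 \<mu>)) \<le> Q"
        unfolding Q_def using free_energy_measure_mix(1)[OF \<phi> \<mu>\<^sub>0(1) \<mu>(1) t'] by (intro SUP_upper) auto
      moreover have "ereal (t * F \<mu>\<^sub>0 + (1 - t) * F \<mu>) \<le> ereal (F (measure_mix t \<mu>\<^sub>0 \<mu>))"
        unfolding F_def ereal_less_eq by (rule free_energy_measure_mix(2)[OF \<phi> \<mu>\<^sub>0(1) \<mu>(1) t'])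
      ultimately show ?thesis by (rule order_trans[rotated])
    qed
    have "((\<lambda>t. ereal (t * F \<mu>\<^sub>0 + (1 - t) * F \<mu>)) \<longlongrightarrow> ereal (0 * F \<mu>\<^sub>0 + (1 - 0) * F \<mu>)) (at_right 0)"
      by (intro tendsto_intros)
    moreover have "\<forall>\<^sub>F t in at_right 0. ereal (t * F \<mu>\<^sub>0 + (1 - t) * F \<mu>) \<le> Q"
      using eventually_at_right_real[OF zero_less_one] by eventually_elim (auto intro: le)
    ultimately have "ereal (0 * F \<mu>\<^sub>0 + (1 - 0) * F \<mu>) \<le> Q"
      by (rule tendsto_upperbound) simp
    then show "ereal (F \<mu>) \<le> Q" by simp
  qed
  with \<open>Q \<le> P\<close> have "Q = P" by simp
  then show "(SUP \<mu>\<in>{\<mu> \<in> imeas. U \<mu> \<in> interior C}. KS_entropy \<mu> shift_map + ereal (integral\<^sup>L \<mu> \<phi>)) = P"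
    unfolding Q_eq .
  have low: "P \<le> liminf ?X"
    unfolding \<open>Q = P\<close>[symmetric] Q_def
  proof (rule SUP_least)
    fix \<mu> assume "\<mu> \<in> {\<mu> \<in> imeas. U \<mu> \<in> interior C}"
    then have \<mu>: "\<mu> \<in> imeas" "U \<mu> \<in> interior C" by auto
    show "ereal (F \<mu>) \<le> liminf ?X"
    proof (rule ereal_le_epsilon2)
      fix e :: real assume e: "0 < e"
      have "\<forall>\<^sub>F n in sequentially. exp (real n * (shift_entropy \<mu> + integral\<^sup>L \<mu> \<phi> - e)) \<le> ?Z n"
        using \<mu> invariantD(1)[OF \<mu>(1)] interior_subset[of C]
        by (intro multifractal_sum_lower[OF \<phi> \<mu>(1) openin_ratio[OF open_interior] _ _ e]) auto
      then have "\<forall>\<^sub>F n in sequentially. ereal (F \<mu> - e) \<le> ?X n"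
        using eventually_gt_at_top[of "0::nat"]
      proof eventually_elim
        case (elim n)
        have Z: "0 < ?Z n" using elim(1) exp_gt_zero less_le_trans by blast
        have "real n * (F \<mu> - e) \<le> ln (?Z n)"
          using elim(1) Z by (simp add: F_def ln_ge_iff)
        then have "F \<mu> - e \<le> 1 / real n * ln (?Z n)" using elim(2) by (simp add: field_simps)
        then show ?case using Z by (simp add: elog_def)
      qed
      then have "ereal (F \<mu> - e) \<le> liminf ?X" by (rule Liminf_bounded)
      then have "ereal (F \<mu> - e) + ereal e \<le> liminf ?X + ereal e" by (rule add_right_mono)
      then show "ereal (F \<mu>) \<le> liminf ?X + ereal e" by simp
    qed
  qed
  have closed: "openin (weak_topology (string_topology G)) {\<nu> \<in> pmeas. U \<nu> \<notin> C}"
    using openin_ratio[of "- C"] C(1) by (simp add: open_Compl)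
  have up: "limsup ?X \<le> P"
  proof (rule ccontr)
    assume "\<not> limsup ?X \<le> P"
    then have "P < limsup ?X" by (simp only: not_le)
    \<comment> \<open>A level strictly between the two is real, because \<open>P\<close> is at least
      the free energy of \<open>\<mu>\<^sub>0\<close>. It is exceeded for infinitely many
      \<open>n\<close>, so \<open>exists_equilibrium\<close> produces a measure contradicting
      \<open>P < c'\<close>.\<close>
    from dense[OF this] obtain c' where c': "P < c'" "c' < limsup ?X" by blast
    have "ereal (F \<mu>\<^sub>0) \<le> P"
      unfolding P_eq using \<mu>\<^sub>0 interior_subset[of C] by (intro SUP_upper) auto
    then obtain c where c: "c' = ereal c" using c' by (cases c') auto
    have "\<exists>\<^sub>F n in sequentially. ereal c < ?X n"
    proof (rule ccontr)
      assume "\<not> (\<exists>\<^sub>F n in sequentially. ereal c < ?X n)"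
      then have "\<forall>\<^sub>F n in sequentially. ?X n \<le> ereal c" by (simp add: not_frequently not_less)
      then have "limsup ?X \<le> ereal c" by (rule Limsup_bounded)
      then show False using c'(2) c by simp
    qed
    then have "\<exists>\<^sub>F n in sequentially. ereal c < ?X n \<and> 0 < n"
      using eventually_gt_at_top[of "0::nat"] by (rule frequently_eventually_frequently)
    then have "\<exists>\<^sub>F n in sequentially. exp (real n * c) < ?Z n"
    proof (rule frequently_elim1)
      fix n assume n: "ereal c < ?X n \<and> 0 < n"
      then have Z: "0 < ?Z n" by (auto simp: elog_def split: if_splits)
      then have "c < 1 / real n * ln (?Z n)" using n by (simp add: elog_def)
      then have "real n * c < ln (?Z n)" using n by (simp add: field_simps)
      then have "exp (real n * c) < exp (ln (?Z n))" by (simp only: exp_less_cancel_iff)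
      then show "exp (real n * c) < ?Z n" using Z by simp
    qed
    from exists_equilibrium[OF \<phi> ratio_mixture[OF C(2)] closed this]
    obtain \<mu> where "\<mu> \<in> imeas" "U \<mu> \<in> C" "c \<le> F \<mu>" unfolding F_def by blast
    then have "ereal c \<le> P" unfolding P_eq by (intro SUP_upper2[of \<mu>]) auto
    then show False using c'(1) c by simp
  qed
  have le: "liminf ?X \<le> limsup ?X" by (intro Liminf_le_Limsup) simp
  show "lower_pressure G U C \<phi> = P" and "upper_pressure G U C \<phi> = P"
    unfolding lower_pressure_def upper_pressure_def using low up le by auto
  have lim: "?X \<longlonglongrightarrow> P"
    using low up le by (intro Liminf_eq_Limsup) auto
  have "ereal (F \<mu>\<^sub>0) \<le> P"
    unfolding P_eq using \<mu>\<^sub>0 interior_subset[of C] by (intro SUP_upper) auto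
  \<comment> \<open>The root test needs a real limit. From above, entropy is bounded by the
    logarithm of the number of arcs, and \<open>\<phi>\<close> is bounded by compactness.\<close>
  moreover have "\<exists>M. P \<le> ereal M"
  proof -
    obtain M where M: "\<And>u. u \<in> strings G \<Longrightarrow> \<bar>\<phi> u\<bar> \<le> M"
      using continuous_map_bounded[OF finite_arcs \<phi>] by blast
    have "F \<mu> \<le> ln (real (card (arcs G))) + M" if \<mu>: "\<mu> \<in> imeas" for \<mu>
    proof -
      have pm: "\<mu> \<in> pmeas" using invariantD(1)[OF \<mu>] .
      interpret prob_space \<mu> using pm by (rule prob_measures_prob_space)
      have "shift_entropy \<mu> \<le> ln (real (card (arcs G)))"
      proof (rule LIMSEQ_le_const2[OF shift_entropy_tendsto[OF \<mu>]], intro exI allI impI)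
        fix n :: nat assume "1 \<le> n"
        then show "word_entropy \<mu> n / real n \<le> ln (real (card (arcs G)))"
          using word_entropy_le[OF pm, of n] by (simp add: field_simps)
      qed
      moreover have "integral\<^sup>L \<mu> \<phi> \<le> (\<integral>u. M \<partial>\<mu>)"
      proof (rule integral_mono)
        show "integrable \<mu> \<phi>"
          using M continuous_map_borel_measurable[OF pm \<phi>]
          by (intro integrable_const_bound[of _ M]) (auto simp: prob_measures_space[OF pm])
      qed (use M in \<open>auto simp: prob_measures_space[OF pm] abs_le_iff\<close>)
      ultimately show ?thesis by (simp add: F_def prob_space)
    qed
    then have "P \<le> ereal (ln (real (card (arcs G))) + M)"
      unfolding P_eq by (intro SUP_least) auto
    then show ?thesis by blast
  qed
  ultimately obtain p where p: "P = ereal p" by (cases P) auto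
  show "- elog (fps_conv_radius (dyn_zeta G U C \<phi>)) = P"
    unfolding p by (rule multifractal_radius) (use lim p in simp)
qed

end

end

theorem theorem4p6:
  fixes G :: "('v, 'e) pre_digraph"
    and \<Gamma> :: "(nat \<Rightarrow> 'e) measure \<Rightarrow> 'x::real_normed_vector"
    and \<Delta> :: "(nat \<Rightarrow> 'e) measure \<Rightarrow> real"
    and U :: "(nat \<Rightarrow> 'e) measure \<Rightarrow> 'x"
    and C :: "'x set"
    and \<phi> :: "(nat \<Rightarrow> 'e) \<Rightarrow> real"
  assumes "fin_digraph G" and "strongly_connected G"
    and "continuous_map (weak_topology (string_topology G)) euclidean \<Gamma>"
    and "affine_on_measures (string_topology G) \<Gamma>"
    and "continuous_map (weak_topology (string_topology G)) euclideanreal \<Delta>"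
    and "affine_on_measures (string_topology G) \<Delta>"
    and "\<And>\<mu>. \<mu> \<in> prob_measures (string_topology G) \<Longrightarrow> \<Delta> \<mu> \<noteq> 0"
    and "\<And>\<mu>. \<mu> \<in> prob_measures (string_topology G) \<Longrightarrow> U \<mu> = \<Gamma> \<mu> /\<^sub>R \<Delta> \<mu>"
    and "closed C" and "convex C"
    and "interior C \<inter> U ` invariant_measures (string_topology G) shift_map \<noteq> {}"
    and "continuous_map (string_topology G) euclideanreal \<phi>"
  shows
    "(lower_pressure G U C \<phi> = upper_pressure G U C \<phi> \<and>
      upper_pressure G U C \<phi> =
        (SUP \<mu> \<in> {\<mu> \<in> invariant_measures (string_topology G) shift_map. U \<mu> \<in> C}.
           KS_entropy \<mu> shift_map + ereal (integral\<^sup>L \<mu> \<phi>)) \<and>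
      upper_pressure G U C \<phi> =
        (SUP \<mu> \<in> {\<mu> \<in> invariant_measures (string_topology G) shift_map. U \<mu> \<in> interior C}.
           KS_entropy \<mu> shift_map + ereal (integral\<^sup>L \<mu> \<phi>))) \<and>
     (- elog (fps_conv_radius (dyn_zeta G U C \<phi>)) =
        (SUP \<mu> \<in> {\<mu> \<in> invariant_measures (string_topology G) shift_map. U \<mu> \<in> C}.
           KS_entropy \<mu> shift_map + ereal (integral\<^sup>L \<mu> \<phi>)) \<and>
      - elog (fps_conv_radius (dyn_zeta G U C \<phi>)) =
        (SUP \<mu> \<in> {\<mu> \<in> invariant_measures (string_topology G) shift_map. U \<mu> \<in> interior C}.
           KS_entropy \<mu> shift_map + ereal (integral\<^sup>L \<mu> \<phi>)))"
proof -
  obtain \<mu>\<^sub>0 where \<mu>0: "\<mu>\<^sub>0 \<in> invariant_measures (string_topology G) shift_map" "U \<mu>\<^sub>0 \<in> interior C"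
    using assms(11) by blast
  then have pm: "\<mu>\<^sub>0 \<in> prob_measures (string_topology G)" by (simp add: invariant_measures_def)
  \<comment> \<open>The string space carries a probability measure, hence has a point; this excludes
    the vertex without edges.\<close>
  have "strings G \<noteq> {}"
    using prob_space.not_empty[OF prob_measures_prob_space[OF pm]] prob_measures_space[OF pm] by simp
  then have "arcs G \<noteq> {}" by (auto simp: strings_def)
  then interpret string_graph G
    using assms(1,2) by (simp add: string_graph_def string_graph_axioms_def)
  note main = multifractal_pressure[OF assms(3-10,12) \<mu>0]
  show ?thesis by (simp only: main)
qed

end
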